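(* Every tile of a quadrilateral tiling of the sphere $S^2$ is either $Q$ or $Q_{13}$. Moreover, every quadrilateral tiling of the sphere is (pentagonally) subdivisible.
   Context: A tiling of a compact connected surface without boundary is a graph embedded in the surface such that the complementary regions (tiles) are open disks; tilings are edge-to-edge, every vertex has degree at least $3$, every tile has at least $3$ edges, and tiles may be degenerate (their boundary need not be a simple closed curve). A quadrilateral tiling has $4$ edges along the boundary of each tile. Label the four corners of a quadrilateral tile cyclically $1,2,3,4$. $Q$ denotes a non-degenerate quadrilateral tile (no identification of vertices or edges). $Q_{13}$ denotes the degenerate quadrilateral tile in which the two opposite corners $1$ and $3$ are the same vertex, and there are no other identifications of vertices or edges. A simple pentagonal subdivision of a quadrilateral tiling is obtained by placing a new vertex at the middle point of every edge and, inside each tile, joining by an arc the middle points of one of the two pairs of opposite edges of the tile, such that the middle point of each edge is used exactly once. A quadrilateral tiling is (pentagonally) subdivisible if it admits a simple pentagonal subdivision. *)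

theory Defs
  imports "HOL-Analysis.Analysis"
begin

text \<open>An edge is a simple path, so it may be a loop; it is represented by one chosen
  parametrization, and its middle point is the value at \<open>1/2\<close>.\<close>

definition open_edge :: "(real \<Rightarrow> 'a) \<Rightarrow> 'a set" where
  "open_edge g = g ` {0<..<1}"

definition edge_midpoint :: "(real \<Rightarrow> 'a) \<Rightarrow> 'a" where
  "edge_midpoint g = g (1/2)"

definition embedded_graph ::
    "'a::topological_space set \<Rightarrow> 'a set \<Rightarrow> (real \<Rightarrow> 'a) set \<Rightarrow> bool" where
  "embedded_graph S V E \<longleftrightarrow>
     finite V \<and> V \<subseteq> S \<and> finite E \<and>
     (\<forall>g\<in>E. simple_path g \<and> path_image g \<subseteq> S \<and>
            pathstart g \<in> V \<and> pathfinish g \<in> V \<and> open_edge g \<inter> V = {}) \<and>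
     (\<forall>g\<in>E. \<forall>h\<in>E. g \<noteq> h \<longrightarrow> open_edge g \<inter> open_edge h = {})"

text \<open>Loops count twice.\<close>

definition vertex_degree :: "(real \<Rightarrow> 'a::topological_space) set \<Rightarrow> 'a \<Rightarrow> nat" where
  "vertex_degree E v = card {g\<in>E. pathstart g = v} + card {g\<in>E. pathfinish g = v}"

definition tiles ::
    "'a::topological_space set \<Rightarrow> 'a set \<Rightarrow> (real \<Rightarrow> 'a) set \<Rightarrow> 'a set set" where
  "tiles S V E = components (S - (V \<union> (\<Union>g\<in>E. path_image g)))"

text \<open>The closed unit disk serves as the model \<open>n\<close>-gon, its boundary circle being divided
  into \<open>n\<close> open sides by \<open>n\<close> corners. Side \<open>i\<close> runs from corner \<open>i\<close> to
  corner \<open>i + 1\<close>, indices being counted from \<open>0\<close>.\<close>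

definition corner :: "nat \<Rightarrow> nat \<Rightarrow> complex" where
  "corner n i = cis (2 * pi * real i / real n)"

definition side :: "nat \<Rightarrow> nat \<Rightarrow> complex set" where
  "side n i = cis ` {2 * pi * real i / real n <..< 2 * pi * real (Suc i) / real n}"

text \<open>\<open>polygon_map V E n T c\<close>: the tile \<open>T\<close> has \<open>n\<close> edges along its boundary, and
  \<open>c\<close> exhibits this. It extends a homeomorphism from the open disk onto \<open>T\<close> continuously
  to the boundary circle, which it wraps around the boundary of \<open>T\<close>, each side covering a
  whole edge (so tilings are edge-to-edge). Different corners or sides may have the same
  image: these are the identifications in a degenerate tile. The choice of \<open>c\<close>
  labels the corners of the tile cyclically.\<close>

definition polygon_map ::
    "'a::topological_space set \<Rightarrow> (real \<Rightarrow> 'a) set \<Rightarrow> nat \<Rightarrow> 'a set \<Rightarrow> (complex \<Rightarrow> 'a) \<Rightarrow> bool" where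
  "polygon_map V E n T c \<longleftrightarrow>
     continuous_on (cball 0 1) c \<and>
     (\<exists>d. homeomorphism (ball 0 1) T c d) \<and>
     (\<forall>i<n. c (corner n i) \<in> V) \<and>
     (\<forall>i<n. inj_on c (side n i) \<and> (\<exists>g\<in>E. c ` side n i = open_edge g))"

text \<open>Intended for a compact connected surface \<open>S\<close> without boundary.\<close>

definition tiling ::
    "'a::topological_space set \<Rightarrow> 'a set \<Rightarrow> (real \<Rightarrow> 'a) set \<Rightarrow> bool" where
  "tiling S V E \<longleftrightarrow>
     embedded_graph S V E \<and>
     (\<forall>v\<in>V. vertex_degree E v \<ge> 3) \<and>
     (\<forall>T\<in>tiles S V E. T homeomorphic ball (0::complex) 1 \<and>
                       (\<exists>n\<ge>3. \<exists>c. polygon_map V E n T c))"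

definition quadrilateral_tiling ::
    "'a::topological_space set \<Rightarrow> 'a set \<Rightarrow> (real \<Rightarrow> 'a) set \<Rightarrow> bool" where
  "quadrilateral_tiling S V E \<longleftrightarrow>
     tiling S V E \<and> (\<forall>T\<in>tiles S V E. \<exists>c. polygon_map V E 4 T c)"

definition is_Q ::
    "'a::topological_space set \<Rightarrow> (real \<Rightarrow> 'a) set \<Rightarrow> 'a set \<Rightarrow> bool" where
  "is_Q V E T \<longleftrightarrow>
     (\<exists>c. polygon_map V E 4 T c \<and>
          (\<forall>i<4. \<forall>j<4. i \<noteq> j \<longrightarrow> c (corner 4 i) \<noteq> c (corner 4 j)) \<and>
          (\<forall>i<4. \<forall>j<4. i \<noteq> j \<longrightarrow> c ` side 4 i \<noteq> c ` side 4 j))"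

text \<open>The customary corner labels \<open>1, 2, 3, 4\<close> are the indices \<open>0, 1, 2, 3\<close> here, so
  the corners \<open>1\<close> and \<open>3\<close> have indices \<open>0\<close> and \<open>2\<close>.\<close>

definition is_Q13 ::
    "'a::topological_space set \<Rightarrow> (real \<Rightarrow> 'a) set \<Rightarrow> 'a set \<Rightarrow> bool" where
  "is_Q13 V E T \<longleftrightarrow>
     (\<exists>c. polygon_map V E 4 T c \<and>
          c (corner 4 0) = c (corner 4 2) \<and>
          (\<forall>i<4. \<forall>j<4. i \<noteq> j \<and> {i, j} \<noteq> {0, 2} \<longrightarrow> c (corner 4 i) \<noteq> c (corner 4 j)) \<and>
          (\<forall>i<4. \<forall>j<4. i \<noteq> j \<longrightarrow> c ` side 4 i \<noteq> c ` side 4 j))"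

text \<open>The arc drawn inside the tile \<open>T\<close> is \<open>c T \<circ> p T\<close>. It is given by the path \<open>p T\<close> in
  the model disk, because in a degenerate tile the edge containing an end point of the
  arc does not determine the side of the tile from which the end point is reached. The
  last conjunct says that each middle point of an edge is hit by exactly one of the two
  ends of exactly one of the arcs.\<close>

definition simple_pentagonal_subdivision ::
    "'a::topological_space set \<Rightarrow> 'a set \<Rightarrow> (real \<Rightarrow> 'a) set \<Rightarrow>
     ('a set \<Rightarrow> complex \<Rightarrow> 'a) \<Rightarrow> ('a set \<Rightarrow> real \<Rightarrow> complex) \<Rightarrow> bool" where
  "simple_pentagonal_subdivision S V E c p \<longleftrightarrow>
     (\<forall>T\<in>tiles S V E.
        polygon_map V E 4 T (c T) \<and>
        arc (p T) \<and> p T ` {0<..<1} \<subseteq> ball 0 1 \<and>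
        (\<exists>i\<in>{0, 1}. pathstart (p T) \<in> side 4 i \<and> pathfinish (p T) \<in> side 4 (i + 2)) \<and>
        c T (pathstart (p T)) \<in> edge_midpoint ` E \<and>
        c T (pathfinish (p T)) \<in> edge_midpoint ` E) \<and>
     (\<forall>g\<in>E. card {(T, b). T \<in> tiles S V E \<and> b \<in> {0, 1} \<and> c T (p T b) = edge_midpoint g} = 1)"

definition subdivisible ::
    "'a::topological_space set \<Rightarrow> 'a set \<Rightarrow> (real \<Rightarrow> 'a) set \<Rightarrow> bool" where
  "subdivisible S V E \<longleftrightarrow> (\<exists>c p. simple_pentagonal_subdivision S V E c p)"

end

theory Submission
  imports Defs "HOL-Complex_Analysis.Winding_Numbers" "HOL-Real_Asymp.Real_Asymp"
begin

text \<open>By invariance of domain, every edge is met by exactly two tile sides (a side on its own would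
  be a boundary, three sides would not fit). If a simple closed curve consists of a set \<open>K\<close> of edges,
  then counting the sides of the tiles on one of its sides gives \<open>4 n = |K| + 2 m\<close>, so \<open>|K|\<close> is even,
  and the vertices have a proper 2-colouring. Hence consecutive corners of a tile differ.
  If both pairs of opposite corners of a tile coincided, the image of one diagonal would be a Jordan
  curve with both of its sides joined through the ends of the other diagonal. Two consecutive
  sides on the same edge would enclose a vertex of degree 1.

  For the subdivision, each tile gets an orientation sign, the jump of the winding number of its
  boundary loop (seen in a planar chart of the sphere) at its boundary. After correcting by these
  signs, the two tile sides at an edge run in opposite directions. In each tile select the two
  sides that run from colour \<open>True\<close> to colour \<open>False\<close> when the boundary is traversed positively. They are opposite
  sides, and at every edge exactly one of the two tile sides is selected.\<close>

section \<open>Topology of the sphere\<close>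

text \<open>Edges and boundary maps are merely continuous, so no cyclic order of the edges around a
  vertex is at hand. Local information comes from a strip along an open edge, formed by a quarter of
  the tile at each of its two sides; the rest is separation and connectedness. In the parity count,
  an edge of \<open>K\<close> has one tile side on each side of the curve, while the two tile sides
  at any other edge lie together; \<open>m\<close> counts those other edges on the chosen side. Two
  opposite sides on the same edge are excluded by the colours: matching their ends would make both
  pairs of opposite corners coincide. So the sides of a tile lie on distinct edges, and the two tile
  sides at an edge belong to two different tiles, which the comparison of signs presupposes. The
  boundary of a degenerate tile is not a Jordan curve. Its winding numbers are therefore found on
  the circle of radius 1/2 in the model disk, whose image is one, and carried to the boundary by a
  homotopy. The pole of the chart must avoid the graph, hence it lies in some tile.\<close>

definition S2 :: "(real ^ 3) set" where "S2 = sphere 0 1"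

text \<open>Stereographic projection. The Jordan curve theorem and winding numbers concern the
  complex plane, so the arguments on the sphere reach them through such a chart.\<close>

lemma sphere_chart:
  assumes "p \<in> S2"
  obtains h k where "homeomorphism (S2 - {p}) (UNIV :: complex set) h k"
proof -
  let ?H = "{x :: real ^ 3. axis 1 1 \<bullet> x = 0}"
  have nz: "(axis 1 1 :: real ^ 3) \<noteq> 0"
    by (simp add: axis_eq_0_iff)
  have 1: "(S2 - {p}) homeomorphic ?H"
    using homeomorphic_punctured_sphere_hyperplane[OF _ assms[unfolded S2_def] nz] by (simp add: S2_def)
  have "?H homeomorphic (UNIV :: complex set)"
    using nz by (intro homeomorphic_affine_sets) (auto simp: affine_hyperplane aff_dim_hyperplane)
  with 1 have "(S2 - {p}) homeomorphic (UNIV :: complex set)"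
    using homeomorphic_trans by blast
  then show ?thesis
    using that unfolding homeomorphic_def by blast
qed

lemma sphere_two_points: obtains p q where "p \<in> S2" "q \<in> S2" "p \<noteq> q"
proof
  show "axis 1 1 \<in> S2" "axis 2 1 \<in> S2" by (auto simp: S2_def norm_axis_1)
  show "(axis 1 1 :: real ^ 3) \<noteq> axis 2 1" by (simp add: axis_eq_axis)
qed

lemma openin_sphere_image_plane:
  fixes d :: "real ^ 3 \<Rightarrow> complex"
  assumes "openin (top_of_set S2) W" "continuous_on W d" "inj_on d W"
  shows "open (d ` W)"
proof -
  have "openin (top_of_set UNIV) (d ` W)"
    using assms by (intro invariance_of_domain_sphere_affine_set[where r=1 and a=0]) (auto simp: S2_def)
  then show ?thesis by simp
qed

lemma openin_sphere_diff_point: "openin (top_of_set S2) (S2 - {p})"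
  by (simp add: openin_delete)

text \<open>Invariance of domain from the plane to the sphere. A chart misses its pole, so planar
  invariance of domain only gives openness of the image without the pole; two different poles
  together give the whole image.\<close>

lemma open_plane_image_sphere:
  fixes f :: "complex \<Rightarrow> real ^ 3"
  assumes U: "open U" and f: "continuous_on U f" "inj_on f U" "f ` U \<subseteq> S2"
  shows "openin (top_of_set S2) (f ` U)"
proof -
  have *: "openin (top_of_set S2) (f ` U - {p})" if p: "p \<in> S2" for p
  proof -
    obtain h k where hk: "homeomorphism (S2 - {p}) (UNIV :: complex set) h k"
      using sphere_chart[OF p] .
    let ?U = "U - {x \<in> U. f x = p}"
    have fU: "f ` ?U = f ` U - {p}" by auto
    have "openin (top_of_set U) (U - f -` {p} \<inter> U)"
      using continuous_closedin_preimage[OF f(1), of "{p}"] by (auto intro: openin_diff simp: Int_commute)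
    then have "openin (top_of_set U) ?U"
      by (rule back_subst[where P="openin (top_of_set U)"]) auto
    then have oU: "open ?U"
      using U openin_open_trans by blast
    have sub: "f ` ?U \<subseteq> S2 - {p}" using f(3) by auto
    have "open ((h \<circ> f) ` ?U)"
    proof (rule invariance_of_domain[OF _ oU])
      show "continuous_on ?U (h \<circ> f)"
      proof (rule continuous_on_compose)
        show "continuous_on ?U f" using f(1) continuous_on_subset by blast
        show "continuous_on (f ` ?U) h"
          using homeomorphism_cont1[OF hk] sub continuous_on_subset by blast
      qed
      show "inj_on (h \<circ> f) ?U"
      proof (rule comp_inj_on)
        show "inj_on f ?U" using f(2) inj_on_subset by blast
        show "inj_on h (f ` ?U)"
          using homeomorphism_apply1[OF hk] sub by (intro inj_on_inverseI[of _ k]) blast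
      qed
    qed
    then have "openin (top_of_set (S2 - {p})) (k ` ((h \<circ> f) ` ?U))"
      using homeomorphism_imp_open_map[OF homeomorphism_symD[OF hk]] by auto
    moreover have "k ` ((h \<circ> f) ` ?U) = f ` U - {p}"
    proof -
      have "k (h y) = y" if "y \<in> f ` ?U" for y
        using that sub hk by (meson homeomorphism_apply1 subsetD)
      then have "k ` ((h \<circ> f) ` ?U) = f ` ?U" 
        by (force simp: image_image)
      then show ?thesis using fU by simp
    qed
    ultimately show ?thesis
      using openin_trans[OF _ openin_sphere_diff_point] by (auto simp only:)
  qed
  obtain p q where "p \<in> S2" "q \<in> S2" "p \<noteq> q" using sphere_two_points .
  then have "openin (top_of_set S2) ((f ` U - {p}) \<union> (f ` U - {q}))"
    using * by (intro openin_Un) auto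
  moreover have "(f ` U - {p}) \<union> (f ` U - {q}) = f ` U" using \<open>p \<noteq> q\<close> by auto
  ultimately show ?thesis by simp
qed

text \<open>Removing a point from a small disk does not disconnect it. This is the only fact used
  about the sphere near a vertex, in \<open>no_fold\<close>.\<close>

lemma sphere_punctured_nbhd:
  assumes "openin (top_of_set S2) B" "v \<in> B"
  obtains B' where "openin (top_of_set S2) B'" "v \<in> B'" "B' \<subseteq> B" "connected (B' - {v})" "B' \<noteq> {v}"
proof -
  obtain p where p: "p \<in> S2" "p \<noteq> v" using sphere_two_points by metis
  obtain h k where hk: "homeomorphism (S2 - {p}) (UNIV :: complex set) h k"
    using sphere_chart[OF p(1)] .
  have hk': "homeomorphism UNIV (S2 - {p}) k h" using homeomorphism_symD[OF hk] .
  have BS: "B \<subseteq> S2" using assms openin_imp_subset by blast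
  have vS: "v \<in> S2 - {p}" using assms BS p by auto
  have "openin (top_of_set (S2 - {p})) (B - {p})"
  proof (rule openin_subset_trans)
    show "openin (top_of_set S2) (B - {p})" using assms(1) by (simp add: openin_delete)
  qed (use BS in auto)
  then have "openin (top_of_set UNIV) (h ` (B - {p}))"
    using homeomorphism_imp_open_map[OF hk] by auto
  then have "open (h ` (B - {p}))" by simp
  moreover have "h v \<in> h ` (B - {p})" using assms p by auto
  ultimately obtain e where e: "e > 0" "ball (h v) e \<subseteq> h ` (B - {p})"
    using open_contains_ball by metis
  have kh: "k (h y) = y" if "y \<in> S2 - {p}" for y
    using hk homeomorphism_apply1[OF hk that] by simp
  have hk_id: "h (k y) = y" for y using homeomorphism_apply2[OF hk] by auto
  define B' where "B' = k ` ball (h v) e"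
  show ?thesis
  proof
    have "openin (top_of_set (S2 - {p})) B'"
      unfolding B'_def using homeomorphism_imp_open_map[OF hk', of "ball (h v) e"] by simp
    then show "openin (top_of_set S2) B'"
      using openin_trans[OF _ openin_sphere_diff_point] by (auto simp only:)
    show "v \<in> B'" unfolding B'_def using kh[OF vS] e by (metis centre_in_ball image_eqI)
    show "B' \<subseteq> B"
    proof -
      have "B' \<subseteq> k ` h ` (B - {p})" unfolding B'_def using e by blast
      also have "\<dots> \<subseteq> B" using kh BS by (auto simp: subset_eq)
      finally show ?thesis .
    qed
    have inj: "inj k" using hk_id by (metis injI)
    have eq: "B' - {v} = k ` (ball (h v) e - {h v})"
      unfolding B'_def using inj kh[OF vS] by (auto simp: inj_def) 
    have "connected (ball (h v) e - {h v})"
      by (rule connected_punctured_convex) (use e in \<open>auto simp: aff_dim_open\<close>)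
    then show "connected (B' - {v})"
      unfolding eq
      using homeomorphism_cont1[OF hk'] by (intro connected_continuous_image) (auto intro: continuous_on_subset)
    have "h v + of_real (e/2) \<in> ball (h v) e" using e by (simp add: dist_norm)
    then have "k (h v + of_real (e/2)) \<in> B'" unfolding B'_def by blast
    moreover have "k (h v + of_real (e/2)) \<noteq> v"
    proof
      assume "k (h v + of_real (e/2)) = v"
      then have "h v + of_real (e/2) = h v" using hk_id by metis
      then show False using e by simp
    qed
    ultimately show "B' \<noteq> {v}" by blast
  qed
qed

text \<open>The point \<open>p\<close> off the curve is the pole of a chart in which the planar
  theorem applies. What is recorded is a separation into two open sets that both accumulate at every
  point of the curve; connected sets off the curve are then placed on one side.\<close>

lemma Jordan_sphere:
  fixes J :: "real \<Rightarrow> real ^ 3"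
  assumes J: "simple_path J" "pathfinish J = pathstart J" "path_image J \<subseteq> S2"
    and p: "p \<in> S2" "p \<notin> path_image J"
  obtains A B where "openin (top_of_set S2) A" "openin (top_of_set S2) B" "A \<inter> B = {}"
    "A \<union> B = S2 - path_image J" "path_image J \<subseteq> closure A" "path_image J \<subseteq> closure B"
proof -
  obtain h k where hk: "homeomorphism (S2 - {p}) (UNIV :: complex set) h k"
    using sphere_chart[OF p(1)] .
  have hk': "homeomorphism UNIV (S2 - {p}) k h" using homeomorphism_symD[OF hk] .
  have kh: "k (h y) = y" if "y \<in> S2 - {p}" for y
    using hk homeomorphism_apply1[OF hk that] by simp
  have hk_id: "h (k y) = y" for y using homeomorphism_apply2[OF hk] by auto
  have JS: "path_image J \<subseteq> S2 - {p}" using J p by auto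
  let ?c = "h \<circ> J"
  have pc: "path_image ?c = h ` path_image J" by (auto simp: path_image_def)
  have sc: "simple_path ?c"
  proof (rule simple_path_continuous_image[OF J(1)])
    show "continuous_on (path_image J) h"
      using hk JS by (meson continuous_on_subset homeomorphism_def)
    show "inj_on h (path_image J)"
      using kh JS by (metis inj_on_inverseI subset_eq)
  qed
  have cl: "pathfinish ?c = pathstart ?c" using J(2) by (simp add: pathfinish_def pathstart_def)
  note JIO = Jordan_inside_outside[OF sc cl]
  have kc: "continuous_on X k" for X
    using hk' by (auto simp: homeomorphism_def intro: continuous_on_subset)
  have kim: "k y \<in> S2" "k y \<noteq> p" for y using homeomorphism_image1[OF hk'] by auto
  have op: "openin (top_of_set S2) (k ` X)" if "open X" for X
  proof (rule openin_trans[OF _ openin_sphere_diff_point])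
    show "openin (top_of_set (S2 - {p})) (k ` X)"
      using homeomorphism_imp_open_map[OF hk', of X] that by simp
  qed
  have kJ: "k ` path_image ?c = path_image J"
    unfolding pc using kh JS by (force simp: image_iff)
  define A where "A = k ` inside (path_image ?c)"
  \<comment> \<open>\<open>B\<close> is the planar outside together with the pole. As the complement
    of the image of a compact set (the curve with its inside) it is open, at the pole as
    well.\<close>
  define B where "B = S2 - path_image J - A"
  have Bp: "B = insert p (k ` outside (path_image ?c))"
  proof -
    have inj: "inj k" using hk_id by (metis injI)
    have "range k = S2 - {p}" using hk' by (auto simp: homeomorphism_def)
    then have "S2 - {p} - path_image J - A = k ` (UNIV - path_image ?c - inside (path_image ?c))"
      using inj kJ unfolding A_def by (simp add: image_set_diff)
    also have "UNIV - path_image ?c - inside (path_image ?c) = outside (path_image ?c)"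
      using inside_Un_outside[of "path_image ?c"] inside_Int_outside[of "path_image ?c"] by blast
    finally have e: "S2 - {p} - path_image J - A = k ` outside (path_image ?c)" .
    have "p \<notin> A" using kim unfolding A_def by auto
    then have "B = insert p (S2 - {p} - path_image J - A)" using p unfolding B_def by auto
    then show ?thesis using e by simp
  qed
  have clos: "path_image J \<subseteq> closure (k ` X)" if "path_image ?c \<subseteq> closure X" for X
  proof -
    have "k ` closure X \<subseteq> closure (k ` X)"
      by (rule image_closure_subset) (auto simp: kc closure_subset)
    then show ?thesis using kJ that by blast
  qed
  show ?thesis
  proof
    show "openin (top_of_set S2) A" unfolding A_def using op JIO by blast
    show "openin (top_of_set S2) B"
    proof -
      have "closed (k ` (path_image ?c \<union> inside (path_image ?c)))"
      proof -
        have "compact (path_image ?c \<union> inside (path_image ?c))"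
        proof (subst compact_eq_bounded_closed, intro conjI)
          show "bounded (path_image ?c \<union> inside (path_image ?c))"
            using JIO sc by (simp add: compact_imp_bounded compact_simple_path_image)
          show "closed (path_image ?c \<union> inside (path_image ?c))"
            by (metis closed_path_image_Un_inside sc simple_path_imp_path)
        qed
        then show ?thesis by (intro compact_imp_closed compact_continuous_image kc)
      qed
      moreover have "B = S2 - k ` (path_image ?c \<union> inside (path_image ?c))"
        unfolding B_def A_def image_Un kJ by auto
      ultimately show ?thesis by (metis Diff_eq open_Compl openin_open_Int)
    qed
    show "A \<inter> B = {}" unfolding B_def by auto
    show "A \<union> B = S2 - path_image J"
      using kJ kim inside_no_overlap[of "path_image ?c"] unfolding B_def A_def
    proof -
      have "k ` inside (path_image ?c) \<inter> k ` path_image ?c = {}"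
        using inside_no_overlap[of "path_image ?c"] image_Int[of k] hk_id
        by (metis image_empty injI)
      then show "k ` inside (path_image (h \<circ> J)) \<union> (S2 - path_image J - k ` inside (path_image (h \<circ> J))) = S2 - path_image J"
        using kJ kim by auto
    qed
    show "path_image J \<subseteq> closure A" unfolding A_def
      by (rule clos) (use JIO in \<open>auto simp: frontier_def\<close>)
    have "path_image J \<subseteq> closure (k ` outside (path_image ?c))"
      by (rule clos) (use JIO in \<open>auto simp: frontier_def\<close>)
    then show "path_image J \<subseteq> closure B"
      unfolding Bp using closure_mono by (metis subset_insertI subset_trans)
  qed
qed

text \<open>A continuous map on a compact set is closed, and it stays closed when restricted to the
  full preimage of a set \<open>W\<close>. Injectivity over \<open>W\<close> thus suffices, whatever
  the map identifies elsewhere.\<close>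

lemma homeomorphism_saturated:
  fixes f :: "'a::metric_space \<Rightarrow> 'b::metric_space"
  assumes K: "compact K" "continuous_on K f" and W: "W \<subseteq> f ` K" and inj: "inj_on f (K \<inter> f -` W)"
  obtains d where "homeomorphism (K \<inter> f -` W) W f d"
proof (rule homeomorphism_injective_closed_map[of "K \<inter> f -` W" f W])
  show "continuous_on (K \<inter> f -` W) f" using K continuous_on_subset by blast
  show "f ` (K \<inter> f -` W) = W" using W by auto
  show "closedin (top_of_set W) (f ` U)" if U: "closedin (top_of_set (K \<inter> f -` W)) U" for U
  proof -
    obtain C where C: "closed C" "U = K \<inter> f -` W \<inter> C" using U by (auto simp: closedin_closed)
    have "compact (f ` (K \<inter> C))"
      using K C by (intro compact_continuous_image) (auto intro: continuous_on_subset compact_Int_closed)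
    moreover have "f ` U = W \<inter> f ` (K \<inter> C)" using C by auto
    ultimately show ?thesis using closedin_closed compact_imp_closed by blast
  qed
qed (use inj that in auto)

section \<open>Parametrizations of edges\<close>

lemma simple_path_inj_open: "simple_path g \<Longrightarrow> inj_on g {0<..<1}"
  unfolding simple_path_def loop_free_def inj_on_def by force

lemma simple_path_preimage_open_edge:
  assumes "simple_path g"
  shows "{0..1} \<inter> g -` open_edge g = {0<..<1}"
  using assms unfolding simple_path_def loop_free_def open_edge_def
  by (auto simp: image_iff) force+

lemma open_edge_homeomorphism:
  fixes g :: "real \<Rightarrow> 'a::metric_space"
  assumes "simple_path g"
  obtains d where "homeomorphism {0<..<1} (open_edge g) g d"
  by (metis assms homeomorphism_saturated[of "{0..1}" g "open_edge g"] compact_Icc simple_path_def path_def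
      simple_path_preimage_open_edge simple_path_inj_open open_edge_def image_mono greaterThanLessThan_subseteq_atLeastAtMost_iff order_refl)

text \<open>Otherwise the homeomorphism with an interval, followed by the inclusion of the reals in
  the plane, would make a real interval open in the plane.\<close>

lemma open_edge_not_open:
  fixes g :: "real \<Rightarrow> real ^ 3"
  assumes "simple_path g"
  shows "\<not> openin (top_of_set S2) (open_edge g)"
proof
  assume o: "openin (top_of_set S2) (open_edge g)"
  obtain d where d: "homeomorphism {0<..<1} (open_edge g) g d"
    using open_edge_homeomorphism[OF assms] .
  have "open ((complex_of_real \<circ> d) ` open_edge g)"
  proof (rule openin_sphere_image_plane[OF o])
    show "continuous_on (open_edge g) (complex_of_real \<circ> d)"
      using d by (auto simp: homeomorphism_def intro!: continuous_on_compose continuous_intros)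
    show "inj_on (complex_of_real \<circ> d) (open_edge g)"
      using d by (metis comp_inj_on homeomorphism_apply2 inj_on_inverseI inj_of_real inj_on_subset subset_UNIV)
  qed
  then have *: "open (complex_of_real ` {0<..<1})"
    using d unfolding image_comp[symmetric] by (simp add: homeomorphism_def)
  have "complex_of_real (1/2) \<in> complex_of_real ` {0<..<1}" by (rule imageI) simp
  then obtain e where e: "e > 0" "ball (complex_of_real (1/2)) e \<subseteq> complex_of_real ` {0<..<1}"
    using * open_contains_ball by metis
  have "complex_of_real (1/2) + \<i> * of_real (e/2) \<in> ball (complex_of_real (1/2)) e"
    using e by (simp add: dist_norm norm_mult)
  then have "complex_of_real (1/2) + \<i> * of_real (e/2) \<in> complex_of_real ` {0<..<1}" using e by blast
  then have "Im (complex_of_real (1/2) + \<i> * of_real (e/2)) = 0" by force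
  then show False using e by simp
qed

lemma reparametrize_mono:
  fixes P g :: "real \<Rightarrow> 'a::metric_space" and \<tau> :: "real \<Rightarrow> real"
  assumes P: "path P" and g: "path g"
    and mono: "strict_mono_on {0<..<1} \<tau>" and im: "\<tau> ` {0<..<1} = {0<..<1}"
    and eq: "\<And>t. t \<in> {0<..<1} \<Longrightarrow> P t = g (\<tau> t)"
  obtains \<theta> where "continuous_on UNIV \<theta>" "strict_mono \<theta>" "\<theta> 0 = (0::real)" "\<theta> 1 = 1"
    "\<forall>t\<in>{0..1}. P t = g (\<theta> t)" "\<forall>t\<in>{0<..<1}. \<theta> t = \<tau> t"
proof -
  \<comment> \<open>With the identity outside the open unit interval the map is strictly increasing
    and onto the real line, which forces continuity, also at 0 and 1.\<close>
  define \<theta> where "\<theta> t = (if t \<in> {0<..<1} then \<tau> t else t)" for t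
  have in01: "\<tau> t \<in> {0<..<1}" if "t \<in> {0<..<1}" for t using im that by blast
  have sm: "strict_mono \<theta>"
  proof (rule strict_monoI)
    fix x y :: real assume "x < y"
    then show "\<theta> x < \<theta> y"
      using in01[of x] in01[of y] strict_mono_onD[OF mono, of x y] by (auto simp: \<theta>_def)
  qed
  have surj: "range \<theta> = UNIV"
  proof -
    have "y \<in> range \<theta>" for y
    proof (cases "y \<in> {0<..<1}")
      case True
      then obtain t where "t \<in> {0<..<1}" "y = \<tau> t" using im by blast
      then show ?thesis by (auto simp: \<theta>_def image_iff intro!: exI[of _ t])
    qed (auto simp: \<theta>_def image_iff intro!: exI[of _ y])
    then show ?thesis by auto
  qed
  have cont: "continuous_on UNIV \<theta>"
    by (rule continuous_onI_mono) (use sm surj in \<open>auto simp: strict_mono_less_eq\<close>)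
  have th01: "\<theta> 0 = 0" "\<theta> 1 = 1" by (auto simp: \<theta>_def)
  have "P t = g (\<theta> t)" if "t \<in> {0..1}" for t
  proof -
    have "dist (P t) (g (\<theta> t)) = 0"
    proof (rule continuous_constant_on_closure[of "{0<..<1}" "\<lambda>t. dist (P t) (g (\<theta> t))"])
      have "\<theta> ` {0..1} \<subseteq> {0..1}"
        using in01 by (force simp: \<theta>_def)
      then have "continuous_on {0..1} (\<lambda>x. g (\<theta> x))"
        using g cont by (auto simp: path_def intro!: continuous_on_compose2[of "{0..1}" g] intro: continuous_on_subset)
      then show "continuous_on (closure {0<..<1}) (\<lambda>t. dist (P t) (g (\<theta> t)))"
        using P by (auto simp: path_def intro!: continuous_on_dist)
      show "dist (P x) (g (\<theta> x)) = 0" if "x \<in> {0<..<1}" for x using eq that by (auto simp: \<theta>_def)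
      show "t \<in> closure {0<..<1}" using that by simp
    qed
    then show ?thesis by simp
  qed
  then show ?thesis using that[of \<theta>] cont sm th01 by (simp add: \<theta>_def)
qed

text \<open>A polygon map prescribes only the image of a side, not how the edge is traversed. The
  transition map between two injective parametrizations of the same open arc is continuous and
  injective on an interval, hence monotone; the decreasing case is reversed first. The paths may be
  loops, so the direction is read off from \<theta> and not from the end points.\<close>

lemma reparametrize:
  fixes f g :: "real \<Rightarrow> 'a::metric_space"
  assumes f: "path f" "inj_on f {0<..<1}" and g: "path g" "inj_on g {0<..<1}"
    and eq: "f ` {0<..<1} = g ` {0<..<1}"
    and ends: "f 0 \<notin> f ` {0<..<1}" "f 1 \<notin> f ` {0<..<1}"
  obtains \<theta> where "continuous_on UNIV \<theta>" "inj \<theta>" "\<theta> ` {0<..<1} = {0<..<1::real}"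
    "\<forall>t\<in>{0..1}. g t = f (\<theta> t)" "(\<theta> 0 = 0 \<and> \<theta> 1 = 1) \<or> (\<theta> 0 = 1 \<and> \<theta> 1 = 0)"
proof -
  let ?O = "f ` {0<..<1}"
  have "y = 0 \<or> y = 1 \<or> y \<in> {0<..<1}" if "y \<in> {0..1::real}" for y
    using that by auto
  then have pre: "{0..1} \<inter> f -` ?O = {0<..<1}"
    using ends by fastforce
  obtain d where d: "homeomorphism {0<..<1} ?O f d"
    by (rule homeomorphism_saturated[of "{0..1}" f ?O]) (use f pre in \<open>auto simp: path_def\<close>)
  let ?t = "d \<circ> g"
  have fd: "f (d y) = y" if "y \<in> ?O" for y using homeomorphism_apply2[OF d that] .
  have ct: "continuous_on {0<..<1} ?t"
  proof (rule continuous_on_compose)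
    show "continuous_on {0<..<1} g"
      using g(1) by (auto simp: path_def intro: continuous_on_subset)
    show "continuous_on (g ` {0<..<1}) d"
      using homeomorphism_cont2[OF d] eq by simp
  qed
  have it: "inj_on ?t {0<..<1}"
    using g(2) eq fd by (intro comp_inj_on) (auto intro: inj_on_inverseI[of _ f])
  have im: "?t ` {0<..<1} = {0<..<1}"
    using homeomorphism_image2[OF d] eq by (metis image_comp)
  have gt: "g t = f (?t t)" if "t \<in> {0<..<1}" for t
    using fd eq that by auto
  consider "strict_mono_on {0<..<1} ?t" | "strict_antimono_on {0<..<1} ?t"
    using injective_eq_monotone_map[of "{0<..<1}" ?t] ct it by (auto simp: is_interval_oo)
  then show ?thesis
  proof cases
    case 1
    obtain \<theta> where \<theta>: "continuous_on UNIV \<theta>" "strict_mono \<theta>" "\<theta> 0 = (0::real)" "\<theta> 1 = 1"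
      "\<forall>t\<in>{0..1}. g t = f (\<theta> t)" "\<forall>t\<in>{0<..<1}. \<theta> t = ?t t"
      using reparametrize_mono[OF g(1) f(1) 1 im gt] .
    show ?thesis
    proof (rule that[of \<theta>])
      show "inj \<theta>" using \<theta>(2) by (rule strict_mono_imp_inj_on)
      show "\<theta> ` {0<..<1} = {0<..<1}" using \<theta>(6) im by (metis (no_types, lifting) image_cong)
    qed (use \<theta> in auto)
  next
    case 2
    let ?s = "\<lambda>t. ?t (1 - t)"
    have refl: "(\<lambda>t. 1 - t) ` {0<..<1} = {0<..<1::real}"
      by (auto simp: image_iff intro!: bexI[of _ "1 - x" for x])
    have m: "strict_mono_on {0<..<1} ?s"
      using 2 by (auto simp: monotone_on_def)
    have im': "?s ` {0<..<1} = {0<..<1}"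
      using im refl by (metis (no_types, lifting) image_cong image_image)
    have gt': "(g \<circ> (\<lambda>t. 1 - t)) t = f (?s t)" if "t \<in> {0<..<1}" for t
      using gt[of "1 - t"] that by auto
    have pg: "path (g \<circ> (\<lambda>t. 1 - t))"
      using path_reversepath[of g] g(1) by (simp add: reversepath_def comp_def)
    obtain \<theta> where \<theta>: "continuous_on UNIV \<theta>" "strict_mono \<theta>" "\<theta> 0 = (0::real)" "\<theta> 1 = 1"
      "\<forall>t\<in>{0..1}. (g \<circ> (\<lambda>t. 1 - t)) t = f (\<theta> t)" "\<forall>t\<in>{0<..<1}. \<theta> t = ?s t"
      using reparametrize_mono[OF pg f(1) m im' gt'] .
    let ?th = "\<lambda>t. \<theta> (1 - t)"
    show ?thesis
    proof (rule that[of ?th])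
      show "continuous_on UNIV ?th"
        by (rule continuous_on_compose2[OF \<theta>(1)]) (auto intro: continuous_intros)
      show "inj ?th"
        using strict_mono_eq[OF \<theta>(2)] by (intro injI) simp
      show "?th ` {0<..<1} = {0<..<1}"
      proof -
        have "?th ` {0<..<1} = \<theta> ` {0<..<1}" using refl by (metis (no_types, lifting) image_cong image_image)
        also have "\<dots> = ?s ` {0<..<1}" using \<theta>(6) by (intro image_cong) auto
        finally show ?thesis using im' by simp
      qed
      show "\<forall>t\<in>{0..1}. g t = f (?th t)"
      proof
        fix t :: real assume "t \<in> {0..1}"
        then show "g t = f (?th t)" using bspec[OF \<theta>(5), of "1 - t"] by auto
      qed
    qed (use \<theta> in auto)
  qed
qed

section \<open>Tiles and their sides\<close>

text \<open>Angles are measured in quarter turns: corner \<open>i\<close> of the model square is \<open>ang i\<close>.\<close>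

definition ang :: "real \<Rightarrow> complex" where "ang x = cis (pi / 2 * x)"

lemma norm_ang [simp]: "cmod (ang x) = 1" by (simp add: ang_def)

lemma continuous_on_ang [continuous_intros]:
  "continuous_on A f \<Longrightarrow> continuous_on A (\<lambda>x. ang (f x))"
  unfolding ang_def cis_conv_exp by (intro continuous_intros)

lemma ang_add: "ang (x + y) = ang x * ang y"
  by (simp add: ang_def cis_mult distrib_left)

lemma ang_int: "ang 0 = 1" "ang 1 = \<i>" "ang 2 = -1" "ang 3 = -\<i>" "ang 4 = 1"
proof -
  show "ang 0 = 1" "ang 1 = \<i>" "ang 2 = -1" "ang 4 = 1"
    by (simp_all add: ang_def complex_eq_iff)
  have "ang 3 = ang 1 * ang 2" using ang_add[of 1 2] by simp
  then show "ang 3 = -\<i>" by (simp add: ang_def complex_eq_iff)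
qed

lemma ang_polar_inj:
  assumes "of_real r * ang x = of_real s * ang y" "r > 0" "s > 0" "x \<in> {0..<4}" "y \<in> {0..<4}"
  shows "r = s" "x = y"
proof -
  have "cmod (of_real r * ang x) = cmod (of_real s * ang y)" using assms by simp
  then show "r = s" using assms(2,3) by (simp add: norm_mult)
  have A: "Arg2pi (of_real u * ang z) = pi / 2 * z" if "u > 0" "z \<in> {0..<4}" for u z
    using that by (intro Arg2pi_unique[of u]) (auto simp: ang_def cis_conv_exp mult.commute)
  have "pi / 2 * x = pi / 2 * y"
    using A[of r x] A[of s y] assms by metis
  then show "x = y" by simp
qed

lemma ang_inj: "ang x = ang y \<Longrightarrow> x \<in> {0..<4} \<Longrightarrow> y \<in> {0..<4} \<Longrightarrow> x = y"
  using ang_polar_inj(2)[of 1 x 1 y] by simp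

lemma ang_surj:
  assumes "cmod z = 1"
  obtains x where "x \<in> {0..<4}" "z = ang x"
proof
  show "Arg2pi z / (pi / 2) \<in> {0..<4}"
    using Arg2pi[of z] by (auto simp: field_simps)
  have "exp (\<i> * of_real (Arg2pi z)) = z" using assms complex_norm_eq_1_exp by blast
  then show "z = ang (Arg2pi z / (pi / 2))" by (simp add: ang_def cis_conv_exp)
qed

lemma corner_4: "corner 4 i = ang (real i)"
  by (simp add: corner_def ang_def field_simps)

lemma side_4: "side 4 i = ang ` {real i<..<real i + 1}"
proof -
  have "side 4 i = (\<lambda>y. ang (y / (pi / 2))) ` {pi / 2 * real i<..<pi / 2 * (real i + 1)}"
  proof -
    have "2 * pi * real i / real 4 = pi / 2 * real i" "2 * pi * real (Suc i) / real 4 = pi / 2 * (real i + 1)"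
      by (simp_all add: field_simps)
    then show ?thesis unfolding side_def ang_def by (simp add: add.commute)
  qed
  also have "\<dots> = ang ` {real i<..<real i + 1}"
  proof (intro equalityI subsetI)
    fix z assume "z \<in> ang ` {real i<..<real i + 1}"
    then obtain x where "real i < x" "x < real i + 1" "z = ang x" by auto
    then show "z \<in> (\<lambda>y. ang (y / (pi / 2))) ` {pi / 2 * real i<..<pi / 2 * (real i + 1)}"
      by (intro image_eqI[of _ _ "pi / 2 * x"]) auto
  qed (auto intro!: imageI simp: field_simps)
  finally show ?thesis .
qed

lemma side_4': "side 4 i = (\<lambda>t. ang (real i + t)) ` {0<..<1}"
  unfolding side_4 by (auto simp: image_iff intro!: bexI[of _ "x - real i" for x] )

text \<open>The open quarter of the model disk between the centre and side \<open>i\<close>. Its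
  image is a collar of the edge from one side. Quarters are disjoint, so two sides of one tile can
  be treated like sides of two tiles.\<close>

definition sector :: "nat \<Rightarrow> complex set" where
  "sector i = {of_real r * ang x |r x. 0 < r \<and> r < 1 \<and> real i < x \<and> x < real i + 1}"

lemma sector_ball: "sector i \<subseteq> ball 0 1"
  by (auto simp: sector_def norm_mult)

lemma disjoint_unit_intervals:
  "real i < x \<Longrightarrow> x < real i + 1 \<Longrightarrow> real j < x \<Longrightarrow> x < real j + 1 \<Longrightarrow> i = j"
  by linarith

lemma sector_disjoint:
  assumes "i < 4" "j < 4" "i \<noteq> j" shows "sector i \<inter> sector j = {}"
proof -
  have "False" if rx: "0 < r" "real i < x" "x < real i + 1" and sy: "0 < s" "real j < y" "y < real j + 1"
    and eq: "of_real r * ang x = of_real s * ang y" for r x s y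
  proof -
    have "x \<in> {0..<4}" "y \<in> {0..<4}" using rx sy assms by auto
    then have "x = y" using ang_polar_inj(2)[OF eq] rx sy by simp
    then show False using rx sy assms disjoint_unit_intervals by metis
  qed
  then show ?thesis unfolding sector_def by blast
qed

lemma side_sphere: "side 4 i \<subseteq> sphere 0 1" by (auto simp: side_4)

lemma side_disjoint:
  assumes "i < 4" "j < 4" "i \<noteq> j" shows "side 4 i \<inter> side 4 j = {}"
proof -
  have "False" if rx: "real i < x" "x < real i + 1" and sy: "real j < y" "y < real j + 1"
    and eq: "ang x = ang y" for x y
  proof -
    have "x \<in> {0..<4}" "y \<in> {0..<4}" using rx sy assms by auto
    then have "x = y" using ang_inj[OF eq] rx sy by simp
    then show False using rx sy assms disjoint_unit_intervals by metis
  qed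
  then show ?thesis unfolding side_4 by force
qed

lemma circle_decomposition:
  assumes "z \<in> sphere (0::complex) 1"
  obtains i where "i < 4" "z = corner 4 i" | i where "i < 4" "z \<in> side 4 i"
proof -
  obtain x where x: "x \<in> {0..<4}" "z = ang x" using ang_surj assms by auto
  define i where "i = nat \<lfloor>x\<rfloor>"
  have i: "real i \<le> x" "x < real i + 1" "i < 4" using x unfolding i_def by auto linarith+
  show ?thesis
  proof (cases "x = real i")
    case True
    then show ?thesis using that(1)[of i] i x by (simp add: corner_4)
  next
    case False
    then show ?thesis using that(2)[of i] i x by (auto simp: side_4)
  qed
qed

lemma side_subset_closure_sector: "side 4 i \<subseteq> closure (sector i)"
proof
  fix z assume "z \<in> side 4 i"
  then obtain x where x: "z = ang x" "real i < x" "x < real i + 1" by (auto simp: side_4)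
  have "(\<lambda>n. of_real (1 - 1 / (real n + 2)) * ang x) \<longlonglongrightarrow> of_real (1 - 0) * ang x"
    by (intro tendsto_intros) real_asymp
  moreover have "of_real (1 - 1 / (real n + 2)) * ang x \<in> sector i" for n
    unfolding sector_def mem_Collect_eq using x
    by (intro exI[of _ "1 - 1 / (real n + 2)"] exI[of _ x] conjI refl) auto
  ultimately show "z \<in> closure (sector i)"
    using x by (auto simp: closure_sequential intro!: exI[of _ "\<lambda>n. of_real (1 - 1 / (real n + 2)) * ang x"])
qed

text \<open>The model of a collar: the real segment stands for the open edge, the points above it
  for the interior of the tile.\<close>

definition half_strip :: "complex set" where
  "half_strip = {z. 0 < Re z \<and> Re z < 1 \<and> 0 \<le> Im z \<and> Im z < 1}"

locale quad_tiling =
  fixes V :: "(real ^ 3) set" and E :: "(real \<Rightarrow> real ^ 3) set"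
  assumes quadrilateral: "quadrilateral_tiling S2 V E"
begin

section \<open>The graph, the tiles and the collars of tile sides\<close>

abbreviation "Tiles \<equiv> tiles S2 V E"
abbreviation "PM T c \<equiv> polygon_map V E 4 T c"

definition G :: "(real ^ 3) set" where "G = V \<union> (\<Union>g\<in>E. path_image g)"

lemma embedded: "embedded_graph S2 V E" and degree_ge_3: "v \<in> V \<Longrightarrow> vertex_degree E v \<ge> 3"
  and ex_PM: "T \<in> Tiles \<Longrightarrow> \<exists>c. PM T c"
  using quadrilateral unfolding quadrilateral_tiling_def tiling_def by auto

lemma finV: "finite V" and finE: "finite E" and VS: "V \<subseteq> S2"
  using embedded unfolding embedded_graph_def by auto

lemma edgeD:
  assumes "g \<in> E"
  shows "simple_path g" "path_image g \<subseteq> S2" "g 0 \<in> V" "g 1 \<in> V" "open_edge g \<inter> V = {}"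
  using embedded assms unfolding embedded_graph_def pathstart_def pathfinish_def by auto

lemma edges_disjoint: "g \<in> E \<Longrightarrow> h \<in> E \<Longrightarrow> g \<noteq> h \<Longrightarrow> open_edge g \<inter> open_edge h = {}"
  using embedded unfolding embedded_graph_def by auto

lemma path_image_open_edge: "path_image g = open_edge g \<union> {g 0, g 1}"
proof -
  have "{0..1::real} = {0<..<1} \<union> {0, 1}" by auto
  then show ?thesis unfolding path_image_def open_edge_def by (metis image_Un image_insert image_empty)
qed

lemma open_edge_ne: "open_edge g \<noteq> {}" by (simp add: open_edge_def)

lemma open_edge_inj: "g \<in> E \<Longrightarrow> h \<in> E \<Longrightarrow> open_edge g = open_edge h \<Longrightarrow> g = h"
  using edges_disjoint open_edge_ne by (metis Int_absorb)

lemma G_eq: "G = V \<union> (\<Union>g\<in>E. open_edge g)"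
  unfolding G_def path_image_open_edge using edgeD by auto

lemma GS: "G \<subseteq> S2" unfolding G_def using VS edgeD by auto

lemma open_edge_G: "g \<in> E \<Longrightarrow> open_edge g \<subseteq> G" unfolding G_eq by auto

lemma closed_G_minus: "closed (V \<union> (\<Union>g\<in>E'. path_image g))" if "E' \<subseteq> E"
proof -
  have "closed (path_image g)" if "g \<in> E'" for g
    using edgeD(1)[of g] that \<open>E' \<subseteq> E\<close> by (simp add: closed_simple_path_image subset_eq)
  then show ?thesis using finV finE finite_subset[OF that] by (intro closed_Un closed_UN finite_imp_closed) auto
qed

lemma G_minus: "e \<in> E \<Longrightarrow> G - open_edge e = V \<union> (\<Union>g\<in>E - {e}. path_image g)"
proof -
  assume e: "e \<in> E"
  have "V \<union> (\<Union>g\<in>E - {e}. path_image g) = V \<union> (\<Union>g\<in>E - {e}. open_edge g)"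
    unfolding path_image_open_edge using edgeD(3,4) by auto
  moreover have "G = V \<union> (\<Union>g\<in>E - {e}. open_edge g) \<union> open_edge e"
    unfolding G_eq using e by auto
  moreover have "(V \<union> (\<Union>g\<in>E - {e}. open_edge g)) \<inter> open_edge e = {}"
    using edgeD(5)[OF e] edges_disjoint[OF _ e] by auto
  ultimately show ?thesis by auto
qed

lemma closed_G_diff: "e \<in> E \<Longrightarrow> closed (G - open_edge e)"
  unfolding G_minus by (rule closed_G_minus) auto

lemma Union_tiles: "\<Union>Tiles = S2 - G"
  unfolding tiles_def G_def by (simp add: Union_components)

lemma tile_sub: "T \<in> Tiles \<Longrightarrow> T \<subseteq> S2 - G" using Union_tiles by blast

lemma tile_connected: "T \<in> Tiles \<Longrightarrow> connected T"
  unfolding tiles_def using in_components_connected by blast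

lemma tile_ne: "T \<in> Tiles \<Longrightarrow> T \<noteq> {}"
  unfolding tiles_def using in_components_nonempty by blast

lemma tiles_disjoint: "T \<in> Tiles \<Longrightarrow> T' \<in> Tiles \<Longrightarrow> T \<noteq> T' \<Longrightarrow> T \<inter> T' = {}"
  unfolding tiles_def using components_nonoverlap by blast

text \<open>The description is unique because the open edges are nonempty and pairwise
  disjoint.\<close>

definition side_edge :: "(complex \<Rightarrow> real ^ 3) \<Rightarrow> nat \<Rightarrow> real \<Rightarrow> real ^ 3" where
  "side_edge c i = (THE g. g \<in> E \<and> c ` side 4 i = open_edge g)"

context
  fixes T c assumes T: "T \<in> Tiles" and PM: "PM T c"
begin

lemma PM_cont: "continuous_on (cball 0 1) c" and PM_corner: "i < 4 \<Longrightarrow> c (corner 4 i) \<in> V"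
  and PM_inj_side: "i < 4 \<Longrightarrow> inj_on c (side 4 i)"
  using PM unfolding polygon_map_def by auto

lemma PM_ball: "c ` ball 0 1 = T" and PM_inj: "inj_on c (ball 0 1)"
proof -
  obtain d where d: "homeomorphism (ball 0 1) T c d" using PM unfolding polygon_map_def by auto
  show "c ` ball 0 1 = T" using homeomorphism_image1[OF d] .
  show "inj_on c (ball 0 1)" using homeomorphism_apply1[OF d] by (metis inj_on_inverseI)
qed

lemma side_edge: assumes "i < 4" shows "side_edge c i \<in> E" "c ` side 4 i = open_edge (side_edge c i)"
proof -
  obtain g where g: "g \<in> E" "c ` side 4 i = open_edge g" using PM assms unfolding polygon_map_def by auto
  have "side_edge c i = g" unfolding side_edge_def using g open_edge_inj by (intro the_equality) auto
  then show "side_edge c i \<in> E" "c ` side 4 i = open_edge (side_edge c i)" using g by auto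
qed

lemma PM_sphere: "c ` sphere 0 1 \<subseteq> G"
proof
  fix y assume "y \<in> c ` sphere 0 1"
  then obtain z where z: "z \<in> sphere 0 1" "y = c z" by blast
  show "y \<in> G"
    using z(1)
  proof (cases rule: circle_decomposition)
    case (1 i) then show ?thesis using PM_corner z by (auto simp: G_def)
  next
    case (2 i) then show ?thesis using side_edge[of i] z open_edge_G by blast
  qed
qed

lemma cball_split: "cball (0::complex) 1 = ball 0 1 \<union> sphere 0 1" by auto

lemma PM_cball: "c ` cball 0 1 \<subseteq> T \<union> G"
  unfolding cball_split image_Un using PM_ball PM_sphere by blast

lemma PM_cball_S2: "c ` cball 0 1 \<subseteq> S2"
  using PM_cball tile_sub[OF T] GS by blast

lemma PM_in_T: "z \<in> cball 0 1 \<Longrightarrow> c z \<in> T \<longleftrightarrow> z \<in> ball 0 1"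
  using PM_ball PM_sphere tile_sub[OF T] unfolding cball_split by blast

lemma PM_in_edge:
  assumes "z \<in> cball 0 1" "g \<in> E" "c z \<in> open_edge g"
  obtains i where "i < 4" "z \<in> side 4 i" "side_edge c i = g"
proof -
  have "z \<notin> ball 0 1" using PM_ball assms tile_sub[OF T] open_edge_G[of g] by blast
  then have "z \<in> sphere 0 1" using assms by auto
  then show ?thesis
  proof (cases rule: circle_decomposition)
    case (1 i) then show ?thesis using PM_corner edgeD(5)[of g] assms by blast
  next
    case (2 i)
    then have "c z \<in> open_edge (side_edge c i)" using side_edge[of i] by blast
    then have "side_edge c i = g" using edges_disjoint side_edge[of i] 2 assms by blast
    then show ?thesis using that 2 by blast
  qed
qed

lemma compact_PM: "compact (c ` cball 0 1)"
  using PM_cont by (intro compact_continuous_image) auto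

lemma PM_open_image: "open U \<Longrightarrow> U \<subseteq> ball 0 1 \<Longrightarrow> openin (top_of_set S2) (c ` U)"
  using PM_cball_S2 ball_subset_cball[of 0 1]
  by (intro open_plane_image_sphere continuous_on_subset[OF PM_cont] inj_on_subset[OF PM_inj]) blast+

lemma tile_open: "openin (top_of_set S2) T"
  using PM_open_image[of "ball 0 1"] PM_ball by auto

lemma sector_image: "c ` sector i \<subseteq> T" using PM_ball sector_ball by blast

lemma edge_closure_sector: "i < 4 \<Longrightarrow> open_edge (side_edge c i) \<subseteq> closure (c ` sector i)"
proof -
  assume i: "i < 4"
  have "closure (sector i) \<subseteq> cball 0 1"
    using sector_ball[of i] by (meson ball_subset_cball closed_cball closure_minimal order_trans)
  then have "c ` closure (sector i) \<subseteq> closure (c ` sector i)"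
    by (intro image_closure_subset) (auto intro: continuous_on_subset[OF PM_cont] simp: closure_subset)
  then show ?thesis using side_edge(2)[OF i] side_subset_closure_sector by blast
qed

text \<open>The two cases at the end say whether the stored edge runs with or against the boundary
  of the tile; \<open>side_winding\<close> turns them into a sign.\<close>

lemma side_param:
  assumes i: "i < 4"
  obtains \<theta> where "continuous_on UNIV \<theta>" "inj \<theta>" "\<theta> ` {0<..<1} = {0<..<1::real}"
    "\<forall>t\<in>{0..1}. side_edge c i t = c (ang (real i + \<theta> t))" "(\<theta> 0 = 0 \<and> \<theta> 1 = 1) \<or> (\<theta> 0 = 1 \<and> \<theta> 1 = 0)"
proof (rule reparametrize[of "\<lambda>t. c (ang (real i + t))" "side_edge c i"])
  let ?f = "\<lambda>t. c (ang (real i + t))"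
  have im: "?f ` {0<..<1} = open_edge (side_edge c i)"
    using side_edge(2)[OF i] unfolding side_4' image_image .
  show "path ?f" unfolding path_def
    by (rule continuous_on_compose2[OF PM_cont]) (auto intro!: continuous_intros)
  show "inj_on ?f {0<..<1}"
  proof (rule inj_onI)
    fix x y :: real assume xy: "x \<in> {0<..<1}" "y \<in> {0<..<1}" "?f x = ?f y"
    then have "ang (real i + x) = ang (real i + y)"
      using inj_onD[OF PM_inj_side[OF i]] unfolding side_4' by blast
    then have "real i + x = real i + y" using xy i by (intro ang_inj) auto
    then show "x = y" by simp
  qed
  show "path (side_edge c i)" using edgeD(1) side_edge(1)[OF i] simple_path_imp_path by blast
  show "inj_on (side_edge c i) {0<..<1}" using simple_path_inj_open edgeD(1) side_edge(1)[OF i] by blast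
  show "?f ` {0<..<1} = side_edge c i ` {0<..<1}" using im by (simp add: open_edge_def)
  have "ang (real i + 1) = corner 4 ((i + 1) mod 4)"
  proof (cases "i = 3")
    case False
    then have "(i + 1) mod 4 = i + 1" using i by simp
    then show ?thesis by (simp add: corner_4 add.commute)
  qed (simp add: corner_4 ang_int)
  then have "?f 1 \<in> V" using PM_corner[of "(i + 1) mod 4"] by simp
  moreover have "?f 0 \<in> V" using PM_corner[OF i] by (simp add: corner_4)
  ultimately show "?f 0 \<notin> ?f ` {0<..<1}" "?f 1 \<notin> ?f ` {0<..<1}"
    unfolding im using edgeD(5) side_edge(1)[OF i] by blast+
qed (use that in auto)

text \<open>Polar coordinates on the sector. The real coordinate is the parameter of the edge itself
  and not the angle, so that the maps for two tile sides on the same edge agree on the real segment.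
  Although \<open>c\<close> may identify boundary points, it is injective on a single open side, and
  interior points never share an image with boundary points.\<close>

lemma half_strip_map:
  assumes i: "i < 4"
  obtains f where "continuous_on half_strip f" "inj_on f half_strip"
    "f ` {z \<in> half_strip. Im z > 0} = c ` sector i"
    "\<And>t. t \<in> {0<..<1} \<Longrightarrow> f (of_real t) = side_edge c i t"
proof -
  obtain \<theta> where th: "continuous_on UNIV \<theta>" "inj \<theta>" "\<theta> ` {0<..<1} = {0<..<1::real}"
    "\<forall>t\<in>{0..1}. side_edge c i t = c (ang (real i + \<theta> t))" "(\<theta> 0 = 0 \<and> \<theta> 1 = 1) \<or> (\<theta> 0 = 1 \<and> \<theta> 1 = 0)"
    using side_param[OF i] .
  have th01: "\<theta> t \<in> {0<..<1}" if "t \<in> {0<..<1}" for t using th(3) that by blast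
  \<comment> \<open>The radius is \<open>1 - Im z\<close>, so that the real segment goes to the
    boundary circle.\<close>
  define q where "q z = of_real (1 - Im z) * ang (real i + \<theta> (Re z))" for z
  have nq: "cmod (q z) = 1 - Im z" if "z \<in> half_strip" for z
    using that by (auto simp: q_def half_strip_def norm_mult simp del: of_real_diff)
  have injq: "inj_on q half_strip"
  proof (rule inj_onI)
    fix z w assume zw: "z \<in> half_strip" "w \<in> half_strip" "q z = q w"
    have *: "of_real (1 - Im z) * ang (real i + \<theta> (Re z)) = of_real (1 - Im w) * ang (real i + \<theta> (Re w))"
      using zw(3) unfolding q_def .
    have "real i + \<theta> (Re z) \<in> {0..<4}" "real i + \<theta> (Re w) \<in> {0..<4}"
      using zw th01[of "Re z"] th01[of "Re w"] i by (auto simp: half_strip_def)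
    then have "1 - Im z = 1 - Im w" "real i + \<theta> (Re z) = real i + \<theta> (Re w)"
      using ang_polar_inj[OF *] zw by (auto simp: half_strip_def)
    then show "z = w" using th(2) by (auto simp: complex_eq_iff inj_def)
  qed
  have contq: "continuous_on half_strip q"
    unfolding q_def by (intro continuous_intros continuous_on_compose2[OF th(1)]) auto
  have q_side: "q z \<in> side 4 i" if "z \<in> half_strip" "Im z = 0" for z
    using that th01[of "Re z"] unfolding q_def side_4' half_strip_def by auto
  have qim: "q ` {z \<in> half_strip. Im z > 0} = sector i"
  proof (intro equalityI subsetI)
    fix y assume "y \<in> q ` {z \<in> half_strip. Im z > 0}"
    then obtain z where z: "z \<in> half_strip" "Im z > 0" "y = q z" by blast
    then show "y \<in> sector i" using th01[of "Re z"] unfolding sector_def q_def half_strip_def mem_Collect_eq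
      by (intro exI[of _ "1 - Im z"] exI[of _ "real i + \<theta> (Re z)"] conjI) auto
  next
    fix y assume "y \<in> sector i"
    then obtain r x where r: "0 < r" "r < 1" and x: "real i < x" "x < real i + 1" and y: "y = of_real r * ang x"
      unfolding sector_def by blast
    have "x - real i \<in> \<theta> ` {0<..<1}" using th(3) x by simp
    then obtain t where t: "t \<in> {0<..<1}" "\<theta> t = x - real i" by fastforce
    then show "y \<in> q ` {z \<in> half_strip. Im z > 0}" using r y
      by (intro image_eqI[of _ _ "Complex t (1 - r)"]) (auto simp: q_def half_strip_def)
  qed
  show ?thesis
  proof (rule that[of "c \<circ> q"])
    show "continuous_on half_strip (c \<circ> q)"
      by (rule continuous_on_compose[OF contq continuous_on_subset[OF PM_cont]])
        (auto simp: nq half_strip_def)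
    show "inj_on (c \<circ> q) half_strip"
    proof (rule inj_onI)
      fix z w assume zw: "z \<in> half_strip" "w \<in> half_strip" "(c \<circ> q) z = (c \<circ> q) w"
      have cb: "q z \<in> cball 0 1" "q w \<in> cball 0 1" using nq zw by (auto simp: half_strip_def)
      have ba: "q z \<in> ball 0 1 \<longleftrightarrow> Im z \<noteq> 0" "q w \<in> ball 0 1 \<longleftrightarrow> Im w \<noteq> 0" using nq zw by (auto simp: half_strip_def)
      have "q z = q w"
      proof (cases "Im z = 0")
        case True
        then have "Im w = 0" using PM_in_T[OF cb(1)] PM_in_T[OF cb(2)] ba zw by auto
        then show ?thesis using True q_side zw inj_onD[OF PM_inj_side[OF i]] by auto
      next
        case False
        then have "Im w \<noteq> 0" using PM_in_T[OF cb(1)] PM_in_T[OF cb(2)] ba zw by auto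
        then show ?thesis using False ba zw inj_onD[OF PM_inj] by auto
      qed
      then show "z = w" using injq zw by (auto dest: inj_onD)
    qed
    show "(c \<circ> q) ` {z \<in> half_strip. Im z > 0} = c ` sector i" unfolding image_comp[symmetric] qim ..
    show "(c \<circ> q) (of_real t) = side_edge c i t" if "t \<in> {0<..<1}" for t
      using bspec[OF th(4), of t] that by (simp add: q_def)
  qed
qed

end

text \<open>The sectors of two tile sides on the edge \<open>e\<close> are parametrized by the two halves of an open strip
  so that the parametrizations agree on \<open>e\<close>; invariance of domain applies to the strip.\<close>

lemma glue:
  assumes T: "T \<in> Tiles" "PM T c" "i < 4" and T': "T' \<in> Tiles" "PM T' c'" "j < 4"
    and e: "side_edge c i = e" "side_edge c' j = e"
    and ne: "T \<noteq> T' \<or> (c = c' \<and> i \<noteq> j)"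
  shows "openin (top_of_set S2) (c ` sector i \<union> open_edge e \<union> c' ` sector j)"
    "connected (c ` sector i \<union> open_edge e \<union> c' ` sector j)"
proof -
  obtain f where f: "continuous_on half_strip f" "inj_on f half_strip"
    "f ` {z \<in> half_strip. Im z > 0} = c ` sector i"
    "\<And>t. t \<in> {0<..<1} \<Longrightarrow> f (of_real t) = e t"
    using half_strip_map[OF T] e by auto
  obtain f' where f': "continuous_on half_strip f'" "inj_on f' half_strip"
    "f' ` {z \<in> half_strip. Im z > 0} = c' ` sector j"
    "\<And>t. t \<in> {0<..<1} \<Longrightarrow> f' (of_real t) = e t"
    using half_strip_map[OF T'] e by auto
  have eE: "e \<in> E" using side_edge(1)[OF T] e by simp
  have disj: "c ` sector i \<inter> c' ` sector j = {}"
  proof (cases "T = T'")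
    case False
    then show ?thesis
      using tiles_disjoint[OF T(1) T'(1)] sector_image[OF T(1,2), of i] sector_image[OF T'(1,2), of j] by blast
  next
    case True
    then have "c = c'" "i \<noteq> j" using ne by auto
    then show ?thesis
      using sector_disjoint[of i j] T(3) T'(3) PM_inj[OF T(1,2)] sector_ball
      by (metis image_empty inj_on_image_Int)
  qed
  have disj1: "c ` sector i \<inter> open_edge e = {}" "c' ` sector j \<inter> open_edge e = {}"
    using sector_image[OF T(1,2), of i] sector_image[OF T'(1,2), of j] tile_sub[OF T(1)] tile_sub[OF T'(1)] open_edge_G[OF eE]
    by blast+
  define U where "U = {z. 0 < Re z \<and> Re z < 1 \<and> -1 < Im z \<and> Im z < 1}"
  have U_eq: "U = {z. 0 < Re z} \<inter> {z. Re z < 1} \<inter> {z. -1 < Im z} \<inter> {z. Im z < 1}" unfolding U_def by auto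
  have oU: "open U" unfolding U_eq
    by (intro open_Int open_halfspace_Re_gt open_halfspace_Re_lt open_halfspace_Im_gt open_halfspace_Im_lt)
  have cU: "connected U" unfolding U_eq
    by (intro convex_connected convex_Int convex_halfspace_Re_gt convex_halfspace_Re_lt convex_halfspace_Im_gt convex_halfspace_Im_lt)
  define \<Phi> where "\<Phi> z = (if 0 \<le> Im z then f z else f' (cnj z))" for z
  have real_z: "z = of_real (Re z)" if "Im z = 0" for z using that by (simp add: complex_eq_iff)
  have mem: "f z \<in> c ` sector i" if "z \<in> half_strip" "Im z > 0" for z using f(3) that by blast
  have mem': "f' z \<in> c' ` sector j" if "z \<in> half_strip" "Im z > 0" for z using f'(3) that by blast
  have meme: "f z = e (Re z)" "f' z = e (Re z)" "e (Re z) \<in> open_edge e" if "z \<in> half_strip" "Im z = 0" for z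
    using f(4)[of "Re z"] f'(4)[of "Re z"] that real_z[of z] by (auto simp: half_strip_def open_edge_def)
  have cont: "continuous_on U \<Phi>"
  proof -
    have "continuous_on ({z \<in> U. 0 \<le> Im z} \<union> {z \<in> U. Im z \<le> 0}) \<Phi>"
      unfolding \<Phi>_def
    proof (rule continuous_on_cases_local)
      have "closedin (top_of_set U) (U \<inter> {z. 0 \<le> Im z})" "closedin (top_of_set U) (U \<inter> {z. Im z \<le> 0})"
        by (auto intro!: closedin_closed_Int closed_halfspace_Im_ge closed_halfspace_Im_le)
      moreover have "U \<inter> {z. 0 \<le> Im z} = {z \<in> U. 0 \<le> Im z}" "U \<inter> {z. Im z \<le> 0} = {z \<in> U. Im z \<le> 0}"
        "{z \<in> U. 0 \<le> Im z} \<union> {z \<in> U. Im z \<le> 0} = U" by auto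
      ultimately show "closedin (top_of_set ({z \<in> U. 0 \<le> Im z} \<union> {z \<in> U. Im z \<le> 0})) {z \<in> U. 0 \<le> Im z}"
        "closedin (top_of_set ({z \<in> U. 0 \<le> Im z} \<union> {z \<in> U. Im z \<le> 0})) {z \<in> U. Im z \<le> 0}" by auto
      show "continuous_on {z \<in> U. 0 \<le> Im z} f"
        by (rule continuous_on_subset[OF f(1)]) (auto simp: U_def half_strip_def)
      show "continuous_on {z \<in> U. Im z \<le> 0} (\<lambda>z. f' (cnj z))"
        by (rule continuous_on_compose2[OF f'(1)]) (auto simp: U_def half_strip_def intro!: continuous_intros)
      fix z assume "z \<in> {z \<in> U. 0 \<le> Im z} \<and> \<not> 0 \<le> Im z \<or> z \<in> {z \<in> U. Im z \<le> 0} \<and> 0 \<le> Im z"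
      then have z: "z \<in> half_strip" "Im z = 0" by (auto simp: U_def half_strip_def)
      then have "cnj z = z" by (simp add: complex_eq_iff)
      then show "f z = f' (cnj z)" using meme z by simp
    qed
    moreover have "{z \<in> U. 0 \<le> Im z} \<union> {z \<in> U. Im z \<le> 0} = U" by auto
    ultimately show ?thesis by simp
  qed
  have hs: "z \<in> half_strip" if "z \<in> U" "0 \<le> Im z" for z using that by (auto simp: U_def half_strip_def)
  have hs': "cnj z \<in> half_strip" if "z \<in> U" "Im z < 0" for z using that by (auto simp: U_def half_strip_def)
  have inj: "inj_on \<Phi> U"
  proof -
    have *: False if z: "z \<in> U" "0 \<le> Im z" and w: "w \<in> U" "Im w < 0" and eq: "f z = f' (cnj w)" for z w
    proof -
      have "f' (cnj w) \<in> c' ` sector j" using mem'[OF hs'[OF w]] w by simp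
      moreover have "f z \<in> c ` sector i \<union> open_edge e"
        using mem[OF hs[OF z]] meme[OF hs[OF z]] z by (cases "Im z = 0") auto
      ultimately show False using eq disj disj1 by auto
    qed
    show ?thesis
    proof (rule inj_onI)
      fix z w assume zw: "z \<in> U" "w \<in> U" "\<Phi> z = \<Phi> w"
      show "z = w"
      proof (cases "0 \<le> Im z"; cases "0 \<le> Im w")
        assume "0 \<le> Im z" "0 \<le> Im w"
        then show ?thesis using zw hs inj_onD[OF f(2)] by (auto simp: \<Phi>_def)
      next
        assume "\<not> 0 \<le> Im z" "\<not> 0 \<le> Im w"
        then have "cnj z = cnj w" using zw hs'[of z] hs'[of w] inj_onD[OF f'(2), of "cnj z" "cnj w"] by (auto simp: \<Phi>_def)
        then show ?thesis by simp
      qed (use zw *[of z w] *[of w z] in \<open>auto simp: \<Phi>_def\<close>)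
    qed
  qed
  have im: "\<Phi> ` U = c ` sector i \<union> open_edge e \<union> c' ` sector j"
  proof (intro equalityI subsetI)
    fix y assume "y \<in> \<Phi> ` U"
    then obtain z where z: "z \<in> U" "y = \<Phi> z" by blast
    consider "Im z > 0" | "Im z = 0" | "Im z < 0" by linarith
    then show "y \<in> c ` sector i \<union> open_edge e \<union> c' ` sector j"
      using z mem[of z] meme[of z] mem'[of "cnj z"] hs[of z] hs'[of z] by cases (auto simp: \<Phi>_def)
  next
    fix y assume "y \<in> c ` sector i \<union> open_edge e \<union> c' ` sector j"
    then consider "y \<in> c ` sector i" | "y \<in> open_edge e" | "y \<in> c' ` sector j" by blast
    then show "y \<in> \<Phi> ` U"
    proof cases
      case 1
      then obtain z where "z \<in> half_strip" "Im z > 0" "y = f z" using f(3) by blast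
      then show ?thesis by (intro image_eqI[of _ _ z]) (auto simp: \<Phi>_def U_def half_strip_def)
    next
      case 2
      then obtain t where "t \<in> {0<..<1}" "y = e t" by (auto simp: open_edge_def)
      then show ?thesis using f(4)[of t] by (intro image_eqI[of _ _ "of_real t"]) (auto simp: \<Phi>_def U_def)
    next
      case 3
      then obtain z where "z \<in> half_strip" "Im z > 0" "y = f' z" using f'(3) by blast
      then show ?thesis by (intro image_eqI[of _ _ "cnj z"]) (auto simp: \<Phi>_def U_def half_strip_def)
    qed
  qed
  have "\<Phi> ` U \<subseteq> S2" unfolding im
    using sector_image[OF T(1,2), of i] sector_image[OF T'(1,2), of j] tile_sub[OF T(1)] tile_sub[OF T'(1)] open_edge_G[OF eE] GS
    by blast
  then show "openin (top_of_set S2) (c ` sector i \<union> open_edge e \<union> c' ` sector j)"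
    using open_plane_image_sphere[OF oU cont inj] im by simp
  show "connected (c ` sector i \<union> open_edge e \<union> c' ` sector j)"
    using connected_continuous_image[OF cont cU] im by simp
qed

end

section \<open>The parity of cycles and the colouring of the vertices\<close>

lemma connected_subset_split:
  assumes "connected N" "N \<subseteq> A \<union> B" "openin (top_of_set S) A" "openin (top_of_set S) B" "A \<inter> B = {}"
  shows "N \<subseteq> A \<or> N \<subseteq> B"
proof -
  obtain A' B' where "open A'" "A = S \<inter> A'" "open B'" "B = S \<inter> B'"
    using assms(3,4) unfolding openin_open by blast
  then show ?thesis
    using connectedD[OF assms(1), of A' B'] assms(2,5) by blast
qed

context quad_tiling begin

section \<open>The two tile sides at an edge\<close>

definition tile_map :: "(real ^ 3) set \<Rightarrow> complex \<Rightarrow> real ^ 3" where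
  "tile_map T = (SOME c. PM T c)"

lemma tile_map: "T \<in> Tiles \<Longrightarrow> PM T (tile_map T)"
  unfolding tile_map_def using ex_PM someI_ex by metis

text \<open>Pairs are collected, not tiles: a tile having two sides on the edge counts
  twice.\<close>

definition covers :: "(real \<Rightarrow> real ^ 3) \<Rightarrow> ((real ^ 3) set \<times> nat) set" where
  "covers e = {(T, i). T \<in> Tiles \<and> i < 4 \<and> side_edge (tile_map T) i = e}"

lemma covers_glue:
  assumes "(T, i) \<in> covers e" "(T', j) \<in> covers e" "(T, i) \<noteq> (T', j)"
  shows "openin (top_of_set S2) (tile_map T ` sector i \<union> open_edge e \<union> tile_map T' ` sector j)"
    "connected (tile_map T ` sector i \<union> open_edge e \<union> tile_map T' ` sector j)"
  using assms glue[OF _ tile_map _ _ tile_map, of T i T' j e] unfolding covers_def by auto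

text \<open>Two sectors and the open edge between them form a neighbourhood of each point of the
  edge. A third sector accumulates at the edge, so it would have to meet this neighbourhood, from
  which it is disjoint.\<close>

lemma covers_no_three:
  assumes a: "(T, i) \<in> covers e" and b: "(T', j) \<in> covers e" and c: "(T'', k) \<in> covers e"
    and ne: "(T, i) \<noteq> (T', j)" "(T, i) \<noteq> (T'', k)" "(T', j) \<noteq> (T'', k)"
  shows False
proof -
  let ?N = "tile_map T ` sector i \<union> open_edge e \<union> tile_map T' ` sector j"
  have disj: "tile_map X ` sector n \<inter> tile_map T'' ` sector k = {}" if "(X, n) \<in> covers e" "(X, n) \<noteq> (T'', k)" for X n
  proof (cases "X = T''")
    case False
    then show ?thesis
      using tiles_disjoint[of X T''] sector_image[of X "tile_map X" n] sector_image[of T'' "tile_map T''" k] tile_map that c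
      unfolding covers_def by blast
  next
    case True
    then have "sector n \<inter> sector k = {}" using that c sector_disjoint[of n k] unfolding covers_def by auto
    then show ?thesis
      using True that PM_inj[of X "tile_map X"] tile_map sector_ball unfolding covers_def
      by (metis (mono_tags, lifting) case_prodD image_empty inj_on_image_Int mem_Collect_eq)
  qed
  have T'': "T'' \<in> Tiles" "k < 4" "side_edge (tile_map T'') k = e" using c unfolding covers_def by auto
  have eE: "e \<in> E" using side_edge(1)[OF T''(1) tile_map[OF T''(1)] T''(2)] T''(3) by simp
  have "open_edge e \<inter> tile_map T'' ` sector k = {}"
    using sector_image[OF T''(1) tile_map[OF T''(1)], of k] tile_sub[OF T''(1)] open_edge_G[OF eE] by blast
  then have dN: "?N \<inter> tile_map T'' ` sector k = {}"
    using disj[OF a ne(2)] disj[OF b ne(3)] by blast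
  obtain W where W: "open W" "?N = S2 \<inter> W" using covers_glue(1)[OF a b ne(1)] openin_open by metis
  obtain x where "x \<in> open_edge e" using open_edge_ne[of e] by blast
  then have "x \<in> W" "x \<in> closure (tile_map T'' ` sector k)"
    using W edge_closure_sector[OF T''(1) tile_map[OF T''(1)] T''(2)] T''(3) by blast+
  then obtain y where "y \<in> W" "y \<in> tile_map T'' ` sector k"
    using W(1) open_Int_closure_eq_empty by blast
  then show False using dN W(2) sector_image[OF T''(1) tile_map[OF T''(1)], of k] tile_sub[OF T''(1)] by blast
qed

lemma covers_le2: "finite (covers e) \<and> card (covers e) \<le> 2"
proof (rule ccontr)
  assume not: "\<not> ?thesis"
  have "\<exists>C. C \<subseteq> covers e \<and> card C = 3"
  proof (cases "finite (covers e)")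
    case True
    with not have "3 \<le> card (covers e)" by simp
    then show ?thesis using obtain_subset_with_card_n[of 3 "covers e"] by metis
  next
    case False
    then show ?thesis using infinite_arbitrarily_large[of "covers e" 3] by metis
  qed
  then obtain C where C: "C \<subseteq> covers e" "card C = 3" by blast
  then obtain a b c where abc: "C = {a, b, c}" "a \<noteq> b" "a \<noteq> c" "b \<noteq> c" unfolding card_3_iff by blast
  obtain T i T' j T'' k where p: "a = (T, i)" "b = (T', j)" "c = (T'', k)"
    using surj_pair[of a] surj_pair[of b] surj_pair[of c] by blast
  have "(T, i) \<in> covers e" "(T', j) \<in> covers e" "(T'', k) \<in> covers e"
    using C(1) unfolding abc(1) p by blast+
  then show False by (rule covers_no_three) (use abc p in blast)+
qed

text \<open>Finiteness of the set of tiles is no assumption. It follows because every tile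
  contributes its side 0 to one of finitely many edges, each of which takes at most two
  sides.\<close>

lemma finite_Tiles: "finite Tiles"
proof -
  have "Tiles \<subseteq> fst ` (\<Union>e\<in>E. covers e)"
  proof
    fix T assume T: "T \<in> Tiles"
    then have "(T, 0) \<in> covers (side_edge (tile_map T) 0)" "side_edge (tile_map T) 0 \<in> E"
      using side_edge(1)[OF T tile_map[OF T], of 0] by (auto simp: covers_def)
    then show "T \<in> fst ` (\<Union>e\<in>E. covers e)" by force
  qed
  then show ?thesis using finE covers_le2 by (meson finite_UN finite_imageI finite_subset)
qed

text \<open>The set \<open>C\<close> consists of the graph without the open edge and the closed
  images of the tiles that do not reach it; being a finite union of closed sets it is closed. Its
  complement in the sphere is then open. It is the open edge alone if no side lies on it, and the
  open edge with one tile if one side does. Both contradict invariance of domain.\<close>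

lemma card_covers:
  assumes e: "e \<in> E"
  shows "card (covers e) = 2"
proof (rule ccontr)
  assume "card (covers e) \<noteq> 2"
  then have c1: "card (covers e) \<le> 1" using covers_le2[of e] by linarith
  define M where "M = {T \<in> Tiles. \<forall>i. (T, i) \<notin> covers e}"
  define C where "C = (G - open_edge e) \<union> (\<Union>T\<in>M. tile_map T ` cball 0 1)"
  have "finite M" unfolding M_def using finite_Tiles by simp
  moreover have "closed (tile_map T ` cball 0 1)" if "T \<in> M" for T
    using compact_PM[of T "tile_map T"] tile_map that compact_imp_closed unfolding M_def by blast
  ultimately have clC: "closed C" unfolding C_def using closed_G_diff[OF e] by (intro closed_Un closed_UN) auto
  have Ce: "C \<inter> open_edge e = {}"
  proof -
    have "tile_map T z \<notin> open_edge e" if "T \<in> M" "z \<in> cball 0 1" for T z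
      using PM_in_edge[of T "tile_map T" z e] tile_map that e unfolding M_def covers_def by blast
    then show ?thesis unfolding C_def by blast
  qed
  have GC: "G - open_edge e \<subseteq> C" unfolding C_def by blast
  have op: "openin (top_of_set S2) (S2 - C)"
    using clC by (metis Diff_eq open_Compl openin_open_Int)
  have tC: "T \<subseteq> C" if "T \<in> M" for T
  proof -
    have "T = tile_map T ` ball 0 1" using PM_ball[of T "tile_map T"] tile_map that unfolding M_def by auto
    also have "\<dots> \<subseteq> tile_map T ` cball 0 1" by (intro image_mono) auto
    finally show ?thesis using that unfolding C_def by blast
  qed
  show False
  proof (cases "covers e = {}")
    case True
    then have "M = Tiles" unfolding M_def by auto
    then have "S2 - G \<subseteq> C" using Union_tiles tC by blast
    then have "S2 - C = open_edge e" using Ce GC open_edge_G[OF e] GS by blast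
    then show False using op open_edge_not_open edgeD(1)[OF e] by metis
  next
    case False
    then have "card (covers e) = 1" using c1 covers_le2[of e] card_gt_0_iff[of "covers e"] by linarith
    then obtain T i where Ti: "covers e = {(T, i)}" by (metis card_1_singletonE surj_pair)
    then have "(T, i) \<in> covers e" by simp
    then have T: "T \<in> Tiles" "i < 4" "side_edge (tile_map T) i = e" unfolding covers_def by auto
    note PMT = T(1) tile_map[OF T(1)]
    have M_eq: "M = Tiles - {T}" unfolding M_def Ti using Ti by auto
    have TG: "T \<inter> G = {}" using tile_sub[OF T(1)] by blast
    have TC: "T \<inter> C = {}"
    proof -
      have "tile_map T' ` cball 0 1 \<inter> T = {}" if "T' \<in> M" for T'
        using PM_cball[of T' "tile_map T'"] tile_map[of T'] that M_eq tiles_disjoint[of T' T] T(1) TG by blast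
      then show ?thesis using TG unfolding C_def by blast
    qed
    let ?N = "T \<union> open_edge e"
    have "S2 - G \<subseteq> C \<union> T"
    proof -
      have "\<Union>Tiles \<subseteq> C \<union> T" using tC M_eq by blast
      then show ?thesis using Union_tiles by simp
    qed
    then have N: "S2 - C = ?N"
      using TC Ce GC tile_sub[OF T(1)] open_edge_G[OF e] GS by blast
    let ?c = "tile_map T" let ?K = "cball 0 1 \<inter> ?c -` ?N"
    have Nsub: "?N \<subseteq> ?c ` cball 0 1"
    proof -
      have "?c ` ball 0 1 \<subseteq> ?c ` cball 0 1" "?c ` side 4 i \<subseteq> ?c ` cball 0 1"
        using side_sphere[of i] by (auto intro!: image_mono)
      then show ?thesis using PM_ball[OF PMT] side_edge(2)[OF PMT T(2)] T(3) by simp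
    qed
    have onside: "z \<in> side 4 i" if zc: "z \<in> cball 0 1" and ze: "?c z \<in> open_edge e" for z
    proof -
      obtain j where "j < 4" "z \<in> side 4 j" "side_edge ?c j = e" using PM_in_edge[OF PMT zc e ze] .
      then have "(T, j) \<in> covers e" using T(1) by (simp add: covers_def)
      then show ?thesis using Ti \<open>z \<in> side 4 j\<close> by simp
    qed
    have disj: "T \<inter> open_edge e = {}" using TG open_edge_G[OF e] by blast
    have inj: "inj_on ?c ?K"
    proof (rule inj_onI)
      fix z w assume zw: "z \<in> ?K" "w \<in> ?K" "?c z = ?c w"
      show "z = w"
      proof (cases "?c z \<in> T")
        case True
        then have "z \<in> ball 0 1" "w \<in> ball 0 1" using PM_in_T[OF PMT, of z] PM_in_T[OF PMT, of w] zw by auto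
        then show ?thesis using PM_inj[OF PMT] zw(3) by (auto dest: inj_onD)
      next
        case False
        then have "z \<in> side 4 i" "w \<in> side 4 i" using onside zw by auto
        then show ?thesis using PM_inj_side[OF PMT T(2)] zw(3) by (auto dest: inj_onD)
      qed
    qed
    obtain d where d: "homeomorphism ?K ?N ?c d"
      using homeomorphism_saturated[OF compact_cball PM_cont[OF PMT] Nsub inj] .
    have "open (d ` ?N)"
    proof (rule openin_sphere_image_plane)
      show "openin (top_of_set S2) ?N" using op N by simp
      show "continuous_on ?N d" using homeomorphism_cont2[OF d] .
      show "inj_on d ?N" using homeomorphism_apply2[OF d] by (intro inj_on_inverseI[of _ ?c]) auto
    qed
    \<comment> \<open>\<open>?K\<close> lies in the closed disk, so as an open set of the plane it
      would avoid the unit circle; but it contains side \<open>i\<close>.\<close>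
    then have "open ?K" using homeomorphism_image2[OF d] by simp
    then have "?K \<subseteq> interior (cball 0 1)" by (intro interior_maximal) auto
    then have K: "?K \<subseteq> ball 0 1" by simp
    have "ang (real i + 1/2) \<in> side 4 i" unfolding side_4 by (intro imageI) simp
    then obtain z where z: "z \<in> side 4 i" by blast
    then have "?c z \<in> open_edge e" using side_edge(2)[OF PMT T(2)] T(3) by blast
    then have "z \<in> ?K" using z side_sphere[of i] by auto
    then have "z \<in> ball 0 1" using K by blast
    moreover have "cmod z = 1" using z side_sphere[of i] by auto
    ultimately show False by simp
  qed
qed

lemma covers_pair:
  assumes "e \<in> E"
  obtains T i T' j where "covers e = {(T, i), (T', j)}" "(T, i) \<noteq> (T', j)"
  using card_covers[OF assms] by (metis card_2_iff surj_pair)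

lemma coversD: "(T, i) \<in> covers e \<Longrightarrow> T \<in> Tiles \<and> i < 4 \<and> side_edge (tile_map T) i = e"
  by (simp add: covers_def)

lemma sector_ne: "sector i \<noteq> {}"
proof -
  have "of_real (1/2) * ang (real i + 1/2) \<in> sector i"
    unfolding sector_def mem_Collect_eq by (intro exI[of _ "1/2"] exI[of _ "real i + 1/2"] conjI refl) auto
  then show ?thesis by blast
qed

text \<open>The number \<open>a e\<close> counts the tile sides on \<open>e\<close> whose tile lies
  in \<open>A\<close>. Off \<open>K\<close> the strip along \<open>e\<close> is connected and avoids
  the curve, so \<open>a e\<close> is 0 or 2. On \<open>K\<close> both \<open>A\<close> and
  \<open>B\<close> accumulate at the edge, and only the two sectors are available there, so
  \<open>a e\<close> is 1.\<close>

lemma even_Jordan_cycle: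
  assumes J: "simple_path J" "pathfinish J = pathstart J" and K: "K \<subseteq> E"
    and JK: "path_image J = (\<Union>e\<in>K. path_image e)"
  shows "even (card K)"
proof -
  have "K \<noteq> {}" using JK path_image_nonempty[of J] by auto
  then obtain e0 where "e0 \<in> E" using K by blast
  then obtain T0 i0 T1 i1 where "covers e0 = {(T0, i0), (T1, i1)}" by (rule covers_pair)
  then have "(T0, i0) \<in> covers e0" by simp
  then have T0: "T0 \<in> Tiles" using coversD by blast
  \<comment> \<open>A point inside a tile is off the whole graph, so it can be the pole for
    \<open>Jordan_sphere\<close>.\<close>
  obtain p where p: "p \<in> T0" using tile_ne[OF T0] by blast
  have JG: "path_image J \<subseteq> G" unfolding JK G_def using K by blast
  have JS: "path_image J \<subseteq> S2" using JG GS by blast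
  have pS: "p \<in> S2" "p \<notin> path_image J" using p tile_sub[OF T0] JG by blast+
  obtain A B where AB: "openin (top_of_set S2) A" "openin (top_of_set S2) B" "A \<inter> B = {}"
    "A \<union> B = S2 - path_image J" "path_image J \<subseteq> closure A" "path_image J \<subseteq> closure B"
    using Jordan_sphere[OF J JS pS] .
  have split: "N \<subseteq> A \<or> N \<subseteq> B" if "connected N" "N \<subseteq> S2 - path_image J" for N
    using connected_subset_split[OF that(1) _ AB(1,2,3)] that(2) AB(4) by simp
  have tile_AB: "T \<subseteq> A \<or> T \<subseteq> B" if "T \<in> Tiles" for T
    using split[OF tile_connected[OF that]] tile_sub[OF that] JG by blast
  have iff: "T \<subseteq> A \<longleftrightarrow> X \<subseteq> A" if "T \<in> Tiles" "X \<subseteq> T" "X \<noteq> {}" for T X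
    using tile_AB[OF that(1)] that AB(3) by blast
  define a where "a e = card {(T, i) \<in> covers e. T \<subseteq> A}" for e
  have odd_a: "odd (a e) \<longleftrightarrow> e \<in> K" if e: "e \<in> E" for e
  proof -
    obtain T i T' j where c: "covers e = {(T, i), (T', j)}" "(T, i) \<noteq> (T', j)"
      using covers_pair[OF e] .
    then have m: "(T, i) \<in> covers e" "(T', j) \<in> covers e" by auto
    have TT': "T \<in> Tiles" "T' \<in> Tiles" using coversD m by blast+
    let ?s = "tile_map T ` sector i" let ?s' = "tile_map T' ` sector j"
    let ?N = "?s \<union> open_edge e \<union> ?s'"
    have s: "?s \<subseteq> T" "?s \<noteq> {}" "?s' \<subseteq> T'" "?s' \<noteq> {}"
      using sector_image[OF TT'(1) tile_map[OF TT'(1)]] sector_image[OF TT'(2) tile_map[OF TT'(2)]] sector_ne by auto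
    have a_eq: "a e = (if T \<subseteq> A then 1 else 0) + (if T' \<subseteq> A then 1 else 0)"
    proof -
      have "{(T, i) \<in> covers e. T \<subseteq> A} = (if T \<subseteq> A then {(T, i)} else {}) \<union> (if T' \<subseteq> A then {(T', j)} else {})"
        unfolding c(1) by auto
      moreover have "card ((if T \<subseteq> A then {(T, i)} else {}) \<union> (if T' \<subseteq> A then {(T', j)} else {}))
        = (if T \<subseteq> A then 1 else 0) + (if T' \<subseteq> A then 1 else 0)"
        using c(2) c(2)[symmetric] by (cases "T \<subseteq> A"; cases "T' \<subseteq> A") (simp_all only: if_True if_False, auto simp: card_insert_if)
      ultimately show ?thesis unfolding a_def by presburger
    qed
    show ?thesis
    proof (cases "e \<in> K")
      case False
      have "open_edge e \<inter> path_image J = {}"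
      proof -
        have "path_image J \<subseteq> V \<union> (\<Union>g\<in>E - {e}. path_image g)" unfolding JK using K False by blast
        then show ?thesis using G_minus[OF e] by blast
      qed
      moreover have "?s \<union> ?s' \<subseteq> S2 - path_image J"
        using s tile_sub[OF TT'(1)] tile_sub[OF TT'(2)] JG by blast
      ultimately have "?N \<subseteq> S2 - path_image J" using open_edge_G[OF e] GS by blast
      then have "?N \<subseteq> A \<or> ?N \<subseteq> B" using split covers_glue(2)[OF m c(2)] by blast
      then have "?s \<subseteq> A \<longleftrightarrow> ?s' \<subseteq> A" using s AB(3) by blast
      then have "T \<subseteq> A \<longleftrightarrow> T' \<subseteq> A" using iff s TT' by metis
      then show ?thesis using False a_eq by auto
    next
      case True
      obtain x where x: "x \<in> open_edge e" using open_edge_ne[of e] by blast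
      then have xJ: "x \<in> path_image J" unfolding JK using True path_image_open_edge by blast
      obtain W where W: "open W" "?N = S2 \<inter> W" using covers_glue(1)[OF m c(2)] openin_open by metis
      have eJ: "open_edge e \<subseteq> path_image J" unfolding JK using True path_image_open_edge by blast
      \<comment> \<open>Near \<open>x\<close> the sphere is covered by the strip, and a point of the
        strip off the curve lies in one of the two sectors.\<close>
      have *: "\<exists>y\<in>X. y \<in> ?s \<union> ?s'" if xc: "x \<in> closure X" and XJ: "X \<subseteq> S2 - path_image J" for X
      proof -
        have "x \<in> W" using x W by blast
        then obtain y where "y \<in> X" "y \<in> W" using open_Int_closure_eq_empty[OF W(1), of X] xc by blast
        moreover have "y \<in> S2" "y \<notin> path_image J" using XJ \<open>y \<in> X\<close> by blast+
        ultimately have "y \<in> S2 \<inter> W" "y \<notin> open_edge e" using eJ by blast+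
        then have "y \<in> ?s \<union> ?s'" unfolding W(2)[symmetric] by blast
        then show ?thesis using \<open>y \<in> X\<close> by blast
      qed
      have "x \<in> closure A" "x \<in> closure B" "A \<subseteq> S2 - path_image J" "B \<subseteq> S2 - path_image J"
        using AB(4,5,6) xJ by blast+
      then obtain y z where "y \<in> A" "y \<in> ?s \<union> ?s'" "z \<in> B" "z \<in> ?s \<union> ?s'"
        using *[of A] *[of B] by blast
      then have y: "y \<in> A" "y \<in> T \<union> T'" and z: "z \<in> B" "z \<in> T \<union> T'" using s by blast+
      have "\<not> (T \<subseteq> A \<and> T' \<subseteq> A)" using z AB(3) by blast
      moreover have "\<not> (T \<subseteq> B \<and> T' \<subseteq> B)" using y AB(3) by blast
      ultimately have "T \<subseteq> A \<longleftrightarrow> \<not> T' \<subseteq> A"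
        using tile_AB TT' by blast
      then show ?thesis using True a_eq by auto
    qed
  qed
  \<comment> \<open>Double counting of the sides of the tiles in \<open>A\<close>: four for each
    tile on the left, edge by edge on the right.\<close>
  have "{T \<in> Tiles. T \<subseteq> A} \<times> {..<4} = (\<Union>e\<in>E. {(T, i) \<in> covers e. T \<subseteq> A})"
  proof (intro equalityI subsetI)
    fix p assume "p \<in> {T \<in> Tiles. T \<subseteq> A} \<times> {..<4::nat}"
    then obtain T i where p: "p = (T, i)" "T \<in> Tiles" "T \<subseteq> A" "i < 4" by auto
    then have "side_edge (tile_map T) i \<in> E" "(T, i) \<in> covers (side_edge (tile_map T) i)"
      using side_edge(1)[OF p(2) tile_map[OF p(2)] p(4)] by (auto simp: covers_def)
    then show "p \<in> (\<Union>e\<in>E. {(T, i) \<in> covers e. T \<subseteq> A})" using p by blast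
  qed (auto simp: covers_def)
  then have "card ({T \<in> Tiles. T \<subseteq> A} \<times> {..<4::nat}) = card (\<Union>e\<in>E. {(T, i) \<in> covers e. T \<subseteq> A})"
    by simp
  also have "\<dots> = (\<Sum>e\<in>E. a e)" unfolding a_def
  proof (rule card_UN_disjoint)
    show "\<forall>e\<in>E. finite {(T, i) \<in> covers e. T \<subseteq> A}"
      using covers_le2 by (auto intro: finite_subset[of _ "covers e" for e])
  qed (use finE in \<open>auto simp: covers_def\<close>)
  finally have "(\<Sum>e\<in>E. a e) = card {T \<in> Tiles. T \<subseteq> A} * 4" by (simp add: card_cartesian_product)
  then have "even (\<Sum>e\<in>E. a e)" by simp
  then have "even (card {e \<in> E. odd (a e)})" using finE by (simp add: even_sum_iff)
  moreover have "{e \<in> E. odd (a e)} = K" using odd_a K by auto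
  ultimately show ?thesis by simp
qed

text \<open>In \<open>spath F u v A K\<close>, \<open>A\<close> collects the vertices and \<open>K\<close> the edges of a simple path from \<open>u\<close> to \<open>v\<close>.\<close>

inductive spath :: "(real \<Rightarrow> real ^ 3) set \<Rightarrow> real ^ 3 \<Rightarrow> real ^ 3 \<Rightarrow> (real ^ 3) set \<Rightarrow> (real \<Rightarrow> real ^ 3) set \<Rightarrow> bool"
  for F u where
  nil: "spath F u u {u} {}"
| step: "spath F u v A K \<Longrightarrow> e \<in> F \<Longrightarrow> {e 0, e 1} = {v, w} \<Longrightarrow> w \<notin> A \<Longrightarrow> spath F u w (insert w A) (insert e K)"

lemma spath_basic:
  assumes "spath F u v A K"
  shows "K \<subseteq> F \<and> finite K \<and> u \<in> A \<and> v \<in> A \<and> (\<forall>e\<in>K. e 0 \<in> A \<and> e 1 \<in> A)"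
  using assms
proof induction
  case (step v A K e w)
  have "e 0 \<in> {v, w}" "e 1 \<in> {v, w}" using step.hyps(3) by blast+
  then show ?case using step by auto
qed simp

lemma spath_sub:
  assumes "spath F u v A K" "x \<in> A"
  shows "\<exists>A' K'. spath F u x A' K'"
  using assms by (induction) (auto intro: spath.intros)

lemma spath_parity:
  assumes "spath F u v A K" "\<And>e. e \<in> F \<Longrightarrow> \<kappa> (e 0) \<noteq> (\<kappa> (e 1) :: bool)"
  shows "even (card K) \<longleftrightarrow> \<kappa> u = \<kappa> v"
  using assms(1)
proof induction
  case (step v A K e w)
  note b = spath_basic[OF step.hyps(1)]
  have "w \<in> {e 0, e 1}" using step.hyps(3) by blast
  then have "e \<notin> K" using b step.hyps(4) by auto
  then have "card (insert e K) = Suc (card K)" using b by simp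
  moreover have "\<kappa> v \<noteq> \<kappa> w" using assms(2)[OF step.hyps(2)] step.hyps(3) by (metis doubleton_eq_iff)
  ultimately show ?case using step.IH by auto
qed simp

lemma oriented_edge:
  assumes e: "e \<in> E" and vw: "{e 0, e 1} = {v, w}" "v \<noteq> w"
  obtains P where "arc P" "pathstart P = v" "pathfinish P = w" "path_image P = path_image e"
proof -
  have ne: "e 0 \<noteq> e 1" using vw by auto
  have arc: "arc e" using edgeD(1)[OF e] ne by (simp add: arc_simple_path pathstart_def pathfinish_def)
  from vw(1) ne consider "e 0 = v" "e 1 = w" | "e 0 = w" "e 1 = v" by (metis doubleton_eq_iff)
  then show ?thesis
  proof cases
    case 1 then show ?thesis using that[of e] arc by (simp add: pathstart_def pathfinish_def)
  next
    case 2 then show ?thesis using that[of "reversepath e"] arc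
      by (simp add: arc_reversepath) (simp add: pathstart_def pathfinish_def)
  qed
qed

lemma edge_Int_path:
  assumes e: "e \<in> E" and K: "K \<subseteq> E" "e \<notin> K" and ev: "{e 0, e 1} = {v, w}"
  shows "(\<Union>g\<in>K. path_image g) \<inter> path_image e \<subseteq> {v, w}"
proof -
  have "(\<Union>g\<in>K. path_image g) \<subseteq> V \<union> (\<Union>g\<in>E - {e}. path_image g)" using K by blast
  then have "(\<Union>g\<in>K. path_image g) \<inter> open_edge e = {}" using G_minus[OF e] by blast
  then show ?thesis unfolding path_image_open_edge[of e] ev by blast
qed

text \<open>The equation with \<open>A\<close> is the invariant that carries the induction: a new
  vertex outside \<open>A\<close> is off the arc, so the next edge meets the arc only in its last
  vertex. The path without edges is a separate case because an arc is not constant.\<close>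

lemma spath_arc:
  assumes "spath F u v A K" "F \<subseteq> E" "u \<in> V"
  shows "(K = {} \<and> v = u \<and> A = {u}) \<or>
    (\<exists>P. arc P \<and> pathstart P = u \<and> pathfinish P = v \<and> path_image P = (\<Union>e\<in>K. path_image e)
       \<and> path_image P \<inter> V = A)"
  using assms(1)
proof induction
  case (step v A K e w)
  note b = spath_basic[OF step.hyps(1)]
  have e: "e \<in> E" using step.hyps assms by blast
  have "w \<in> {e 0, e 1}" using step.hyps(3) by blast
  then have eK: "e \<notin> K" using b step.hyps(4) by auto
  have KE: "K \<subseteq> E" using b assms by blast
  have ne: "v \<noteq> w" using b step.hyps by blast
  obtain Q where Q: "arc Q" "pathstart Q = v" "pathfinish Q = w" "path_image Q = path_image e"
    using oriented_edge[OF e step.hyps(3) ne] .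
  have QV: "path_image Q \<inter> V = {v, w}"
  proof -
    have "path_image Q = open_edge e \<union> {v, w}"
      using Q(4) path_image_open_edge[of e] step.hyps(3) by simp
    moreover have "{v, w} \<subseteq> V" using edgeD(3,4)[OF e] unfolding step.hyps(3)[symmetric] by blast
    ultimately show ?thesis using edgeD(5)[OF e] by blast
  qed
  from step.IH show ?case
  proof (elim disjE exE conjE)
    assume "K = {}" "v = u" "A = {u}"
    then show ?thesis using Q QV by (intro disjI2 exI[of _ Q]) auto
  next
    fix P assume P: "arc P" "pathstart P = u" "pathfinish P = v" "path_image P = (\<Union>e\<in>K. path_image e)"
      "path_image P \<inter> V = A"
    have wV: "w \<in> V" using QV by blast
    have "path_image P \<inter> path_image Q \<subseteq> {v, w}"
      unfolding P(4) Q(4) using edge_Int_path[OF e KE eK step.hyps(3)] .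
    moreover have "w \<notin> path_image P" using P(5) wV step.hyps by blast
    ultimately have "path_image P \<inter> path_image Q \<subseteq> {pathstart Q}" using Q by blast
    then have "arc (P +++ Q)" using P Q by (intro arc_join) auto
    moreover have im: "path_image (P +++ Q) = path_image P \<union> path_image Q"
      using P Q by (simp add: path_image_join)
    moreover have "(path_image P \<union> path_image Q) \<inter> V = insert w A"
      using P(5) QV b by auto
    ultimately show ?thesis
      using P Q by (intro disjI2 exI[of _ "P +++ Q"]) auto
  qed
qed simp

text \<open>Equal colours at the ends make the path even, and \<open>g\<close> closes it to a Jordan
  curve with an odd number of edges. The path without edges is the case of a loop \<open>g\<close>,
  a cycle of length 1.\<close>

lemma coloring_step:
  assumes F: "F \<subseteq> E" and g: "g \<in> E" "g \<notin> F" and \<kappa>: "\<And>e. e \<in> F \<Longrightarrow> \<kappa> (e 0) \<noteq> (\<kappa> (e 1) :: bool)"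
    and eq: "\<kappa> (g 0) = \<kappa> (g 1)" and sp: "spath F (g 0) (g 1) A K"
  shows False
proof -
  note b = spath_basic[OF sp]
  have KE: "K \<subseteq> E" and gK: "g \<notin> K" using b F g by auto
  have "even (card K)" using spath_parity[OF sp, of \<kappa>] \<kappa> eq by blast
  then have odd: "odd (card (insert g K))" using b gK by simp
  have "\<exists>J. simple_path J \<and> pathfinish J = pathstart J \<and> path_image J = (\<Union>e\<in>insert g K. path_image e)"
    using spath_arc[OF sp F edgeD(3)[OF g(1)]]
  proof (elim disjE exE conjE)
    assume "K = {}" "g 1 = g 0"
    then show ?thesis using edgeD(1)[OF g(1)] by (intro exI[of _ g]) (simp add: pathstart_def pathfinish_def)
  next
    fix P assume P: "arc P" "pathstart P = g 0" "pathfinish P = g 1" "path_image P = (\<Union>e\<in>K. path_image e)"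
    have ne: "g 1 \<noteq> g 0" using P(1-3) by (metis arc_distinct_ends)
    have gg: "{g 0, g 1} = {g 1, g 0}" by auto
    obtain Q where Q: "arc Q" "pathstart Q = g 1" "pathfinish Q = g 0" "path_image Q = path_image g"
      using oriented_edge[OF g(1) gg ne] .
    have "path_image P \<inter> path_image Q \<subseteq> {pathstart P, pathstart Q}"
      unfolding P(2,4) Q(2,4) using edge_Int_path[OF g(1) KE gK] by blast
    then have "simple_path (P +++ Q)" using P Q by (intro simple_path_join_loop) auto
    then show ?thesis using P Q by (intro exI[of _ "P +++ Q"]) (auto simp: path_image_join)
  qed
  then show False using even_Jordan_cycle[of _ "insert g K"] KE g odd by blast
qed

text \<open>Edges are added one at a time. If the new edge \<open>g\<close> joins equal colours, the
  colours are flipped on the set \<open>R\<close> of vertices reachable from \<open>g 0\<close>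
  through the old edges. No old edge leaves \<open>R\<close>, and \<open>g 1\<close> is outside
  \<open>R\<close> by \<open>coloring_step\<close>.\<close>

lemma ex_coloring_aux:
  "finite F \<Longrightarrow> F \<subseteq> E \<Longrightarrow> \<exists>\<kappa> :: real ^ 3 \<Rightarrow> bool. \<forall>e\<in>F. \<kappa> (e 0) \<noteq> \<kappa> (e 1)"
proof (induction F rule: finite_induct)
  case (insert g F)
  then obtain \<kappa> :: "real ^ 3 \<Rightarrow> bool" where \<kappa>: "\<forall>e\<in>F. \<kappa> (e 0) \<noteq> \<kappa> (e 1)" by auto
  show ?case
  proof (cases "\<kappa> (g 0) = \<kappa> (g 1)")
    case False
    then show ?thesis using \<kappa> by (intro exI[of _ \<kappa>]) auto
  next
    case True
    define R where "R = {w. \<exists>A K. spath F (g 0) w A K}"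
    have g0: "g 0 \<in> R" unfolding R_def using spath.nil by blast
    have g1: "g 1 \<notin> R" unfolding R_def
      using coloring_step[of F g \<kappa>] insert.prems insert.hyps \<kappa> True by blast
    have step: "w \<in> R" if "v \<in> R" "e \<in> F" "{e 0, e 1} = {v, w}" for v w e
      using that spath.step spath_sub unfolding R_def by blast
    have "e 0 \<in> R \<longleftrightarrow> e 1 \<in> R" if "e \<in> F" for e
      using step[of "e 0" e "e 1"] step[of "e 1" e "e 0"] that by (auto simp: insert_commute)
    then show ?thesis
      using \<kappa> True g0 g1 by (intro exI[of _ "\<lambda>v. \<kappa> v \<noteq> (v \<in> R)"]) auto
  qed
qed simp

definition colour :: "real ^ 3 \<Rightarrow> bool" where
  "colour = (SOME \<kappa>. \<forall>e\<in>E. \<kappa> (e 0) \<noteq> \<kappa> (e 1))"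

lemma colour: "e \<in> E \<Longrightarrow> colour (e 0) \<noteq> colour (e 1)"
  using someI_ex[OF ex_coloring_aux[OF finE subset_refl]] unfolding colour_def by blast

end

section \<open>Degenerate tiles\<close>

lemma all_less_4: "(\<forall>i<4. P i) \<longleftrightarrow> P 0 \<and> P 1 \<and> P 2 \<and> P (3::nat)"
  by (auto simp: numeral_eq_Suc All_less_Suc)

lemma less_4_cases: "i < 4 \<Longrightarrow> i = 0 \<or> i = 1 \<or> i = 2 \<or> i = (3::nat)"
  by linarith

lemma ang_Suc_corner: "i < 4 \<Longrightarrow> ang (real i + 1) = corner 4 ((i + 1) mod 4)"
  using less_4_cases[of i] by (auto simp: corner_4 ang_int)

lemma rot_corner: "i < 4 \<Longrightarrow> \<i> * corner 4 i = corner 4 ((i + 1) mod 4)"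
  using ang_add[of "real i" 1] ang_Suc_corner[of i] by (simp add: corner_4 ang_int mult.commute)

lemma rot_side:
  assumes "i < 4" shows "(*) \<i> ` side 4 i = side 4 ((i + 1) mod 4)"
proof -
  have "\<i> * ang (real i + t) = ang (real ((i + 1) mod 4) + t)" for t
  proof -
    have "\<i> * ang (real i + t) = \<i> * corner 4 i * ang t" by (simp add: ang_add corner_4)
    also have "\<dots> = ang (real ((i + 1) mod 4) + t)"
      using rot_corner[OF assms] by (simp only: ang_add corner_4)
    finally show ?thesis .
  qed
  then show ?thesis unfolding side_4' image_image by simp
qed

lemma corners: "corner 4 0 = 1" "corner 4 1 = \<i>" "corner 4 2 = -1" "corner 4 3 = -\<i>"
  by (simp_all add: corner_4 ang_int)

lemma Im_ang_pos: "0 < x \<Longrightarrow> x < 2 \<Longrightarrow> Im (ang x) > 0"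
  unfolding ang_def by (auto intro!: sin_gt_zero simp: field_simps)

lemma Im_ang_neg: "2 < x \<Longrightarrow> x < 4 \<Longrightarrow> Im (ang x) < 0"
  unfolding ang_def by (auto intro!: sin_lt_zero simp: field_simps)

lemma upper_circle:
  assumes "cmod z = 1" "Im z > 0"
  shows "z = \<i> \<or> z \<in> side 4 0 \<or> z \<in> side 4 1"
proof -
  have zs: "z \<in> sphere 0 1" using assms by simp
  show ?thesis
    using zs
  proof (cases rule: circle_decomposition)
    case (1 i) then show ?thesis using less_4_cases[of i] assms by (auto simp: corners simp flip: One_nat_def)
  next
    case (2 i)
    then obtain x where x: "z = ang x" "real i < x" "x < real i + 1" by (auto simp: side_4)
    then have "x < 2" using Im_ang_neg[of x] 2(1) assms(2) less_4_cases[of i] ang_int(3)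
      by (cases "x = 2") (auto simp: not_less)
    then have "i = 0 \<or> i = 1" using x less_4_cases[of i] 2(1) by auto
    then show ?thesis using 2 by auto
  qed
qed

context quad_tiling begin

text \<open>Multiplication by \<open>\<i>\<close> shifts the labels of the corners by one, so facts
  proved for sides 0, 1 and 2 spread to the other positions.\<close>

lemma PM_rot:
  assumes "PM T c"
  shows "PM T (\<lambda>z. c (\<i> * z))"
proof -
  obtain d where d: "homeomorphism (ball 0 1) T c d" using assms unfolding polygon_map_def by auto
  have "homeomorphism (ball 0 1) (ball 0 1) (\<lambda>z. \<i> * z) (\<lambda>z. - \<i> * z)"
    by (rule homeomorphismI) (auto intro!: continuous_intros simp: norm_mult)
  then have "homeomorphism (ball 0 1) T (c \<circ> (\<lambda>z. \<i> * z)) ((\<lambda>z. - \<i> * z) \<circ> d)"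
    using d homeomorphism_compose by blast
  then have "\<exists>d. homeomorphism (ball 0 1) T (\<lambda>z. c (\<i> * z)) d" by (auto simp: comp_def)
  moreover have "continuous_on (cball 0 1) (\<lambda>z. c (\<i> * z))"
    using assms unfolding polygon_map_def
    by (auto intro!: continuous_on_compose2[of "cball 0 1" c] continuous_intros simp: norm_mult)
  moreover have "c (\<i> * corner 4 i) \<in> V" if "i < 4" for i
    using assms that unfolding polygon_map_def by (simp add: rot_corner)
  moreover have "inj_on (\<lambda>z. c (\<i> * z)) (side 4 i) \<and> (\<exists>g\<in>E. (\<lambda>z. c (\<i> * z)) ` side 4 i = open_edge g)"
    if i: "i < 4" for i
  proof -
    have im: "(\<lambda>z. c (\<i> * z)) ` side 4 i = c ` side 4 ((i + 1) mod 4)"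
      using rot_side[OF i] by (metis image_image)
    have "inj_on c ((*) \<i> ` side 4 i)"
      using assms unfolding rot_side[OF i] polygon_map_def by simp
    moreover have "inj_on ((*) \<i>) (side 4 i)" by (auto intro: inj_onI)
    ultimately have "inj_on (c \<circ> (*) \<i>) (side 4 i)" by (rule comp_inj_on[rotated])
    then show ?thesis
      using assms unfolding im polygon_map_def by (simp add: comp_def)
  qed
  ultimately show ?thesis unfolding polygon_map_def by blast
qed

lemma side_edge_rot: "i < 4 \<Longrightarrow> side_edge (\<lambda>z. c (\<i> * z)) i = side_edge c ((i + 1) mod 4)"
proof -
  assume i: "i < 4"
  have "(\<lambda>z. c (\<i> * z)) ` side 4 i = c ` side 4 ((i + 1) mod 4)"
    using rot_side[OF i] by (metis image_image)
  then show ?thesis unfolding side_edge_def by simp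
qed

context
  fixes T c assumes T: "T \<in> Tiles" and PM: "PM T c"
begin

lemma side_edge_ends:
  assumes "i < 4"
  shows "(side_edge c i 0 = c (corner 4 i) \<and> side_edge c i 1 = c (corner 4 ((i + 1) mod 4))) \<or>
    (side_edge c i 1 = c (corner 4 i) \<and> side_edge c i 0 = c (corner 4 ((i + 1) mod 4)))"
proof -
  obtain \<theta> where "\<forall>t\<in>{0..1}. side_edge c i t = c (ang (real i + \<theta> t))" "(\<theta> 0 = 0 \<and> \<theta> 1 = 1) \<or> (\<theta> 0 = 1 \<and> \<theta> 1 = (0::real))"
    using side_param[OF T PM assms] by metis
  then show ?thesis using ang_Suc_corner[OF assms] by (auto simp: corner_4)
qed

lemma colour_corner: "i < 4 \<Longrightarrow> colour (c (corner 4 i)) \<noteq> colour (c (corner 4 ((i + 1) mod 4)))"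
  using side_edge_ends[of i] colour[OF side_edge(1)[OF T PM, of i]] by auto

lemma colour_corners:
  "colour (c 1) \<noteq> colour (c \<i>)" "colour (c \<i>) \<noteq> colour (c (-1))" "colour (c (-1)) \<noteq> colour (c (-\<i>))" "colour (c (-\<i>)) \<noteq> colour (c 1)"
  using colour_corner[of 0] colour_corner[of 1] colour_corner[of 2] colour_corner[of 3] by (simp_all add: corners del: One_nat_def)

lemma corner_V: "c 1 \<in> V" "c \<i> \<in> V" "c (-1) \<in> V" "c (-\<i>) \<in> V"
  using PM_corner[OF T PM, of 0] PM_corner[OF T PM, of 1] PM_corner[OF T PM, of 2] PM_corner[OF T PM, of 3]
  by (simp_all add: corners del: One_nat_def)

lemma real_diameter:
  assumes "z \<in> cball 0 1" "Im z = 0"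
  shows "z = 1 \<or> z = -1 \<or> z \<in> ball 0 1"
proof -
  have "z = of_real (Re z)" using assms by (simp add: complex_eq_iff)
  then have "cmod z = \<bar>Re z\<bar>" by (metis norm_of_real)
  then show ?thesis using assms by (auto simp: complex_eq_iff)
qed

text \<open>The image of the real diameter is simple because \<open>c\<close> is injective inside
  the disk and the inside is kept apart from the boundary. Adjacent corners have different colours,
  hence \<open>c \<i>\<close> is off this curve and can join the images of the two half
  disks.\<close>

lemma not_both_diagonals: "\<not> (c 1 = c (-1) \<and> c \<i> = c (-\<i>))"
proof
  assume eq: "c 1 = c (-1) \<and> c \<i> = c (-\<i>)"
  define l where "l = linepath (1::complex) (-1)"
  have l: "l t = of_real (1 - 2 * t)" for t by (simp add: l_def linepath_def algebra_simps scaleR_conv_of_real)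
  have l_im: "path_image l = {z \<in> cball 0 1. Im z = 0}"
  proof (intro equalityI subsetI)
    fix z assume "z \<in> path_image l"
    then obtain t where "t \<in> {0..1}" "z = l t" unfolding path_image_def by blast
    then show "z \<in> {z \<in> cball 0 1. Im z = 0}" unfolding l by (auto simp del: of_real_diff of_real_mult of_real_1)
  next
    fix z :: complex assume z: "z \<in> {z \<in> cball 0 1. Im z = 0}"
    then have zr: "z = of_real (Re z)" by (simp add: complex_eq_iff)
    have "\<bar>Re z\<bar> \<le> 1" using z abs_Re_le_cmod[of z] by auto
    then have "(1 - Re z) / 2 \<in> {0..1}" by auto
    moreover have "z = l ((1 - Re z) / 2)" unfolding l using zr by (simp add: field_simps)
    ultimately show "z \<in> path_image l" unfolding path_image_def by blast
  qed
  let ?J = "c \<circ> l"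
  have J_im: "path_image ?J = c ` {z \<in> cball 0 1. Im z = 0}"
    unfolding l_im[symmetric] by (simp add: path_image_def image_comp)
  have lball: "l t \<in> ball 0 1" if "t \<in> {0<..<1}" for t
    using that unfolding l by (auto simp del: of_real_diff of_real_mult of_real_1)
  have lcb: "l t \<in> cball 0 1" if "t \<in> {0..1}" for t
    using that unfolding l by (auto simp del: of_real_diff of_real_mult of_real_1)
  have VT: "c z \<notin> T" if "c z \<in> V" for z using that tile_sub[OF T] by (auto simp: G_def)
  have "simple_path ?J"
    unfolding simple_path_def loop_free_def
  proof (intro conjI ballI impI)
    show "path ?J" unfolding path_def
      by (rule continuous_on_compose[OF _ continuous_on_subset[OF PM_cont[OF T PM]]])
        (use lcb in \<open>auto simp: l intro!: continuous_intros\<close>)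
    fix x y :: real assume xy: "x \<in> {0..1}" "y \<in> {0..1}" "?J x = ?J y"
    show "x = y \<or> x = 0 \<and> y = 1 \<or> x = 1 \<and> y = 0"
    proof (cases "x \<in> {0<..<1} \<or> y \<in> {0<..<1}")
      case True
      then have "l x \<in> ball 0 1" "l y \<in> ball 0 1"
        using PM_in_T[OF T PM lcb[OF xy(1)]] PM_in_T[OF T PM lcb[OF xy(2)]] lball xy(3) by auto
      then have "l x = l y" using PM_inj[OF T PM] xy(3) by (auto dest: inj_onD)
      then show ?thesis unfolding l of_real_eq_iff by simp
    qed (use xy in auto)
  qed
  moreover have "pathfinish ?J = pathstart ?J" using eq by (simp add: pathfinish_def pathstart_def l)
  moreover have "path_image ?J \<subseteq> S2" unfolding J_im using PM_cball_S2[OF T PM] by blast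
  moreover have not_J: "c z \<notin> path_image ?J" if z: "z \<in> cball 0 1" "Im z \<noteq> 0" "z \<in> ball 0 1 \<or> z = \<i> \<or> z = -\<i>" for z
  proof
    assume "c z \<in> path_image ?J"
    then obtain w where w: "w \<in> cball 0 1" "Im w = 0" "c z = c w" unfolding J_im by auto
    have iff: "z \<in> ball 0 1 \<longleftrightarrow> w \<in> ball 0 1"
      using PM_in_T[OF T PM z(1)] PM_in_T[OF T PM w(1)] w(3) by simp
    show False
    proof (cases "z \<in> ball 0 1")
      case True
      then have "z = w" using iff PM_inj[OF T PM] w(3) by (auto dest: inj_onD)
      then show False using z w by simp
    next
      case False
      then have "w = 1 \<or> w = -1" using real_diameter[OF w(1,2)] iff by blast
      moreover have "z = \<i> \<or> z = -\<i>" using False z by blast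
      ultimately show False using w(3) colour_corners by metis
    qed
  qed
  moreover have "c (\<i> / 2) \<notin> path_image ?J" by (rule not_J) auto
  moreover have "c (\<i> / 2) \<in> S2" using PM_cball_S2[OF T PM] by (auto simp: image_subset_iff)
  ultimately obtain A B where AB: "openin (top_of_set S2) A" "openin (top_of_set S2) B" "A \<inter> B = {}"
    "A \<union> B = S2 - path_image ?J" "path_image ?J \<subseteq> closure A" "path_image ?J \<subseteq> closure B"
    using Jordan_sphere[of ?J "c (\<i> / 2)"] by metis
  define Hp where "Hp = {z. Im z > 0} \<inter> ball 0 1"
  define Hm where "Hm = {z. Im z < 0} \<inter> ball 0 1"
  \<comment> \<open>The segments attach the corners \<open>\<i>\<close> and \<open>-\<i>\<close> to
    the open half disks without leaving connected sets.\<close>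
  define Dp where "Dp = closed_segment \<i> (\<i> / 2)"
  define Dm where "Dm = closed_segment (-\<i>) (-(\<i> / 2))"
  have "convex Hp" "convex Hm" "convex Dp" "convex Dm"
    unfolding Hp_def Hm_def Dp_def Dm_def
    by (auto intro!: convex_Int convex_halfspace_Im_gt convex_halfspace_Im_lt)
  then have con: "connected Hp" "connected Hm" "connected Dp" "connected Dm" by (auto intro: convex_connected)
  have Dz: "z \<in> cball 0 1 \<and> Im z \<noteq> 0 \<and> (z \<in> ball 0 1 \<or> z = \<i> \<or> z = -\<i>)" if zD: "z \<in> Dp \<union> Dm" for z
  proof -
    obtain u :: real where u: "0 \<le> u" "u \<le> 1" and z: "z = of_real (1 - u / 2) * \<i> \<or> z = of_real (1 - u / 2) * (-\<i>)"
    proof -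
      from zD obtain u where u: "0 \<le> u" "u \<le> 1"
        "z = (1 - u) *\<^sub>R \<i> + u *\<^sub>R (\<i> / 2) \<or> z = (1 - u) *\<^sub>R (-\<i>) + u *\<^sub>R (-(\<i> / 2))"
        unfolding Dp_def Dm_def closed_segment_def by blast
      then have "z = of_real (1 - u / 2) * \<i> \<or> z = of_real (1 - u / 2) * (-\<i>)"
        by (auto simp: complex_eq_iff)
      then show thesis using u that by blast
    qed
    have "cmod z = 1 - u / 2" using u z by (auto simp: norm_mult simp del: of_real_diff of_real_divide)
    moreover have "Im z \<noteq> 0" using u z by auto
    moreover have "u = 0 \<Longrightarrow> z = \<i> \<or> z = -\<i>" using z by auto
    ultimately show ?thesis using u by (cases "u = 0") auto
  qed
  have Hz: "z \<in> cball 0 1 \<and> Im z \<noteq> 0 \<and> (z \<in> ball 0 1 \<or> z = \<i> \<or> z = -\<i>)" if "z \<in> Hp \<union> Hm" for z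
    using that unfolding Hp_def Hm_def by auto
  define N where "N = (c ` (Hp \<union> Dp)) \<union> (c ` (Hm \<union> Dm))"
  have conN: "connected N"
    unfolding N_def
  proof (rule connected_Un)
    have "\<i> / 2 \<in> Hp \<inter> Dp" "-(\<i> / 2) \<in> Hm \<inter> Dm" unfolding Hp_def Hm_def Dp_def Dm_def by auto
    then have "connected (Hp \<union> Dp)" "connected (Hm \<union> Dm)" using con by (blast intro: connected_Un)+
    moreover have "Hp \<union> Dp \<subseteq> cball 0 1" "Hm \<union> Dm \<subseteq> cball 0 1" using Dz Hz by blast+
    ultimately show "connected (c ` (Hp \<union> Dp))" "connected (c ` (Hm \<union> Dm))"
      using PM_cont[OF T PM] by (auto intro!: connected_continuous_image intro: continuous_on_subset)
    have "c \<i> \<in> c ` (Hp \<union> Dp)" "c (-\<i>) \<in> c ` (Hm \<union> Dm)" unfolding Dp_def Dm_def by auto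
    then show "c ` (Hp \<union> Dp) \<inter> c ` (Hm \<union> Dm) \<noteq> {}" using eq by auto
  qed
  have N_sub: "N \<subseteq> S2 - path_image ?J"
  proof -
    have "c z \<in> S2 - path_image ?J" if "z \<in> Hp \<union> Dp \<union> (Hm \<union> Dm)" for z
      using that Dz[of z] Hz[of z] not_J[of z] PM_cball_S2[OF T PM] by blast
    then show ?thesis unfolding N_def by blast
  qed
  have "N \<subseteq> A \<or> N \<subseteq> B" using connected_subset_split[OF conN _ AB(1,2,3)] N_sub AB(4) by simp
  \<comment> \<open>The point \<open>c 0\<close> is on the curve and in the open set
    \<open>T\<close>. So \<open>A\<close> and \<open>B\<close> both have points in \<open>T\<close>
    near it, and a point of \<open>T\<close> off the curve comes from an open half disk.\<close>
  moreover have "X \<inter> N \<noteq> {}" if X: "X = A \<or> X = B" for X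
  proof -
    obtain W where W: "open W" "T = S2 \<inter> W" using tile_open[OF T PM] openin_open by metis
    have "c 0 \<in> T" using PM_ball[OF T PM] by auto
    moreover have "c 0 \<in> path_image ?J" unfolding J_im by auto
    ultimately have "c 0 \<in> W" "c 0 \<in> closure X" using W AB(5,6) X by auto
    then obtain y where y: "y \<in> X" "y \<in> W" using open_Int_closure_eq_empty[OF W(1), of X] by blast
    have "y \<in> S2 - path_image ?J" using AB(4) y X by blast
    moreover then have "y \<in> T" using W y by blast
    ultimately obtain z where z: "z \<in> ball 0 1" "y = c z" "c z \<notin> path_image ?J" using PM_ball[OF T PM] by blast
    have "Im z \<noteq> 0" using z unfolding J_im by auto
    then have "z \<in> Hp \<union> Hm" using z unfolding Hp_def Hm_def by auto
    then have "y \<in> N" using z unfolding N_def by blast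
    then show ?thesis using y by blast
  qed
  ultimately show False using AB(3) by blast
qed

text \<open>Folding the two sides together closes up the image \<open>X\<close> of the upper half
  disk around the vertex \<open>v\<close> between them. A punctured neighbourhood of
  \<open>v\<close> is connected and hence contained in \<open>X\<close>, so no other edge can end at
  \<open>v\<close>.\<close>

lemma no_fold: "side_edge c 0 \<noteq> side_edge c 1"
proof
  assume fold: "side_edge c 0 = side_edge c 1"
  define e where "e = side_edge c 0"
  have e: "side_edge c 0 = e" "side_edge c 1 = e" and eE: "e \<in> E" using fold side_edge(1)[OF T PM, of 0] unfolding e_def by auto
  have ends: "{e 0, e 1} = {c 1, c \<i>}" "{e 0, e 1} = {c \<i>, c (-1)}"
    using side_edge_ends[of 0] side_edge_ends[of 1] e by (auto simp: corners insert_commute simp del: One_nat_def)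
  define v where "v = c \<i>"
  have uv: "c 1 \<noteq> v" "c (-1) \<noteq> v" using colour_corners unfolding v_def by metis+
  have vV: "v \<in> V" using corner_V v_def by simp
  have vT: "v \<notin> T" using vV tile_sub[OF T] unfolding G_def by blast
  define H where "H = {z. Im z > 0} \<inter> ball 0 1"
  define X where "X = c ` H \<union> open_edge e"
  define D where "D = c ` {z \<in> cball 0 1. Im z = 0}"
  define Cl where "Cl = c ` {z \<in> cball 0 1. Im z \<ge> 0}"
  have HT: "c ` H \<subseteq> T" using PM_ball[OF T PM] unfolding H_def by blast
  have vX: "v \<notin> X" using HT vT edgeD(5)[OF eE] vV unfolding X_def by blast
  \<comment> \<open>Along the crease openness comes from \<open>glue\<close>, applied to two sides
    of the same tile.\<close>
  have oX: "openin (top_of_set S2) X"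
  proof -
    have "sector i \<subseteq> H" if "i = 0 \<or> i = 1" for i
      using that Im_ang_pos unfolding sector_def H_def by (auto simp: norm_mult)
    then have "X = c ` H \<union> (c ` sector 0 \<union> open_edge e \<union> c ` sector 1)" unfolding X_def by blast
    moreover have "openin (top_of_set S2) (c ` H)" unfolding H_def
      by (intro PM_open_image[OF T PM] open_Int open_halfspace_Im_gt) auto
    moreover have "openin (top_of_set S2) (c ` sector 0 \<union> open_edge e \<union> c ` sector 1)"
      using e by (intro glue[OF T PM _ T PM]) auto
    ultimately show ?thesis by (simp add: openin_Un)
  qed
  have comp: "compact {z \<in> cball (0::complex) 1. Im z = 0}" "compact {z \<in> cball (0::complex) 1. Im z \<ge> 0}"
  proof -
    have "{z \<in> cball (0::complex) 1. Im z = 0} = cball 0 1 \<inter> {z. Im z = 0}"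
      "{z \<in> cball (0::complex) 1. Im z \<ge> 0} = cball 0 1 \<inter> {z. Im z \<ge> 0}" by auto
    then show "compact {z \<in> cball (0::complex) 1. Im z = 0}" "compact {z \<in> cball (0::complex) 1. Im z \<ge> 0}"
      by (simp_all add: compact_Int_closed closed_halfspace_Im_eq closed_halfspace_Im_ge)
  qed
  have clo: "closed D" "closed Cl" unfolding D_def Cl_def
    by (intro compact_imp_closed compact_continuous_image comp continuous_on_subset[OF PM_cont[OF T PM]]; auto)+
  have Cl_sub: "Cl \<subseteq> X \<union> {v} \<union> D"
  proof
    fix y assume "y \<in> Cl"
    then obtain z where z: "cmod z \<le> 1" "Im z \<ge> 0" "y = c z" unfolding Cl_def by auto
    consider "Im z = 0" | "Im z > 0" "cmod z < 1" | "Im z > 0" "cmod z = 1" using z by linarith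
    then show "y \<in> X \<union> {v} \<union> D"
    proof cases
      case 1 then show ?thesis using z unfolding D_def by auto
    next
      case 2 then show ?thesis using z unfolding X_def H_def by auto
    next
      case 3
      from upper_circle[OF 3(2,1)] show ?thesis
      proof (elim disjE)
        assume "z \<in> side 4 0" then show ?thesis using side_edge(2)[OF T PM, of 0] z e unfolding X_def by auto
      next
        assume "z \<in> side 4 1" then show ?thesis using side_edge(2)[OF T PM, of 1] z e unfolding X_def by auto
      qed (use z in \<open>auto simp: v_def\<close>)
    qed
  qed
  have X_Cl: "X \<subseteq> Cl"
  proof -
    have "c ` H \<subseteq> Cl" unfolding H_def Cl_def by auto
    moreover have "side 4 0 \<subseteq> {z \<in> cball 0 1. Im z \<ge> 0}"
      unfolding side_4 using Im_ang_pos by (force simp: less_imp_le)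
    then have "c ` side 4 0 \<subseteq> Cl" unfolding Cl_def by blast
    then have "open_edge e \<subseteq> Cl" using side_edge(2)[OF T PM, of 0] e by simp
    ultimately show ?thesis unfolding X_def by blast
  qed
  have vD: "v \<notin> D"
  proof
    assume "v \<in> D"
    then obtain z where z: "z \<in> cball 0 1" "Im z = 0" "v = c z" unfolding D_def by auto
    then have "z \<notin> ball 0 1" using PM_in_T[OF T PM z(1)] vT by auto
    then show False using real_diameter[OF z(1,2)] uv z(3) by metis
  qed
  have vS: "v \<in> S2" using vV VS by blast
  have "openin (top_of_set S2) (S2 - D)" using clo(1) by (metis Diff_eq open_Compl openin_open_Int)
  then obtain B where B: "openin (top_of_set S2) B" "v \<in> B" "B \<subseteq> S2 - D" "connected (B - {v})" "B \<noteq> {v}"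
    using sphere_punctured_nbhd[of "S2 - D" v] vS vD by auto
  obtain W where W: "open W" "B = S2 \<inter> W" using B(1) openin_open by metis
  have "openin (top_of_set S2) (S2 - Cl)" using clo(2) by (metis Diff_eq open_Compl openin_open_Int)
  \<comment> \<open>Off \<open>v\<close> and \<open>D\<close>, the open set \<open>X\<close> and the
    closed set \<open>Cl\<close> have the same points, so \<open>X\<close> is both open and closed
    in the punctured neighbourhood.\<close>
  then have "B - {v} \<subseteq> X \<or> B - {v} \<subseteq> S2 - Cl"
    using connected_subset_split[OF B(4) _ oX] B(3) Cl_sub X_Cl by blast
  moreover have "\<not> B - {v} \<subseteq> S2 - Cl"
  proof -
    have "(\<lambda>n. of_real (1 - 1 / (real n + 2)) * \<i>) \<longlonglongrightarrow> of_real (1 - 0) * \<i>"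
      by (intro tendsto_intros) real_asymp
    moreover have "of_real (1 - 1 / (real n + 2)) * \<i> \<in> H" for n
      unfolding H_def by (auto simp: norm_mult simp del: of_real_diff of_real_divide)
    ultimately have "\<i> \<in> closure H"
      by (auto simp: closure_sequential intro!: exI[of _ "\<lambda>n. of_real (1 - 1 / (real n + 2)) * \<i>"])
    moreover have "closure H \<subseteq> cball 0 1"
      unfolding H_def by (intro closure_minimal) auto
    then have "c ` closure H \<subseteq> closure (c ` H)"
      by (intro image_closure_subset continuous_on_subset[OF PM_cont[OF T PM]]) (auto simp: closure_subset)
    ultimately have "v \<in> closure (c ` H)" unfolding v_def by blast
    moreover have "v \<in> W" using W B(2) by blast
    ultimately obtain y where y: "y \<in> c ` H" "y \<in> W" using open_Int_closure_eq_empty[OF W(1), of "c ` H"] by blast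
    have yT: "y \<in> T" using y(1) HT by blast
    have "y \<in> B" using W(2) y yT tile_sub[OF T] by blast
    moreover have "y \<noteq> v" using yT vT by blast
    moreover have "y \<in> Cl" using y(1) X_Cl unfolding X_def by blast
    ultimately show ?thesis by blast
  qed
  ultimately have BX: "B - {v} \<subseteq> X" by blast
  \<comment> \<open>An edge ending at \<open>v\<close> has interior points in \<open>B\<close>,
    hence in \<open>X\<close>; the only points of the graph in \<open>X\<close> are those of
    \<open>e\<close>.\<close>
  have only: "g = e" if g: "g \<in> E" "g 0 = v \<or> g 1 = v" for g
  proof -
    have "path_image g \<subseteq> closure (open_edge g)"
    proof -
      have "g ` closure {0<..<1} \<subseteq> closure (g ` {0<..<1})"
        using edgeD(1)[OF g(1)] by (intro image_closure_subset) (auto simp: simple_path_def path_def closure_subset)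
      then show ?thesis by (simp add: path_image_def open_edge_def)
    qed
    then have "v \<in> closure (open_edge g)" using g(2) path_image_open_edge by blast
    moreover have "v \<in> W" using W B(2) by blast
    ultimately obtain y where y: "y \<in> open_edge g" "y \<in> W" using open_Int_closure_eq_empty[OF W(1), of "open_edge g"] by blast
    have yG: "y \<in> G" using y open_edge_G[OF g(1)] by blast
    have "y \<noteq> v" using y(1) edgeD(5)[OF g(1)] vV by blast
    then have "y \<in> X" using BX y W yG GS by blast
    then have "y \<in> open_edge e" using HT yG tile_sub[OF T] unfolding X_def by blast
    then show "g = e" using y(1) edges_disjoint[OF g(1) eE] by blast
  qed
  \<comment> \<open>A loop would count twice in the degree; the colours exclude it.\<close>
  have ne: "e 0 \<noteq> e 1" using colour[OF eE] by metis
  have sub: "{g \<in> E. pathstart g = v} \<subseteq> (if e 0 = v then {e} else {})"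
    "{g \<in> E. pathfinish g = v} \<subseteq> (if e 1 = v then {e} else {})"
    using only by (auto simp: pathstart_def pathfinish_def)
  have "card {g \<in> E. pathstart g = v} \<le> (if e 0 = v then 1 else 0)"
    "card {g \<in> E. pathfinish g = v} \<le> (if e 1 = v then 1 else 0)"
    using card_mono[OF _ sub(1)] card_mono[OF _ sub(2)] by (auto split: if_splits)
  then have "vertex_degree E v \<le> 1" unfolding vertex_degree_def using ne by (auto split: if_splits)
  then show False using degree_ge_3[OF vV] by simp
qed

text \<open>The sides have the same pair of ends, and \<open>c 1\<close> and
  \<open>c (-\<i>)\<close> have different colours. So each corner must coincide with its opposite
  one, which is impossible for both pairs.\<close>

lemma opposite_distinct: "side_edge c 0 \<noteq> side_edge c 2"
proof
  assume e: "side_edge c 0 = side_edge c 2"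
  have "{c 1, c \<i>} = {c (-1), c (-\<i>)}"
    using side_edge_ends[of 0] side_edge_ends[of 2] e by (auto simp: corners insert_commute simp del: One_nat_def)
  moreover have "c 1 \<noteq> c (-\<i>)" using colour_corners by metis
  ultimately have "c 1 = c (-1)" "c \<i> = c (-\<i>)" by (metis doubleton_eq_iff)+
  then show False using not_both_diagonals by blast
qed

end

lemma sides_distinct_less:
  assumes T: "T \<in> Tiles" and PM: "PM T c"
  shows "side_edge c 0 \<noteq> side_edge c 1 \<and> side_edge c 1 \<noteq> side_edge c 2 \<and> side_edge c 2 \<noteq> side_edge c 3 \<and> side_edge c 3 \<noteq> side_edge c 0 \<and> side_edge c 0 \<noteq> side_edge c 2 \<and> side_edge c 1 \<noteq> side_edge c 3"
proof -
  let ?r = "\<lambda>c z. c (\<i> * z) :: real ^ 3"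
  have P: "PM T (?r c)" "PM T (?r (?r c))" "PM T (?r (?r (?r c)))"
    using PM PM_rot by blast+
  have r: "side_edge (?r c) 0 = side_edge c 1 \<and> side_edge (?r c) 1 = side_edge c 2 \<and> side_edge (?r c) 2 = side_edge c 3 \<and> side_edge (?r c) 3 = side_edge c 0" for c
    using side_edge_rot[of 0 c] side_edge_rot[of 1 c] side_edge_rot[of 2 c] side_edge_rot[of 3 c] by (simp del: One_nat_def)
  show ?thesis
    using no_fold[OF T PM] no_fold[OF T P(1)] no_fold[OF T P(2)] no_fold[OF T P(3)]
      opposite_distinct[OF T PM] opposite_distinct[OF T P(1)] r[of c] r[of "?r c"] r[of "?r (?r c)"]
    by metis
qed

lemma sides_distinct:
  assumes "T \<in> Tiles" "PM T c" "i < 4" "j < 4" "i \<noteq> j"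
  shows "side_edge c i \<noteq> side_edge c j"
  using sides_distinct_less[OF assms(1,2)] less_4_cases[OF assms(3)] less_4_cases[OF assms(4)] assms(5)
  by metis

lemma side_images_distinct:
  assumes "T \<in> Tiles" "PM T c"
  shows "\<forall>i<4. \<forall>j<4. i \<noteq> j \<longrightarrow> c ` side 4 i \<noteq> c ` side 4 j"
  using sides_distinct[OF assms] side_edge[OF assms] open_edge_inj by metis

lemma tile_Q_or_Q13:
  assumes T: "T \<in> Tiles"
  shows "is_Q V E T \<or> is_Q13 V E T"
proof -
  obtain c where PM: "PM T c" using ex_PM[OF T] by blast
  note tile_map = colour_corners[OF T PM]
  have adj: "c 1 \<noteq> c \<i>" "c \<i> \<noteq> c (-1)" "c (-1) \<noteq> c (-\<i>)" "c (-\<i>) \<noteq> c 1" using tile_map by metis+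
  consider "c 1 \<noteq> c (-1)" "c \<i> \<noteq> c (-\<i>)" | "c 1 = c (-1)" "c \<i> \<noteq> c (-\<i>)" | "c 1 \<noteq> c (-1)" "c \<i> = c (-\<i>)"
    using not_both_diagonals[OF T PM] by blast
  then show ?thesis
  proof cases
    case 1
    then have "\<forall>i<4. \<forall>j<4. i \<noteq> j \<longrightarrow> c (corner 4 i) \<noteq> c (corner 4 j)"
      using adj adj[symmetric] unfolding all_less_4 corners by auto
    then show ?thesis unfolding is_Q_def using PM side_images_distinct[OF T PM] by blast
  next
    case 2
    have "\<forall>i<4. \<forall>j<4. i \<noteq> j \<and> {i, j} \<noteq> {0, 2} \<longrightarrow> c (corner 4 i) \<noteq> c (corner 4 j)"
      unfolding all_less_4 corners using 2 adj adj[symmetric] by (auto simp: insert_commute)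
    moreover have "c (corner 4 0) = c (corner 4 2)" unfolding corners using 2 by simp
    ultimately show ?thesis unfolding is_Q13_def using PM side_images_distinct[OF T PM] by blast
  next
    case 3
    \<comment> \<open>Here the corners with indices 1 and 3 coincide; one quarter turn renames them
      0 and 2, as in \<open>is_Q13\<close>.\<close>
    let ?c = "\<lambda>z. c (\<i> * z)"
    have P: "PM T ?c" using PM_rot[OF PM] .
    have "\<forall>i<4. \<forall>j<4. i \<noteq> j \<and> {i, j} \<noteq> {0, 2} \<longrightarrow> ?c (corner 4 i) \<noteq> ?c (corner 4 j)"
      unfolding all_less_4 corners using 3 adj adj[symmetric] by (auto simp: insert_commute)
    moreover have "?c (corner 4 0) = ?c (corner 4 2)" unfolding corners using 3 by simp
    ultimately show ?thesis unfolding is_Q13_def using P side_images_distinct[OF T P] by blast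
  qed
qed

end

section \<open>Orientation\<close>

text \<open>The pole is the image of the centre of one tile. So the graph and all boundary loops lie
  inside the chart, and only the model disk of \<open>T0\<close> has to be punctured, at its
  centre.\<close>

locale charted_tiling = quad_tiling +
  fixes T0 :: "(real ^ 3) set" and h :: "real ^ 3 \<Rightarrow> complex" and k :: "complex \<Rightarrow> real ^ 3"
  assumes T0: "T0 \<in> Tiles" and hk: "homeomorphism (S2 - {tile_map T0 0}) UNIV h k"
begin

definition pole :: "real ^ 3" where "pole = tile_map T0 0"

definition chart_map :: "(real ^ 3) set \<Rightarrow> complex \<Rightarrow> complex" where
  "chart_map T w = h (tile_map T w)"

lemma pole_in: "pole \<in> T0" "pole \<in> S2" "pole \<notin> G"
proof -
  show "pole \<in> T0" unfolding pole_def using PM_in_T[OF T0 tile_map[OF T0], of 0] by simp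
  then show "pole \<in> S2" "pole \<notin> G" using tile_sub[OF T0] by blast+
qed

lemma G_sub_chart: "G \<subseteq> S2 - {pole}"
  using GS pole_in(3) by auto

lemma tile_map_eq_pole:
  assumes T: "T \<in> Tiles" and w: "w \<in> cball 0 1" "tile_map T w = pole"
  shows "T = T0 \<and> w = 0"
proof -
  have "tile_map T w \<in> T \<union> G" using PM_cball[OF T tile_map[OF T]] imageI[OF w(1)] by (rule subsetD)
  then have "pole \<in> T \<union> G" using w(2) by simp
  then have "pole \<in> T" using pole_in by blast
  then have TT0: "T = T0" using tiles_disjoint[OF T T0] pole_in by blast
  moreover have "w \<in> ball 0 1" using PM_in_T[OF T tile_map[OF T] w(1)] w(2) \<open>pole \<in> T\<close> by simp
  then have "w = 0" using PM_inj[OF T tile_map[OF T]] w(2) TT0 by (auto simp: pole_def dest: inj_onD)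
  ultimately show ?thesis by blast
qed

lemma h_inj: "x \<in> S2 - {pole} \<Longrightarrow> y \<in> S2 - {pole} \<Longrightarrow> h x = h y \<Longrightarrow> x = y"
proof -
  assume xy: "x \<in> S2 - {pole}" "y \<in> S2 - {pole}" "h x = h y"
  have "x = k (h x)" using homeomorphism_apply1[OF hk xy(1)[unfolded pole_def]] by (rule sym)
  also have "\<dots> = y" unfolding xy(3) using homeomorphism_apply1[OF hk xy(2)[unfolded pole_def]] .
  finally show "x = y" .
qed

lemma h_cont: "continuous_on (S2 - {pole}) h"
  using homeomorphism_cont1[OF hk] unfolding pole_def .

lemma tile_map_S2: "T \<in> Tiles \<Longrightarrow> w \<in> cball 0 1 \<Longrightarrow> tile_map T w \<in> S2"
  using PM_cball_S2 tile_map by blast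

lemma chart_map_cont:
  assumes T: "T \<in> Tiles" and A: "A \<subseteq> cball 0 1" "\<And>w. w \<in> A \<Longrightarrow> tile_map T w \<noteq> pole"
  shows "continuous_on A (chart_map T)"
  unfolding chart_map_def
proof (rule continuous_on_compose2[OF h_cont])
  show "continuous_on A (tile_map T)" using PM_cont[OF T tile_map[OF T]] A(1) continuous_on_subset by blast
  show "tile_map T ` A \<subseteq> S2 - {pole}"
  proof (rule image_subsetI)
    fix w assume "w \<in> A"
    then show "tile_map T w \<in> S2 - {pole}" using tile_map_S2[OF T, of w] A(1) A(2)[of w] by auto
  qed
qed

lemma nonzero_ne_pole: "T \<in> Tiles \<Longrightarrow> w \<in> cball 0 1 \<Longrightarrow> w \<noteq> 0 \<Longrightarrow> tile_map T w \<noteq> pole"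
  using tile_map_eq_pole by blast

text \<open>The loop starts at corner \<open>i\<close>, so its first quarter runs along side
  \<open>i\<close>.\<close>

definition boundary_loop :: "(real ^ 3) set \<Rightarrow> nat \<Rightarrow> real \<Rightarrow> complex" where
  "boundary_loop T i t = chart_map T (ang (real i + 4 * t))"

text \<open>Corners of a degenerate tile may coincide, so the boundary loop need not be simple. On
  the circle of radius 1/2 the tile map is injective and avoids the pole, hence this loop is a
  Jordan curve.\<close>

definition half_loop :: "(real ^ 3) set \<Rightarrow> real \<Rightarrow> complex" where
  "half_loop T t = chart_map T (of_real (1/2) * ang (4 * t))"

lemma ang_4: "ang (x + 4) = ang x" by (simp add: ang_add ang_int)

lemma boundary_half_loop:
  assumes T: "T \<in> Tiles" and y: "y \<in> S2 - {pole}" and ne: "\<And>w. 1/2 \<le> cmod w \<Longrightarrow> cmod w \<le> 1 \<Longrightarrow> tile_map T w \<noteq> y"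
  shows "winding_number (boundary_loop T i) (h y) = winding_number (half_loop T) (h y)"
proof -
  \<comment> \<open>\<open>fst u\<close> is the homotopy parameter. It increases the radius from 1/2
    to 1 and turns the starting point from angle 0 to corner \<open>i\<close>.\<close>
  define r where "r u = of_real ((1 + fst u) / 2) * ang (4 * snd u + real i * fst u)" for u :: "real \<times> real"
  have nr: "cmod (r u) = (1 + fst u) / 2" if "fst u \<in> {0..1}" for u
    using that unfolding r_def by (simp add: norm_mult del: of_real_add of_real_divide)
  have "homotopic_loops (-{h y}) (half_loop T) (boundary_loop T i)"
    unfolding homotopic_loops
  proof (intro exI[of _ "\<lambda>u. chart_map T (r u)"] conjI ballI)
    show "continuous_on ({0..1} \<times> {0..1}) (\<lambda>u. chart_map T (r u))"
    proof (rule continuous_on_compose2[OF chart_map_cont[OF T, of "cball 0 1 - {0}"]])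
      show "continuous_on ({0..1} \<times> {0..1}) r" unfolding r_def by (intro continuous_intros) auto
      show "r ` ({0..1} \<times> {0..1}) \<subseteq> cball 0 1 - {0}"
      proof (rule image_subsetI)
        fix u :: "real \<times> real" assume "u \<in> {0..1} \<times> {0..1}"
        then have u: "fst u \<in> {0..1}" by auto
        then have "cmod (r u) \<le> 1" "cmod (r u) \<noteq> 0" using nr[OF u] by auto
        then show "r u \<in> cball 0 1 - {0}" by auto
      qed
    qed (use nonzero_ne_pole[OF T] in auto)
    show "(\<lambda>u. chart_map T (r u)) \<in> {0..1} \<times> {0..1} \<rightarrow> - {h y}"
    proof
      fix u :: "real \<times> real" assume "u \<in> {0..1} \<times> {0..1}"
      then have u: "fst u \<in> {0..1}" by auto
      then have n: "1/2 \<le> cmod (r u)" "cmod (r u) \<le> 1" using nr[OF u] by auto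
      then have "r u \<in> cball 0 1" "r u \<noteq> 0" by auto
      then have "tile_map T (r u) \<in> S2 - {pole}" using tile_map_S2[OF T] nonzero_ne_pole[OF T] by blast
      then show "chart_map T (r u) \<in> - {h y}" unfolding chart_map_def using h_inj[OF _ y] ne[OF n] by blast
    qed
    fix t :: real assume "t \<in> {0..1}"
    show "pathfinish ((\<lambda>u. chart_map T (r u)) \<circ> Pair t) = pathstart ((\<lambda>u. chart_map T (r u)) \<circ> Pair t)"
      using ang_4[of "real i * t"] by (simp add: pathfinish_def pathstart_def r_def add.commute)
    show "chart_map T (r (0, t)) = half_loop T t" "chart_map T (r (1, t)) = boundary_loop T i t"
      by (simp_all add: half_loop_def boundary_loop_def r_def add.commute)
  qed
  then show ?thesis using winding_number_homotopic_loops by metis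
qed

lemma chart_map_inj:
  assumes T: "T \<in> Tiles" and "w \<in> ball 0 1" "w' \<in> ball 0 1" "tile_map T w \<noteq> pole" "tile_map T w' \<noteq> pole" "chart_map T w = chart_map T w'"
  shows "w = w'"
proof -
  have "tile_map T w = tile_map T w'"
    using assms tile_map_S2[OF T, of w] tile_map_S2[OF T, of w'] h_inj unfolding chart_map_def by auto
  then show ?thesis using PM_inj[OF T tile_map[OF T]] assms by (auto dest: inj_onD)
qed

lemma half_circle_image: "path_image (half_loop T) = chart_map T ` sphere 0 (1/2)"
proof (intro equalityI subsetI)
  fix z assume "z \<in> path_image (half_loop T)"
  then obtain t where "z = chart_map T (of_real (1/2) * ang (4 * t))"
    unfolding path_image_def half_loop_def by blast
  then show "z \<in> chart_map T ` sphere 0 (1/2)" by (intro image_eqI) (auto simp: norm_mult)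
next
  fix z assume "z \<in> chart_map T ` sphere 0 (1/2)"
  then obtain w where w: "cmod w = 1/2" "z = chart_map T w" by auto
  then have "cmod (2 * w) = 1" by (simp add: norm_mult)
  then obtain x where x: "x \<in> {0..<4}" "2 * w = ang x" using ang_surj by blast
  then have eq: "of_real (1/2) * ang (4 * (x / 4)) = w" by (auto simp: field_simps)
  have "z = half_loop T (x / 4)" unfolding half_loop_def eq by (rule w(2))
  then show "z \<in> path_image (half_loop T)"
    using x(1) unfolding path_image_def by (intro image_eqI[of _ _ "x/4"]) auto
qed

lemma simple_half_loop:
  assumes T: "T \<in> Tiles"
  shows "simple_path (half_loop T)" "pathfinish (half_loop T) = pathstart (half_loop T)"
proof -
  let ?w = "\<lambda>t. of_real (1/2) * ang (4 * t)"
  have nw: "cmod (?w t) = 1/2" for t by (simp add: norm_mult)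
  have wb: "?w t \<in> ball 0 1" for t using nw[of t] by (simp del: of_real_divide)
  have wz: "?w t \<noteq> 0" for t using nw[of t] by (metis norm_zero zero_neq_one div_by_1 divide_eq_0_iff zero_neq_numeral)
  have wp: "tile_map T (?w t) \<noteq> pole" for t using nonzero_ne_pole[OF T _ wz, of t] wb[of t] by (simp del: of_real_divide)
  show "pathfinish (half_loop T) = pathstart (half_loop T)"
    by (simp add: pathfinish_def pathstart_def half_loop_def ang_int)
  show "simple_path (half_loop T)"
    unfolding simple_path_def loop_free_def
  proof (intro conjI ballI impI)
    show "path (half_loop T)" unfolding path_def half_loop_def
    proof (rule continuous_on_compose2[OF chart_map_cont[OF T, of "sphere 0 (1/2)"]])
      show "tile_map T w \<noteq> pole" if "w \<in> sphere 0 (1/2)" for w using that by (intro nonzero_ne_pole[OF T]) auto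
    qed (auto intro!: continuous_intros simp: norm_mult)
    fix x y :: real assume xy: "x \<in> {0..1}" "y \<in> {0..1}" "half_loop T x = half_loop T y"
    have "?w x = ?w y" using chart_map_inj[OF T wb wb wp wp] xy(3) unfolding half_loop_def by blast
    then have eq: "ang (4 * x) = ang (4 * y)" by simp
    show "x = y \<or> x = 0 \<and> y = 1 \<or> x = 1 \<and> y = 0"
    proof (cases "x < 1"; cases "y < 1")
      assume "x < 1" "y < 1"
      then show ?thesis using ang_inj[OF eq] xy by auto
    next
      assume "x < 1" "\<not> y < 1"
      then show ?thesis using ang_inj[of "4 * x" 0] eq xy by (auto simp: ang_int)
    next
      assume "\<not> x < 1" "y < 1"
      then show ?thesis using ang_inj[of "4 * y" 0] eq xy by (auto simp: ang_int)
    qed (use xy in auto)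
  qed
qed

text \<open>The number \<open>s\<close> is the jump of the winding number between \<open>T\<close> and the outside. For
  the tile that contains the pole of the chart, the winding number vanishes on \<open>T\<close> and not outside,
  hence the constant \<open>a\<close>.\<close>

definition orient :: "(real ^ 3) set \<Rightarrow> complex \<Rightarrow> complex \<Rightarrow> bool" where
  "orient T a s \<longleftrightarrow> s \<in> {1, -1} \<and>
    (\<forall>w. cmod w < 1/2 \<longrightarrow> tile_map T w \<noteq> pole \<longrightarrow> winding_number (half_loop T) (h (tile_map T w)) = a + s) \<and>
    (\<forall>y\<in>S2 - {pole}. y \<notin> tile_map T ` cball 0 (1/2) \<longrightarrow> winding_number (half_loop T) (h y) = a)"

text \<open>The image \<open>X\<close> of the open half-size disk, without the pole, is open and
  connected, and together with the curve it is closed. Hence it is all of the inside or all of the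
  outside of the curve. The inside has winding number 1 or -1, the outside 0, and the jump
  \<open>s\<close> is their difference with the proper sign.\<close>

lemma ex_orient:
  assumes T: "T \<in> Tiles"
  shows "\<exists>a s. orient T a s"
proof -
  let ?C = "half_loop T"
  let ?P = "path_image ?C"
  note C = simple_half_loop[OF T]
  define D where "D = {w \<in> ball 0 (1/2). tile_map T w \<noteq> pole}"
  define X where "X = chart_map T ` D"
  have cb: "cball 0 (1/2) \<subseteq> ball (0::complex) 1" by auto
  have D01: "D \<subseteq> ball 0 1" unfolding D_def by auto
  have D_eq: "D = ball 0 (1/2) \<or> D = ball 0 (1/2) - {0}"
  proof -
    have "w = 0" if "w \<in> ball 0 (1/2)" "tile_map T w = pole" for w
      using tile_map_eq_pole[OF T, of w] that by auto
    then show ?thesis unfolding D_def by (cases "tile_map T 0 = pole") blast+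
  qed
  have oD: "open D" using D_eq by (auto simp: open_delete)
  have "connected (ball (0::complex) (1/2) - {0})"
    by (rule connected_punctured_convex) (auto simp: aff_dim_open)
  then have cD: "connected D" using D_eq by auto
  have cont: "continuous_on D (chart_map T)"
    by (rule chart_map_cont[OF T]) (auto simp: D_def)
  have inj: "inj_on (chart_map T) D"
    using chart_map_inj[OF T] D01 unfolding D_def by (intro inj_onI) blast
  have oX: "open X" unfolding X_def using invariance_of_domain[OF cont oD inj] .
  have cX: "connected X" unfolding X_def using connected_continuous_image[OF cont cD] .
  have XP: "X \<inter> ?P = {}"
  proof -
    have "chart_map T w \<noteq> chart_map T w'" if "w \<in> D" "w' \<in> sphere 0 (1/2)" for w w'
    proof
      assume eq: "chart_map T w = chart_map T w'"
      have "w' \<in> ball 0 1" "w' \<noteq> 0" using that by auto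
      then have "w = w'" using chart_map_inj[OF T _ _ _ _ eq] nonzero_ne_pole[OF T, of w'] that D01 unfolding D_def by auto
      then show False using that unfolding D_def by auto
    qed
    then show ?thesis unfolding X_def half_circle_image by blast
  qed
  have XuP: "X \<union> ?P = h ` (tile_map T ` cball 0 (1/2) - {pole})"
  proof -
    have "{w \<in> cball 0 (1/2). tile_map T w \<noteq> pole} = D \<union> sphere 0 (1/2)"
    proof -
      have "tile_map T w \<noteq> pole" if "w \<in> sphere 0 (1/2)" for w using that by (intro nonzero_ne_pole[OF T]) auto
      then show ?thesis unfolding D_def by auto
    qed
    then have "X \<union> ?P = chart_map T ` {w \<in> cball 0 (1/2). tile_map T w \<noteq> pole}"
      unfolding X_def half_circle_image by (simp add: image_Un)
    then show ?thesis unfolding chart_map_def by auto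
  qed
  have clXP: "closed (X \<union> ?P)"
  proof -
    have "compact (tile_map T ` cball 0 (1/2))"
      by (intro compact_continuous_image continuous_on_subset[OF PM_cont[OF T tile_map[OF T]]]) auto
    moreover have "tile_map T ` cball 0 (1/2) - {pole} = (S2 - {pole}) \<inter> tile_map T ` cball 0 (1/2)"
      using tile_map_S2[OF T] by auto
    ultimately have "closedin (top_of_set (S2 - {tile_map T0 0})) (tile_map T ` cball 0 (1/2) - {pole})"
      using closedin_closed_Int compact_imp_closed unfolding pole_def by metis
    then have "closedin (top_of_set UNIV) (h ` (tile_map T ` cball 0 (1/2) - {pole}))"
      using homeomorphism_imp_closed_map[OF hk] by blast
    then show ?thesis unfolding XuP by simp
  qed
  have Xne: "X \<noteq> {}"
  proof -
    have "of_real (1/4) \<in> D" unfolding D_def using nonzero_ne_pole[OF T, of "of_real (1/4)"] by simp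
    then show ?thesis unfolding X_def by blast
  qed
  note J = Jordan_inside_outside[OF C]
  let ?I = "inside ?P" let ?O = "outside ?P"
  have IO: "?I \<union> ?O = - ?P" using inside_Un_outside by blast
  \<comment> \<open>\<open>X\<close> is both open and closed off the curve, so it fills any
    connected set off the curve that contains it.\<close>
  have eq: "X = Y" if Y: "connected Y" "Y \<inter> ?P = {}" "X \<subseteq> Y" for Y
  proof -
    have "Y \<subseteq> X \<or> Y \<subseteq> - (X \<union> ?P)"
    proof (rule connected_subset_split[OF Y(1), where S = UNIV])
      show "openin (top_of_set UNIV) (- (X \<union> ?P))" using clXP by (simp only: subtopology_UNIV open_openin[symmetric] open_Compl)
    qed (use Y(2) oX in auto)
    then show ?thesis using Xne Y by blast
  qed
  have cases: "X = ?I \<or> X = ?O"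
  proof -
    have "X \<subseteq> ?I \<or> X \<subseteq> ?O"
      using connected_subset_split[OF cX, of ?I ?O UNIV] XP J IO by auto
    then show ?thesis
      using eq[of ?I] eq[of ?O] J IO by blast
  qed
  obtain v :: complex where v: "v \<in> {1, -1}" "\<And>z. z \<in> ?I \<Longrightarrow> winding_number ?C z = v"
    using simple_closed_path_winding_number_inside[OF C(1)] by (metis insert_iff)
  have out: "winding_number ?C z = 0" if "z \<in> ?O" for z
    using winding_number_zero_in_outside[OF _ C(2) that] C(1) simple_path_imp_path by blast
  have inX: "h (tile_map T w) \<in> X" if "cmod w < 1/2" "tile_map T w \<noteq> pole" for w
    using that unfolding X_def D_def chart_map_def by auto
  have outX: "h y \<in> - ?P" "h y \<notin> X" if "y \<in> S2 - {pole}" "y \<notin> tile_map T ` cball 0 (1/2)" for y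
  proof -
    have "h y \<notin> X \<union> ?P"
    proof
      assume "h y \<in> X \<union> ?P"
      then obtain x where x: "x \<in> tile_map T ` cball 0 (1/2) - {pole}" "h y = h x" unfolding XuP by blast
      then have "x \<in> S2 - {pole}" using tile_map_S2[OF T] by auto
      then show False using h_inj[OF that(1) _ x(2)] x(1) that(2) by blast
    qed
    then show "h y \<in> - ?P" "h y \<notin> X" by auto
  qed
  show ?thesis
    using cases
  proof
    assume X: "X = ?I"
    have o: "h y \<in> ?O" if "y \<in> S2 - {pole}" "y \<notin> tile_map T ` cball 0 (1/2)" for y
      using outX[OF that] X IO by blast
    have "orient T 0 v" unfolding orient_def
      using v(1) v(2)[OF inX[unfolded X]] out[OF o] by simp
    then show ?thesis by blast
  next
    assume X: "X = ?O"
    have o: "h y \<in> ?I" if "y \<in> S2 - {pole}" "y \<notin> tile_map T ` cball 0 (1/2)" for y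
      using outX[OF that] X IO by blast
    have "orient T v (- v)" unfolding orient_def
      using v(1) out[OF inX[unfolded X]] v(2)[OF o] by auto
    then show ?thesis by blast
  qed
qed

lemma boundary_loop_winding:
  assumes T: "T \<in> Tiles" and os: "orient T a s"
  shows "\<And>w. cmod w < 1/2 \<Longrightarrow> tile_map T w \<noteq> pole \<Longrightarrow> winding_number (boundary_loop T i) (h (tile_map T w)) = a + s"
    and "\<And>y. y \<in> S2 - {pole} \<Longrightarrow> y \<notin> T \<union> G \<Longrightarrow> winding_number (boundary_loop T i) (h y) = a"
proof -
  fix w assume w: "cmod w < 1/2" "tile_map T w \<noteq> pole"
  have ne: "tile_map T w' \<noteq> tile_map T w" if "1/2 \<le> cmod w'" "cmod w' \<le> 1" for w'
  proof
    assume eq: "tile_map T w' = tile_map T w"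
    have "tile_map T w \<in> T" using PM_in_T[OF T tile_map[OF T], of w] w by auto
    then have "w' \<in> ball 0 1" using PM_in_T[OF T tile_map[OF T], of w'] eq that by auto
    then have "w' = w" using PM_inj[OF T tile_map[OF T]] eq w by (auto dest: inj_onD)
    then show False using w that by simp
  qed
  have "tile_map T w \<in> S2 - {pole}" using w tile_map_S2[OF T, of w] by auto
  then have "winding_number (boundary_loop T i) (h (tile_map T w)) = winding_number (half_loop T) (h (tile_map T w))"
    using boundary_half_loop[OF T] ne by blast
  then show "winding_number (boundary_loop T i) (h (tile_map T w)) = a + s"
    using os w unfolding orient_def by simp
next
  fix y assume y: "y \<in> S2 - {pole}" "y \<notin> T \<union> G"
  have ne: "tile_map T w \<noteq> y" if "cmod w \<le> 1" for w
  proof -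
    have "tile_map T w \<in> T \<union> G" by (rule subsetD[OF PM_cball[OF T tile_map[OF T]] imageI]) (use that in simp)
    then show ?thesis using y(2) by blast
  qed
  then have "winding_number (boundary_loop T i) (h y) = winding_number (half_loop T) (h y)"
    using boundary_half_loop[OF T y(1)] by blast
  moreover have "y \<notin> tile_map T ` cball 0 (1/2)"
  proof
    assume "y \<in> tile_map T ` cball 0 (1/2)"
    then obtain w where "cmod w \<le> 1/2" "y = tile_map T w" by auto
    then show False using ne[of w] by simp
  qed
  ultimately show "winding_number (boundary_loop T i) (h y) = a"
    using os y unfolding orient_def by simp
qed

section \<open>Winding numbers along a single edge\<close>

lemma boundary_path:
  assumes T: "T \<in> Tiles" shows "path (boundary_loop T i)"
  unfolding path_def boundary_loop_def
proof (rule continuous_on_compose2[OF chart_map_cont[OF T, of "sphere 0 1"]])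
  show "tile_map T w \<noteq> pole" if "w \<in> sphere 0 1" for w using that by (intro nonzero_ne_pole[OF T]) auto
qed (auto intro!: continuous_intros)

text \<open>Positive if the boundary runs along \<open>e\<close> in the direction of its
  parametrization. Comparing starting points decides this because the two ends of an edge have
  different colours.\<close>

definition dir_sign :: "(real ^ 3) set \<Rightarrow> nat \<Rightarrow> (real \<Rightarrow> real ^ 3) \<Rightarrow> complex" where
  "dir_sign T i e = (if tile_map T (corner 4 i) = e 0 then 1 else -1)"

lemma pole_notin_edge: "e \<in> E \<Longrightarrow> path_image e \<subseteq> S2 - {pole}"
  using pole_in(3) edgeD(2) unfolding G_def by blast

text \<open>The first quarter of the loop is a reparametrization of the edge or of its reverse.
  Winding numbers of open paths are invariant under homotopies with fixed ends and change sign under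
  reversal.\<close>

lemma side_winding:
  assumes c: "(T, i) \<in> covers e" and y: "y \<in> S2 - {pole}" "y \<notin> path_image e"
  shows "winding_number (subpath 0 (1/4) (boundary_loop T i)) (h y) = dir_sign T i e * winding_number (h \<circ> e) (h y)"
proof -
  have T: "T \<in> Tiles" "i < 4" "side_edge (tile_map T) i = e" using coversD[OF c] by auto
  note PMT = T(1) tile_map[OF T(1)]
  have eE: "e \<in> E" using side_edge(1)[OF PMT T(2)] T(3) by simp
  let ?q = "subpath 0 (1/4) (boundary_loop T i)"
  have q: "?q t = h (tile_map T (ang (real i + t)))" for t
    by (simp add: subpath_def boundary_loop_def chart_map_def)
  have pq: "path ?q" using boundary_path[OF T(1)] by (intro path_subpath) auto
  obtain \<theta> where th: "continuous_on UNIV \<theta>" "inj \<theta>" "\<theta> ` {0<..<1} = {0<..<1::real}"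
    "\<forall>t\<in>{0..1}. e t = tile_map T (ang (real i + \<theta> t))" "(\<theta> 0 = 0 \<and> \<theta> 1 = 1) \<or> (\<theta> 0 = 1 \<and> \<theta> 1 = 0)"
    using side_param[OF PMT T(2)] unfolding T(3) by metis
  have th01: "\<theta> ` {0..1} = {0..1}"
  proof -
    have "{0..1::real} = {0<..<1} \<union> {0, 1}" by auto
    then have "\<theta> ` {0..1} = {0<..<1} \<union> {\<theta> 0, \<theta> 1}" by (simp only: image_Un th(3)) simp
    then show ?thesis using th(5) by auto
  qed
  have qe: "path_image ?q \<subseteq> - {h y}"
  proof
    fix z assume "z \<in> path_image ?q"
    then obtain t where t: "t \<in> {0..1}" "z = h (tile_map T (ang (real i + t)))" unfolding path_image_def using q by auto
    then have "t \<in> \<theta> ` {0..1}" using th01 by simp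
    then obtain t' where "t' \<in> {0..1}" "t = \<theta> t'" by blast
    then have z: "z = h (e t')" "e t' \<in> path_image e" using t th(4) by (auto simp: path_image_def)
    have "e t' \<in> S2 - {pole}" using pole_notin_edge[OF eE] z(2) by (rule subsetD)
    moreover have "e t' \<noteq> y" using z(2) y(2) by metis
    ultimately have "h (e t') \<noteq> h y" using h_inj[OF _ y(1)] by metis
    then show "z \<in> - {h y}" using z(1) by simp
  qed
  have pe: "path (h \<circ> e)"
    using edgeD(1)[OF eE] pole_notin_edge[OF eE] h_cont
    by (intro path_continuous_image) (auto simp: simple_path_def intro: continuous_on_subset)
  have ye: "h y \<notin> path_image (h \<circ> e)"
  proof
    assume "h y \<in> path_image (h \<circ> e)"
    then have "h y \<in> h ` path_image e" by (auto simp: path_image_def)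
    then obtain x where "x \<in> path_image e" "h y = h x" by blast
    then have "x \<in> S2 - {pole}" using pole_notin_edge[OF eE] by blast
    then have "y = x" using h_inj[OF y(1)] \<open>h y = h x\<close> by metis
    then show False using y(2) \<open>x \<in> path_image e\<close> by metis
  qed
  from th(5) show ?thesis
  proof
    assume th0: "\<theta> 0 = 0 \<and> \<theta> 1 = 1"
    have "homotopic_paths (- {h y}) ?q (h \<circ> e)"
    proof (rule homotopic_paths_reparametrize[OF pq qe, of \<theta>])
      show "continuous_on {0..1} \<theta>" using th(1) continuous_on_subset by blast
      show "(h \<circ> e) t = ?q (\<theta> t)" if "t \<in> {0..1}" for t using that th(4) by (simp add: q)
    qed (use th01 th0 in auto)
    then have "winding_number ?q (h y) = winding_number (h \<circ> e) (h y)"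
      by (rule winding_number_homotopic_paths)
    moreover have "dir_sign T i e = 1" using bspec[OF th(4), of 0] th0 by (simp add: dir_sign_def corner_4)
    ultimately show ?thesis by simp
  next
    assume th0: "\<theta> 0 = 1 \<and> \<theta> 1 = 0"
    have "homotopic_paths (- {h y}) ?q (reversepath (h \<circ> e))"
    proof (rule homotopic_paths_reparametrize[OF pq qe, of "\<lambda>t. \<theta> (1 - t)"])
      show "continuous_on {0..1} (\<lambda>t. \<theta> (1 - t))"
        by (rule continuous_on_compose2[OF th(1)]) (auto intro: continuous_intros)
      show "reversepath (h \<circ> e) t = ?q (\<theta> (1 - t))" if "t \<in> {0..1}" for t
        using that bspec[OF th(4), of "1 - t"] by (simp add: q reversepath_def)
      show "(\<lambda>t. \<theta> (1 - t)) \<in> {0..1} \<rightarrow> {0..1}"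
      proof
        fix t :: real assume "t \<in> {0..1}"
        then have "1 - t \<in> {0..1}" by auto
        then show "\<theta> (1 - t) \<in> {0..1}" using th01 by blast
      qed
    qed (use th0 in auto)
    then have "winding_number ?q (h y) = winding_number (reversepath (h \<circ> e)) (h y)"
      by (rule winding_number_homotopic_paths)
    then have "winding_number ?q (h y) = - winding_number (h \<circ> e) (h y)"
      using winding_number_reversepath[OF pe ye] by simp
    moreover have "dir_sign T i e = -1"
    proof -
      have "e 0 = tile_map T (corner 4 ((i + 1) mod 4))" using bspec[OF th(4), of 0] th0 ang_Suc_corner[OF T(2)] by simp
      then show ?thesis using colour_corner[OF PMT T(2)] unfolding dir_sign_def by metis
    qed
    ultimately show ?thesis by simp
  qed
qed

text \<open>By \<open>sides_distinct\<close> no other side of the tile lies on \<open>e\<close>, so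
  the rest of the loop keeps off the open edge.\<close>

lemma rest_image:
  assumes c: "(T, i) \<in> covers e"
  shows "path_image (subpath (1/4) 1 (boundary_loop T i)) \<subseteq> h ` (G - open_edge e)"
proof
  have T: "T \<in> Tiles" "i < 4" "side_edge (tile_map T) i = e" using coversD[OF c] by auto
  note PMT = T(1) tile_map[OF T(1)]
  have eE: "e \<in> E" using side_edge(1)[OF PMT T(2)] T(3) by simp
  fix z assume "z \<in> path_image (subpath (1/4) 1 (boundary_loop T i))"
  then obtain t where t: "t \<in> {0..1}" "z = h (tile_map T (ang (real i + 4 * ((1 - 1/4) * t + 1/4))))"
    by (auto simp: path_image_def subpath_def boundary_loop_def chart_map_def)
  \<comment> \<open>The other three sides occupy the angles from \<open>i + 1\<close> to
    \<open>i + 4\<close>; angles from 4 on are reduced by a full turn below.\<close>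
  define x where "x = real i + 1 + 3 * t"
  have z: "z = h (tile_map T (ang x))" and x: "real i + 1 \<le> x" "x \<le> real i + 4"
    using t by (auto simp: x_def algebra_simps)
  have "tile_map T (ang x) \<notin> open_edge e"
  proof
    assume "tile_map T (ang x) \<in> open_edge e"
    then obtain j where j: "j < 4" "ang x \<in> side 4 j" "side_edge (tile_map T) j = e"
      using PM_in_edge[OF PMT, of "ang x" e] eE by auto
    have "j = i" using sides_distinct[OF PMT j(1) T(2)] j(3) T(3) by metis
    then obtain u where u: "u \<in> {0<..<1}" "ang x = ang (real i + u)" using j(2) unfolding side_4' by auto
    have iu: "real i + u \<in> {0..<4}" using u T(2) by auto
    show False
    proof (cases "x < 4")
      case True
      then have "x = real i + u" using ang_inj[OF u(2) _ iu] x by auto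
      then show False using x u by simp
    next
      case False
      have "ang (x - 4) = ang (real i + u)" using ang_4[of "x - 4"] u(2) by simp
      then have "x - 4 = real i + u" using ang_inj[OF _ _ iu] x False T(2) by auto
      then show False using x u by simp
    qed
  qed
  moreover have "tile_map T (ang x) \<in> G" using PM_sphere[OF PMT] by auto
  ultimately show "z \<in> h ` (G - open_edge e)" using z by blast
qed

lemma rest_ends:
  assumes "i < 4"
  shows "pathstart (subpath (1/4) 1 (boundary_loop T i)) = h (tile_map T (corner 4 ((i + 1) mod 4)))"
    "pathfinish (subpath (1/4) 1 (boundary_loop T i)) = h (tile_map T (corner 4 i))"
  using ang_Suc_corner[OF assms] ang_4[of "real i"]
  by (simp_all add: pathstart_def pathfinish_def subpath_def boundary_loop_def chart_map_def corner_4 add.commute)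

lemma boundary_split:
  assumes c: "(T, i) \<in> covers e" and y: "y \<in> S2 - {pole}" "y \<notin> G"
  shows "winding_number (boundary_loop T i) (h y) = dir_sign T i e * winding_number (h \<circ> e) (h y)
    + winding_number (subpath (1/4) 1 (boundary_loop T i)) (h y)"
proof -
  have T: "T \<in> Tiles" "i < 4" "side_edge (tile_map T) i = e" using coversD[OF c] by auto
  note PMT = T(1) tile_map[OF T(1)]
  have eE: "e \<in> E" using side_edge(1)[OF PMT T(2)] T(3) by simp
  have "h y \<notin> path_image (boundary_loop T i)"
  proof
    assume "h y \<in> path_image (boundary_loop T i)"
    then obtain x where x: "h y = h (tile_map T (ang x))" unfolding path_image_def boundary_loop_def chart_map_def by auto
    have xG: "tile_map T (ang x) \<in> G" using PM_sphere[OF PMT] by auto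
    then have "tile_map T (ang x) \<in> S2 - {pole}" using G_sub_chart by (rule subsetD[rotated])
    then have "y = tile_map T (ang x)" using h_inj[OF y(1) _ x] by blast
    then show False using xG y(2) by metis
  qed
  then have "winding_number (boundary_loop T i) (h y) = winding_number (subpath 0 (1/4) (boundary_loop T i)) (h y)
    + winding_number (subpath (1/4) 1 (boundary_loop T i)) (h y)"
    using winding_number_subpath_combine[OF boundary_path[OF T(1)], of "h y" i 0 "1/4" 1] by simp
  moreover have "y \<notin> path_image e" using y(2) eE unfolding G_def by blast
  ultimately show ?thesis using side_winding[OF c y(1)] by simp
qed

text \<open>With suitable signs, the parts of the two boundary loops that run along \<open>e\<close> cancel. The remaining parts
  form a closed curve off the open edge, whose winding number does not change across \<open>e\<close>.\<close>

lemma edge_orient: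
  assumes c: "(T, i) \<in> covers e" "(T', j) \<in> covers e" "T \<noteq> T'" and os: "orient T a s" "orient T' a' s'"
  shows "dir_sign T i e * s + dir_sign T' j e * s' = 0"
proof -
  have T: "T \<in> Tiles" "i < 4" "side_edge (tile_map T) i = e" and T': "T' \<in> Tiles" "j < 4" "side_edge (tile_map T') j = e"
    using coversD[OF c(1)] coversD[OF c(2)] by auto
  note PMT = T(1) tile_map[OF T(1)] and PMT' = T'(1) tile_map[OF T'(1)]
  have eE: "e \<in> E" using side_edge(1)[OF PMT T(2)] T(3) by simp
  define N where "N = tile_map T ` sector i \<union> open_edge e \<union> tile_map T' ` sector j"
  have cN: "connected N" unfolding N_def using covers_glue(2)[OF c(1,2)] c(3) by simp
  have sec_p: "tile_map X w \<noteq> pole" "tile_map X w \<in> X" if X: "X \<in> Tiles" and ws: "w \<in> sector n" for X w n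
  proof -
    obtain r x where "0 < r" "w = of_real r * ang x" using ws unfolding sector_def by blast
    then have "cmod w = r" "r > 0" by (simp_all add: norm_mult)
    then have "w \<in> ball 0 1" "w \<noteq> 0" using ws sector_ball[of n] by auto
    then show "tile_map X w \<noteq> pole" "tile_map X w \<in> X"
      using nonzero_ne_pole[OF X, of w] PM_in_T[OF X tile_map[OF X], of w] by auto
  qed
  have sub1: "tile_map T ` sector i \<subseteq> T - {pole}" using sec_p[OF T(1), of _ i] by (intro image_subsetI) simp
  have sub2: "tile_map T' ` sector j \<subseteq> T' - {pole}" using sec_p[OF T'(1), of _ j] by (intro image_subsetI) simp
  have sub3: "open_edge e \<subseteq> G - {pole}" using open_edge_G[OF eE] pole_in(3) by blast
  have N_sub: "N \<subseteq> S2 - {pole}"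
    using sub1 sub2 sub3 tile_sub[OF T(1)] tile_sub[OF T'(1)] GS unfolding N_def by blast
  have NG: "N \<inter> (G - open_edge e) = {}"
    using sub1 sub2 tile_sub[OF T(1)] tile_sub[OF T'(1)] unfolding N_def by blast
  have chN: "connected (h ` N)"
    using connected_continuous_image[OF continuous_on_subset[OF h_cont N_sub] cN] .
  let ?R = "subpath (1/4) 1 (boundary_loop T i)" and ?R' = "subpath (1/4) 1 (boundary_loop T' j)"
  have pR: "path ?R" "path ?R'"
    using boundary_path[OF T(1)] boundary_path[OF T'(1)] by (auto intro!: path_subpath)
  have hN: "h y \<notin> h ` (G - open_edge e)" if "y \<in> N" for y
  proof
    assume "h y \<in> h ` (G - open_edge e)"
    then obtain x where x: "x \<in> G - open_edge e" "h y = h x" by blast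
    have "y \<in> S2 - {pole}" "x \<in> S2 - {pole}" using N_sub that G_sub_chart x(1) by blast+
    then have "y = x" using h_inj x(2) by metis
    then show False using NG that x(1) by blast
  qed
  have RN: "h ` N \<inter> path_image ?R = {}" "h ` N \<inter> path_image ?R' = {}"
    using rest_image[OF c(1)] rest_image[OF c(2)] hN by blast+
  define \<epsilon> where "\<epsilon> = dir_sign T i e"
  define \<epsilon>' where "\<epsilon>' = dir_sign T' j e"
  have eps: "\<epsilon> = 1 \<or> \<epsilon> = -1" "\<epsilon>' = 1 \<or> \<epsilon>' = -1" unfolding \<epsilon>_def \<epsilon>'_def dir_sign_def by auto
  have const: "winding_number ?R (h y) - \<epsilon> * \<epsilon>' * winding_number ?R' (h y) =
      winding_number ?R (h z) - \<epsilon> * \<epsilon>' * winding_number ?R' (h z)" if yz: "y \<in> N" "z \<in> N" for y z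
  proof -
    have ny: "h x \<notin> path_image ?R" "h x \<notin> path_image ?R'" if "x \<in> N" for x using RN that by auto
    note ends = side_edge_ends[OF PMT T(2)] side_edge_ends[OF PMT' T'(2)]
    have ne: "e 0 \<noteq> e 1" using colour[OF eE] by metis
    show ?thesis
    proof (cases "\<epsilon> = \<epsilon>'")
      case True
      then have "tile_map T (corner 4 i) = tile_map T' (corner 4 j)" "tile_map T (corner 4 ((i + 1) mod 4)) = tile_map T' (corner 4 ((j + 1) mod 4))"
        using ends ne unfolding T(3) T'(3) \<epsilon>_def \<epsilon>'_def dir_sign_def by (auto split: if_splits)
      then have fin: "pathfinish ?R = pathfinish ?R'" "pathstart ?R = pathstart ?R'"
        using rest_ends[OF T(2)] rest_ends[OF T'(2)] by simp_all
      let ?L = "?R +++ reversepath ?R'"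
      have w: "winding_number ?L (h x) = winding_number ?R (h x) - winding_number ?R' (h x)" if "x \<in> N" for x
        using winding_number_join[of ?R "h x" "reversepath ?R'"] winding_number_reversepath[of ?R' "h x"] pR fin ny[OF that] by simp
      have "winding_number ?L (h y) = winding_number ?L (h z)"
        by (rule winding_number_eq[of _ _ "h ` N"]) (use pR fin chN yz RN in \<open>auto simp: path_image_join\<close>)
      moreover have "\<epsilon> * \<epsilon>' = 1" using True eps by auto
      ultimately show ?thesis using w yz by simp
    next
      case False
      then have "tile_map T (corner 4 i) = tile_map T' (corner 4 ((j + 1) mod 4))" "tile_map T (corner 4 ((i + 1) mod 4)) = tile_map T' (corner 4 j)"
        using ends ne unfolding T(3) T'(3) \<epsilon>_def \<epsilon>'_def dir_sign_def by (auto split: if_splits)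
      then have fin: "pathfinish ?R = pathstart ?R'" "pathstart ?R = pathfinish ?R'"
        using rest_ends[OF T(2)] rest_ends[OF T'(2)] by simp_all
      let ?L = "?R +++ ?R'"
      have w: "winding_number ?L (h x) = winding_number ?R (h x) + winding_number ?R' (h x)" if "x \<in> N" for x
        using winding_number_join[of ?R "h x" ?R'] pR fin ny[OF that] by simp
      have "winding_number ?L (h y) = winding_number ?L (h z)"
        by (rule winding_number_eq[of _ _ "h ` N"]) (use pR fin chN yz RN in \<open>auto simp: path_image_join\<close>)
      moreover have "\<epsilon> * \<epsilon>' = -1" using False eps by auto
      ultimately show ?thesis using w yz by simp
    qed
  qed
  have pt: "of_real (1/4) * ang (real n + 1/2) \<in> sector n" for n
    unfolding sector_def mem_Collect_eq by (intro exI[of _ "1/4"] exI[of _ "real n + 1/2"] conjI refl) auto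
  have ptn: "cmod (of_real (1/4) * ang (real n + 1/2)) < 1/2" for n by (simp add: norm_mult)
  \<comment> \<open>Radius 1/4 keeps the sample points inside the disk of radius 1/2, where
    \<open>orient\<close> gives the value \<open>a + s\<close>, and off the centre, which may be the
    pole.\<close>
  define w1 where "w1 = of_real (1/4) * ang (real i + 1/2)"
  define w2 where "w2 = of_real (1/4) * ang (real j + 1/2)"
  have w: "w1 \<in> sector i" "cmod w1 < 1/2" "w2 \<in> sector j" "cmod w2 < 1/2"
    using pt ptn unfolding w1_def w2_def by blast+
  define y1 where "y1 = tile_map T w1"
  define y2 where "y2 = tile_map T' w2"
  have yN: "y1 \<in> N" "y2 \<in> N" unfolding y1_def y2_def N_def using w by auto
  have yT: "y1 \<in> T" "y2 \<in> T'" unfolding y1_def y2_def using sec_p[OF T(1) w(1)] sec_p[OF T'(1) w(3)] by auto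
  have y1: "y1 \<in> S2 - {pole}" "y1 \<notin> G" "y1 \<notin> T' \<union> G" and y2: "y2 \<in> S2 - {pole}" "y2 \<notin> G" "y2 \<notin> T \<union> G"
    using yT yN N_sub tile_sub[OF T(1)] tile_sub[OF T'(1)] tiles_disjoint[OF T(1) T'(1) c(3)] by blast+
  have 1: "winding_number (boundary_loop T i) (h y1) = a + s"
    unfolding y1_def using boundary_loop_winding(1)[OF T(1) os(1)] w(2) sec_p(1)[OF T(1) w(1)] by blast
  have 2: "winding_number (boundary_loop T' j) (h y2) = a' + s'"
    unfolding y2_def using boundary_loop_winding(1)[OF T'(1) os(2)] w(4) sec_p(1)[OF T'(1) w(3)] by blast
  have 3: "winding_number (boundary_loop T i) (h y2) = a"
    using boundary_loop_winding(2)[OF T(1) os(1)] y2 by blast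
  have 4: "winding_number (boundary_loop T' j) (h y1) = a'"
    using boundary_loop_winding(2)[OF T'(1) os(2)] y1 by blast
  \<comment> \<open>Four equations, for two loops at two points. Subtracting those of the same loop
    removes \<open>a\<close> and \<open>a'\<close>; in the signed sum the terms of \<open>e\<close>
    cancel, and \<open>const\<close> removes the rests.\<close>
  note sp = boundary_split[OF c(1) y1(1,2), unfolded 1] boundary_split[OF c(1) y2(1,2), unfolded 3]
    boundary_split[OF c(2) y2(1,2), unfolded 2] boundary_split[OF c(2) y1(1,2), unfolded 4]
  show ?thesis
    using sp const[OF yN] eps unfolding \<epsilon>_def[symmetric] \<epsilon>'_def[symmetric]
    by (elim disjE) (simp_all, algebra+)
qed

end

section \<open>Selecting the sides\<close>

context quad_tiling begin

text \<open>No tile is its own neighbour across an edge, so the two jumps compared in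
  \<open>edge_orient\<close> belong to two tiles.\<close>

lemma tiles_of_distinct_covers:
  assumes "(T, i) \<in> covers e" "(T', j) \<in> covers e" "(T, i) \<noteq> (T', j)"
  shows "T \<noteq> T'"
  using assms sides_distinct[of T "tile_map T" i j] tile_map coversD by metis

lemma dir_sign_colour:
  assumes c: "(T, i) \<in> covers e"
  shows "tile_map T (corner 4 i) = e 0 \<longleftrightarrow> colour (tile_map T (corner 4 i)) = colour (e 0)"
proof -
  have T: "T \<in> Tiles" "i < 4" "side_edge (tile_map T) i = e" using coversD[OF c] by auto
  show ?thesis
    using side_edge_ends[OF T(1) tile_map[OF T(1)] T(2)] colour[OF side_edge(1)[OF T(1) tile_map[OF T(1)] T(2)]] unfolding T(3) by metis
qed

lemma ex_selection:
  "\<exists>sel. (\<forall>T\<in>Tiles. \<forall>i<4. sel T i \<longleftrightarrow> \<not> sel T ((i + 1) mod 4)) \<and>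
    (\<forall>e T i T' j. (T, i) \<in> covers e \<longrightarrow> (T', j) \<in> covers e \<longrightarrow> (T, i) \<noteq> (T', j) \<longrightarrow> sel T i \<longleftrightarrow> \<not> sel T' j)"
proof (cases "Tiles = {}")
  case False
  then obtain T0 where T0: "T0 \<in> Tiles" by blast
  have "tile_map T0 0 \<in> S2" using PM_cball_S2[OF T0 tile_map[OF T0]] by (auto simp: image_subset_iff)
  then obtain h k where hk: "homeomorphism (S2 - {tile_map T0 0}) (UNIV :: complex set) h k"
    using sphere_chart by blast
  interpret charted_tiling V E T0 h k by unfold_locales (use T0 hk in auto)
  obtain a s where as: "\<And>T. T \<in> Tiles \<Longrightarrow> orient T (a T) (s T)" using ex_orient by metis
  have s: "s T = 1 \<or> s T = -1" if "T \<in> Tiles" for T using as[OF that] unfolding orient_def by blast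
  \<comment> \<open>For \<open>s T = 1\<close> the side starts at corner \<open>i\<close>. For
    \<open>s T = -1\<close> the traversal is reversed and starts at the next corner, which has the
    other colour. In both cases the selected sides start at colour \<open>True\<close>.\<close>
  define sel where "sel T i \<longleftrightarrow> (colour (tile_map T (corner 4 i)) \<longleftrightarrow> s T = 1)" for T i
  have "sel T i \<longleftrightarrow> \<not> sel T ((i + 1) mod 4)" if "T \<in> Tiles" "i < 4" for T i
    using colour_corner[OF that(1) tile_map[OF that(1)] that(2)] unfolding sel_def by metis
  moreover have "sel T i \<longleftrightarrow> \<not> sel T' j"
    if c: "(T, i) \<in> covers e" "(T', j) \<in> covers e" "(T, i) \<noteq> (T', j)" for e T i T' j
  proof -
    have T: "T \<in> Tiles" "T' \<in> Tiles" using coversD c by blast+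
    have "dir_sign T i e * s T + dir_sign T' j e * s T' = 0"
      using edge_orient[OF c(1,2) tiles_of_distinct_covers[OF c] as[OF T(1)] as[OF T(2)]] .
    then have "(dir_sign T i e = 1) = (dir_sign T' j e = 1) \<longleftrightarrow> (s T = 1) \<noteq> (s T' = 1)"
      using s[OF T(1)] s[OF T(2)] by (auto simp: dir_sign_def split: if_splits)
    moreover have "dir_sign T i e = 1 \<longleftrightarrow> colour (tile_map T (corner 4 i)) = colour (e 0)"
      "dir_sign T' j e = 1 \<longleftrightarrow> colour (tile_map T' (corner 4 j)) = colour (e 0)"
      using dir_sign_colour[OF c(1)] dir_sign_colour[OF c(2)] unfolding dir_sign_def by auto
    ultimately show ?thesis unfolding sel_def by metis
  qed
  ultimately show ?thesis by (intro exI[of _ sel]) blast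
next
  case True
  then show ?thesis using coversD by blast
qed

section \<open>The arcs of the subdivision\<close>

lemma arc_chord:
  assumes "z \<in> sphere (0::complex) 1" "w \<in> sphere 0 1" "z \<noteq> w"
  shows "arc (linepath z w)" "linepath z w ` {0<..<1} \<subseteq> ball 0 1"
proof -
  show "arc (linepath z w)" using assms by simp
  show "linepath z w ` {0<..<1} \<subseteq> ball 0 1"
  proof (rule image_subsetI)
    fix t :: real assume "t \<in> {0<..<1}"
    then have "linepath z w t \<in> open_segment z w"
      using assms(3) unfolding linepath_def in_segment by auto
    then have "dist 0 (linepath z w t) < dist 0 z \<or> dist 0 (linepath z w t) < dist 0 w"
      by (rule dist_decreases_open_segment)
    then show "linepath z w t \<in> ball 0 1" using assms by auto
  qed
qed

lemma midpoint_in: "edge_midpoint g \<in> open_edge g"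
  by (auto simp: edge_midpoint_def open_edge_def)

text \<open>The point of side \<open>i\<close> over the middle point of the edge; it depends on the
  boundary parametrization and need not bisect the side of the model disk.\<close>

definition mid :: "(real ^ 3) set \<Rightarrow> nat \<Rightarrow> complex" where
  "mid T i = (SOME z. z \<in> side 4 i \<and> tile_map T z = edge_midpoint (side_edge (tile_map T) i))"

lemma mid:
  assumes "T \<in> Tiles" "i < 4"
  shows "mid T i \<in> side 4 i" "tile_map T (mid T i) = edge_midpoint (side_edge (tile_map T) i)"
proof -
  have "edge_midpoint (side_edge (tile_map T) i) \<in> tile_map T ` side 4 i"
    using midpoint_in side_edge(2)[OF assms(1) tile_map[OF assms(1)] assms(2)] by metis
  then have "\<exists>z. z \<in> side 4 i \<and> tile_map T z = edge_midpoint (side_edge (tile_map T) i)" by auto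
  then have "mid T i \<in> side 4 i \<and> tile_map T (mid T i) = edge_midpoint (side_edge (tile_map T) i)"
    unfolding mid_def by (rule someI_ex)
  then show "mid T i \<in> side 4 i" "tile_map T (mid T i) = edge_midpoint (side_edge (tile_map T) i)" by auto
qed

lemma edge_midpoint_inj: "g \<in> E \<Longrightarrow> g' \<in> E \<Longrightarrow> edge_midpoint g = edge_midpoint g' \<Longrightarrow> g = g'"
  using edges_disjoint[of g g'] midpoint_in[of g] midpoint_in[of g'] by auto

lemma tiling_subdivisible: "subdivisible S2 V E"
proof -
  obtain sel where sel: "\<And>T i. T \<in> Tiles \<Longrightarrow> i < 4 \<Longrightarrow> sel T i \<longleftrightarrow> \<not> sel T ((i + 1) mod 4)"
    "\<And>e T i T' j. (T, i) \<in> covers e \<Longrightarrow> (T', j) \<in> covers e \<Longrightarrow> (T, i) \<noteq> (T', j) \<Longrightarrow> sel T i \<longleftrightarrow> \<not> sel T' j"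
    using ex_selection by metis
  \<comment> \<open>Selection alternates around the tile, so the selected sides are 0 and 2, or 1
    and 3.\<close>
  define first :: "(real ^ 3) set \<Rightarrow> nat" where "first T = (if sel T 0 then 0 else 1)" for T
  have first: "first T \<in> {0, 1}" "first T < 4" "first T + 2 < 4" for T unfolding first_def by auto
  have sel_iff: "sel T i \<longleftrightarrow> i = first T \<or> i = first T + 2" if "T \<in> Tiles" "i < 4" for T i
  proof -
    have "sel T 0 \<longleftrightarrow> \<not> sel T 1" "sel T 1 \<longleftrightarrow> \<not> sel T 2" "sel T 2 \<longleftrightarrow> \<not> sel T 3"
      using sel(1)[OF that(1), of 0] sel(1)[OF that(1), of 1] sel(1)[OF that(1), of 2] by (simp_all del: One_nat_def)
    then show ?thesis using less_4_cases[OF that(2)] unfolding first_def by (elim disjE) (simp_all del: One_nat_def)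
  qed
  define P where "P T = linepath (mid T (first T)) (mid T (first T + 2))" for T
  have ends: "P T 0 = mid T (first T)" "P T 1 = mid T (first T + 2)" for T
    unfolding P_def by (simp_all add: linepath_def)
  have "simple_pentagonal_subdivision S2 V E tile_map P"
    unfolding simple_pentagonal_subdivision_def
  proof (intro conjI ballI)
    fix T assume T: "T \<in> Tiles"
    note m = mid[OF T first(2)[of T]] mid[OF T first(3)[of T]]
    have "mid T (first T) \<noteq> mid T (first T + 2)"
      using m(1,3) side_disjoint[OF first(2)[of T] first(3)[of T]] by auto
    note ch = arc_chord[OF _ _ this]
    show "PM T (tile_map T)" using tile_map[OF T] .
    show "arc (P T)" "P T ` {0<..<1} \<subseteq> ball 0 1"
      unfolding P_def using ch m(1,3) side_sphere by blast+
    show "\<exists>i\<in>{0, 1}. pathstart (P T) \<in> side 4 i \<and> pathfinish (P T) \<in> side 4 (i + 2)"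
      using first(1)[of T] m unfolding P_def by (intro bexI[of _ "first T"]) auto
    show "tile_map T (pathstart (P T)) \<in> edge_midpoint ` E" "tile_map T (pathfinish (P T)) \<in> edge_midpoint ` E"
      unfolding P_def using m side_edge(1)[OF T tile_map[OF T]] first[of T] by auto
  next
    fix g assume g: "g \<in> E"
    \<comment> \<open>The side on which end \<open>b\<close> of the arc lies; hitting the middle
      point of \<open>g\<close> then means that this side lies on \<open>g\<close>.\<close>
    define sd where "sd T b = (if b = (0::real) then first T else first T + 2)" for T b
    have sd4: "sd T b < 4" for T b using first[of T] unfolding sd_def by auto
    have iff: "tile_map T (P T b) = edge_midpoint g \<longleftrightarrow> (T, sd T b) \<in> covers g" if T: "T \<in> Tiles" and b: "b \<in> {0, 1}" for T b
    proof -
      have "P T b = mid T (sd T b)" using b ends unfolding sd_def by auto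
      then have "tile_map T (P T b) = edge_midpoint (side_edge (tile_map T) (sd T b))" using mid(2)[OF T sd4] by simp
      then show ?thesis
        using edge_midpoint_inj[OF side_edge(1)[OF T tile_map[OF T] sd4] g] T sd4[of T b] unfolding covers_def by auto
    qed
    let ?S = "{(T, b). T \<in> Tiles \<and> b \<in> {0, 1} \<and> tile_map T (P T b) = edge_midpoint g}"
    have S_eq: "?S = {(T, b). T \<in> Tiles \<and> b \<in> {0, 1} \<and> (T, sd T b) \<in> covers g}" using iff by blast
    obtain X i Y j where XY: "covers g = {(X, i), (Y, j)}" "(X, i) \<noteq> (Y, j)" using covers_pair[OF g] .
    then have "\<exists>T i. (T, i) \<in> covers g \<and> sel T i" using sel(2)[of X i g Y j] by blast
    then obtain T i where Ti: "(T, i) \<in> covers g" "sel T i" by blast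
    have T: "T \<in> Tiles" "i < 4" using coversD[OF Ti(1)] by auto
    define b :: real where "b = (if i = first T then 0 else 1)"
    have b01: "b \<in> {0, 1}" unfolding b_def by auto
    have i: "i = sd T b" using sel_iff[OF T] Ti(2) unfolding b_def sd_def by auto
    \<comment> \<open>Ends of arcs lie on selected sides only, and of the two tile sides at
      \<open>g\<close> just one is selected.\<close>
    have uniq: "T' = T \<and> b' = b" if c: "T' \<in> Tiles" "b' \<in> {0, 1}" "(T', sd T' b') \<in> covers g" for T' b'
    proof -
      have "sel T' (sd T' b')" using sel_iff[OF c(1) sd4] unfolding sd_def by auto
      then have eq: "(T', sd T' b') = (T, i)" using sel(2)[OF c(3) Ti(1)] Ti(2) by blast
      then have "sd T b' = sd T b" using i by auto
      then have "b' = b" using c(2) b01 unfolding sd_def by (auto split: if_splits)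
      then show ?thesis using eq by auto
    qed
    have "?S = {(T, b)}"
      unfolding S_eq
    proof (intro equalityI subsetI)
      fix q assume "q \<in> {(T, b). T \<in> Tiles \<and> b \<in> {0, 1} \<and> (T, sd T b) \<in> covers g}"
      then obtain T' b' where "q = (T', b')" "T' \<in> Tiles" "b' \<in> {0, 1}" "(T', sd T' b') \<in> covers g" by blast
      then show "q \<in> {(T, b)}" using uniq[of T' b'] by simp
    next
      fix q assume "q \<in> {(T, b)}"
      then show "q \<in> {(T, b). T \<in> Tiles \<and> b \<in> {0, 1} \<and> (T, sd T b) \<in> covers g}"
        using T(1) Ti(1) i b01 by simp
    qed
    then show "card ?S = 1" by simp
  qed
  then show ?thesis unfolding subdivisible_def by blast
qed

end

theorem theorem2p5:
  fixes V :: "(real ^ 3) set" and E :: "(real \<Rightarrow> real ^ 3) set"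
  assumes "quadrilateral_tiling (sphere 0 1) V E"
  shows "(\<forall>T\<in>tiles (sphere 0 1) V E. is_Q V E T \<or> is_Q13 V E T) \<and>
         subdivisible (sphere 0 1) V E"
proof -
  interpret quad_tiling V E by unfold_locales (use assms in \<open>simp add: S2_def\<close>)
  show ?thesis using tile_Q_or_Q13 tiling_subdivisible unfolding S2_def by blast
qed

end
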